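(* Let $U$ be a ground set with $n$ elements, $d \in \mathbb{N}$ a constant, and $\mathcal{F} = \mathcal{F}_0$ a family of subsets of $U$ each of size at most $d$; let $U_0 = U$, let $k$ be a positive integer and $c>0$. For each $i \in \{1,\dots,k\}$ let $S_i \subseteq U_{i-1}$, let $\mathcal{F}_i$ be the subfamily of $\mathcal{F}_{i-1}$ obtained by deleting all sets in $\mathcal{F}_{i-1}$ that intersect $S_i$, and let $U_i = U_{i-1} \setminus S_i$. Suppose that, given access to $U_{i-1}$ and $\mathcal{F}_{i-1}$, membership in $S_i$ can be determined using $O(c\log n)$ bits of space. Then, given read-only access to $\mathcal{F}$, for each $i \in \{1,\dots,k\}$ one can enumerate, and answer membership queries for, each of $S_i$, $U_i$ and $\mathcal{F}_i$ in time $n^{O(ic)}$ using $O(ic \log n)$ bits of space.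
   Context: Model of computation: word RAM with words of $O(\log n)$ bits; the input is given in a canonical encoding and is read-only; output is written to a write-only stream; space is measured as the number of bits of auxiliary read-write memory used. "Enumerate" means producing the elements one after another. *)

theory Defs
  imports Complex_Main "HOL-Library.List_Lexorder"
begin

text \<open>
  A program is a finite list of instructions over a read-write memory of \<open>w\<close>-bit words.
  The first argument of an instruction that produces a value is the address of the target cell;
  \<open>Load\<close>, \<open>Store\<close> and \<open>Read\<close> (which accesses the input) use the content of a cell as an address.
\<close>

datatype binop = Add | Sub | Mul | Div | Mod | And | Or | Xor | Shl | Shr | Less | Equal

datatype instr =
    Const nat nat
  | Op binop nat nat nat
  | Load nat nat
  | Store nat nat
  | Read nat nat
  | Write nat
  | Jump nat
  | JumpZero nat nat

type_synonym program = "instr list"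

text \<open>The value before reduction modulo \<open>2 ^ w\<close>; subtraction wraps around.\<close>

fun binop_val :: "nat \<Rightarrow> binop \<Rightarrow> nat \<Rightarrow> nat \<Rightarrow> nat" where
  "binop_val w Add x y = x + y"
| "binop_val w Sub x y = x + 2 ^ w - y"
| "binop_val w Mul x y = x * y"
| "binop_val w Div x y = x div y"
| "binop_val w Mod x y = x mod y"
| "binop_val w And x y = and x y"
| "binop_val w Or x y = or x y"
| "binop_val w Xor x y = xor x y"
| "binop_val w Shl x y = push_bit y x"
| "binop_val w Shr x y = drop_bit y x"
| "binop_val w Less x y = of_bool (x < y)"
| "binop_val w Equal x y = of_bool (x = y)"

text \<open>
  \<open>hi\<close> is one more than the largest memory address accessed so far.  It never decreases, so its
  final value determines the space of the whole run.  The input and the output are not part of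
  the memory.
\<close>

record config =
  pc :: nat
  mem :: "nat \<Rightarrow> nat"
  hi :: nat
  out :: "nat list"

definition init :: config where
  "init = \<lparr>pc = 0, mem = (\<lambda>_. 0), hi = 0, out = []\<rparr>"

fun accessed :: "(nat \<Rightarrow> nat) \<Rightarrow> instr \<Rightarrow> nat set" where
  "accessed m (Const k v) = {k}"
| "accessed m (Op f k i j) = {k, i, j}"
| "accessed m (Load k i) = {k, i, m i}"
| "accessed m (Store i j) = {i, j, m i}"
| "accessed m (Read k i) = {k, i}"
| "accessed m (Write i) = {i}"
| "accessed m (Jump l) = {}"
| "accessed m (JumpZero i l) = {i}"

fun new_mem :: "nat \<Rightarrow> nat list \<Rightarrow> (nat \<Rightarrow> nat) \<Rightarrow> instr \<Rightarrow> nat \<Rightarrow> nat" where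
  "new_mem w inp m (Const k v) = m(k := take_bit w v)"
| "new_mem w inp m (Op f k i j) = m(k := take_bit w (binop_val w f (m i) (m j)))"
| "new_mem w inp m (Load k i) = m(k := m (m i))"
| "new_mem w inp m (Store i j) = m(m i := m j)"
| "new_mem w inp m (Read k i) =
     m(k := (if m i < length inp then take_bit w (inp ! m i) else 0))"
| "new_mem w inp m (Write i) = m"
| "new_mem w inp m (Jump l) = m"
| "new_mem w inp m (JumpZero i l) = m"

fun new_pc :: "(nat \<Rightarrow> nat) \<Rightarrow> nat \<Rightarrow> instr \<Rightarrow> nat" where
  "new_pc m p (Jump l) = l"
| "new_pc m p (JumpZero i l) = (if m i = 0 then l else Suc p)"
| "new_pc m p _ = Suc p"

fun written :: "(nat \<Rightarrow> nat) \<Rightarrow> instr \<Rightarrow> nat list" where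
  "written m (Write i) = [m i]"
| "written m _ = []"

definition halted :: "program \<Rightarrow> config \<Rightarrow> bool" where
  "halted P s \<longleftrightarrow> length P \<le> pc s"

definition step :: "nat \<Rightarrow> nat list \<Rightarrow> program \<Rightarrow> config \<Rightarrow> config" where
  "step w inp P s =
     (if halted P s then s
      else let I = P ! pc s; m = mem s in
        \<lparr>pc = new_pc m (pc s) I,
         mem = new_mem w inp m I,
         hi = Max (insert (hi s) (Suc ` accessed m I)),
         out = out s @ written m I\<rparr>)"

definition run :: "nat \<Rightarrow> nat list \<Rightarrow> program \<Rightarrow> nat \<Rightarrow> config" where
  "run w inp P t = (step w inp P ^^ t) init"

text \<open>Halting with output \<open>ys\<close>, using at most \<open>sp\<close> bits of memory, and within \<open>T\<close> steps.\<close>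

definition runs_in_space ::
    "nat \<Rightarrow> program \<Rightarrow> nat list \<Rightarrow> nat list \<Rightarrow> real \<Rightarrow> bool" where
  "runs_in_space w P inp ys sp \<longleftrightarrow>
     (\<exists>t. halted P (run w inp P t) \<and> out (run w inp P t) = ys \<and>
          real (w * hi (run w inp P t)) \<le> sp)"

definition runs_within ::
    "nat \<Rightarrow> program \<Rightarrow> nat list \<Rightarrow> nat list \<Rightarrow> real \<Rightarrow> real \<Rightarrow> bool" where
  "runs_within w P inp ys T sp \<longleftrightarrow>
     (\<exists>t. real t \<le> T \<and> halted P (run w inp P t) \<and> out (run w inp P t) = ys \<and>
          real (w * hi (run w inp P t)) \<le> sp)"

text \<open>Word length \<open>O(log n)\<close>, with leading constant \<open>b\<close> and additive constant \<open>e\<close>.\<close>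

definition word_size :: "nat \<Rightarrow> nat \<Rightarrow> nat \<Rightarrow> nat" where
  "word_size b e n = b * nat \<lceil>log 2 (real n)\<rceil> + e"

definition code_elem :: "nat \<Rightarrow> nat list" where
  "code_elem x = [x]"

definition code_set :: "nat set \<Rightarrow> nat list" where
  "code_set X = card X # sorted_list_of_set X"

text \<open>
  The ground set is \<open>{..<n}\<close>; \<open>U\<close> is a subset of it and \<open>F\<close> a family of subsets.
  The members of \<open>F\<close> are listed in the lexicographic order of their codes.
\<close>

definition encode :: "nat \<Rightarrow> nat set \<Rightarrow> nat set set \<Rightarrow> nat list" where
  "encode n U F =
     n # code_set U @ card F # concat (sorted_list_of_set (code_set ` F))"

text \<open>
  On input \<open>inp\<close>, program \<open>E\<close> outputs every element of \<open>X\<close> exactly once, in some order; on a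
  query \<open>q \<in> Q\<close> prepended to \<open>inp\<close>, program \<open>M\<close> outputs the truth value of \<open>q \<in> X\<close>.
\<close>

definition enumerates_and_answers ::
    "nat \<Rightarrow> program \<Rightarrow> program \<Rightarrow> nat list \<Rightarrow> ('b \<Rightarrow> nat list) \<Rightarrow> 'b set \<Rightarrow> 'b set \<Rightarrow>
     real \<Rightarrow> real \<Rightarrow> bool" where
  "enumerates_and_answers w E M inp code Q X T sp \<longleftrightarrow>
     (\<exists>xs. distinct xs \<and> set xs = X \<and>
           runs_within w E inp (concat (map code xs)) T sp) \<and>
     (\<forall>q\<in>Q. runs_within w M (code q @ inp) [of_bool (q \<in> X)] T sp)"

primrec ground :: "'a set \<Rightarrow> (nat \<Rightarrow> 'a set) \<Rightarrow> nat \<Rightarrow> 'a set" where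
  "ground U S 0 = U"
| "ground U S (Suc i) = ground U S i - S (Suc i)"

primrec family :: "'a set set \<Rightarrow> (nat \<Rightarrow> 'a set) \<Rightarrow> nat \<Rightarrow> 'a set set" where
  "family F S 0 = F"
| "family F S (Suc i) = {X \<in> family F S i. X \<inter> S (Suc i) = {}}"

end

(*
  Membership in U_j is decided by recursion on j: x is in U_j iff it is in U_{j-1} and P_j, run on x
  and the instance (U_{j-1}, F_{j-1}), rejects.  That instance is never stored.  Whenever the simulated
  P_j reads a position of its input, the value is recomputed by a scan of the original input in which
  elements and sets are filtered by membership in U_{j-1}; the filter preserves the canonical order.
  So every level stores only the cells of P_j and a bounded number of counters.  The rest follows from
  S_i = U_{i-1} - U_i and F_i = {X in F. X is contained in U_i}.  The time bound comes for free from
  the space bound, because a terminating deterministic run never repeats a configuration.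

  The additive constant C must not grow with e: for n = 1 the bounds leave only a single cell of
  memory, and the simulated programs need e extra bits.  Hence all n up to a threshold that depends
  on e and the P_j are handled by decision trees on the input with hard-coded answers.  These exist
  because S is determined by F and the P_j.
*)

theory Submission
  imports Defs "HOL-Library.FuncSet"
begin

section \<open>Structured programs and their compilation\<close>

text \<open>The constant \<open>C\<close> occurs both in the word length
  \<open>B * clog n + C\<close> and in the space bound, so \<open>N\<close> cells cost
  \<open>N * C\<close> bits besides the logarithmic part, and all but one \<open>C\<close> must be
  charged to \<open>A * i * c * log 2 n\<close>. As \<open>A\<close> is chosen before
  \<open>e\<close>, this fails at small \<open>n\<close> for a \<open>C\<close> of the order of
  \<open>e\<close>; with the numeral 100 it works from \<open>n = 2\<close> on, where the logarithm
  is at least 1. In exchange, a simulated word of \<open>b * clog n + e\<close> bits fits into a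
  real word only when \<open>clog n\<close> is large enough compared with \<open>e\<close>. That
  \<open>A\<close> can be independent of \<open>e\<close> at all rests on counting cells instead of
  bits: a simulated word has at least \<open>log 2 n + e\<close> bits, so the space granted to
  \<open>P j\<close> amounts to at most \<open>\<bar>a\<bar> * c + 1\<close> cells. Constants are
  then paid by \<open>c \<ge> c0\<close>. At \<open>n = 1\<close> a single cell is available, and
  the trees only ask which entries of the input are zero; from \<open>n = 2\<close> on there are two
  cells, and entries can be compared with constants.\<close>

datatype com =
    Skip
  | Ins instr
  | Seq com com  (infixr ";;" 60)
  | Cond nat com com
  | While nat com

primrec clen :: "com \<Rightarrow> nat" where
  "clen Skip = 0"
| "clen (Ins I) = 1"
| "clen (c1 ;; c2) = clen c1 + clen c2"
| "clen (Cond r c1 c2) = clen c1 + clen c2 + 2"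
| "clen (While r c) = clen c + 2"

primrec comp :: "nat \<Rightarrow> com \<Rightarrow> program" where
  "comp p Skip = []"
| "comp p (Ins I) = [I]"
| "comp p (c1 ;; c2) = comp p c1 @ comp (p + clen c1) c2"
| "comp p (Cond r c1 c2) =
     JumpZero r (p + clen c1 + 2) # comp (Suc p) c1 @
     Jump (p + clen c1 + clen c2 + 2) # comp (p + clen c1 + 2) c2"
| "comp p (While r c) = JumpZero r (p + clen c + 2) # comp (Suc p) c @ [Jump p]"

lemma length_comp [simp]: "length (comp p c) = clen c"
  by (induction c arbitrary: p) auto

fun straight :: "instr \<Rightarrow> bool" where
  "straight (Jump l) = False"
| "straight (JumpZero i l) = False"
| "straight _ = True"

lemma new_pc_straight: "straight I \<Longrightarrow> new_pc m p I = Suc p"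
  by (cases I) auto

text \<open>The run stays within the cells below \<open>N\<close>; the number is that of the steps of the compiled code.\<close>

inductive exec :: "nat \<Rightarrow> nat list \<Rightarrow> nat \<Rightarrow> com \<Rightarrow> (nat \<Rightarrow> nat) \<Rightarrow> nat list \<Rightarrow> nat \<Rightarrow>
    (nat \<Rightarrow> nat) \<Rightarrow> nat list \<Rightarrow> bool" for w inp N where
  exec_Skip: "exec w inp N Skip m os 0 m os"
| exec_Ins: "straight I \<Longrightarrow> accessed m I \<subseteq> {..<N} \<Longrightarrow>
    exec w inp N (Ins I) m os 1 (new_mem w inp m I) (os @ written m I)"
| exec_Seq: "exec w inp N c1 m os t1 m1 os1 \<Longrightarrow> exec w inp N c2 m1 os1 t2 m2 os2 \<Longrightarrow>
    exec w inp N (c1 ;; c2) m os (t1 + t2) m2 os2"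
| exec_CondT: "m r \<noteq> 0 \<Longrightarrow> r < N \<Longrightarrow> exec w inp N c1 m os t m1 os1 \<Longrightarrow>
    exec w inp N (Cond r c1 c2) m os (t + 2) m1 os1"
| exec_CondF: "m r = 0 \<Longrightarrow> r < N \<Longrightarrow> exec w inp N c2 m os t m1 os1 \<Longrightarrow>
    exec w inp N (Cond r c1 c2) m os (t + 1) m1 os1"
| exec_WhileF: "m r = 0 \<Longrightarrow> r < N \<Longrightarrow> exec w inp N (While r c) m os 1 m os"
| exec_WhileT: "m r \<noteq> 0 \<Longrightarrow> r < N \<Longrightarrow> exec w inp N c m os t1 m1 os1 \<Longrightarrow>
    exec w inp N (While r c) m1 os1 t2 m2 os2 \<Longrightarrow>
    exec w inp N (While r c) m os (t1 + t2 + 2) m2 os2"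

section \<open>Runs of compiled code inside a larger program\<close>

definition steps :: "nat \<Rightarrow> nat list \<Rightarrow> program \<Rightarrow> nat \<Rightarrow> config \<Rightarrow> config" where
  "steps w inp P t s = (step w inp P ^^ t) s"

lemma steps_0 [simp]: "steps w inp P 0 s = s"
  and steps_Suc: "steps w inp P (Suc t) s = step w inp P (steps w inp P t s)"
  and steps_add: "steps w inp P (t + u) s = steps w inp P u (steps w inp P t s)"
  by (simp_all add: steps_def funpow_add add.commute[of t u])

lemma steps_Suc': "steps w inp P (Suc t) s = steps w inp P t (step w inp P s)"
  using steps_add[of w inp P 1 t s] by (simp add: steps_Suc)

lemma run_steps: "run w inp P t = steps w inp P t init"
  by (simp add: run_def steps_def)

definition inside :: "program \<Rightarrow> nat \<Rightarrow> nat set \<Rightarrow> config \<Rightarrow> bool" where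
  "inside P N A s \<longleftrightarrow> pc s \<in> A \<and> pc s < length P \<and> accessed (mem s) (P ! pc s) \<subseteq> {..<N}"

text \<open>The last configuration is exempt: its program counter has left the range of the code,
  which later serves to tell the end of a run from all earlier moments.\<close>

definition segment :: "nat \<Rightarrow> nat list \<Rightarrow> program \<Rightarrow> nat \<Rightarrow> nat set \<Rightarrow> config \<Rightarrow> nat \<Rightarrow> config \<Rightarrow> bool" where
  "segment w inp P N A s t s' \<longleftrightarrow>
     steps w inp P t s = s' \<and> (\<forall>u<t. inside P N A (steps w inp P u s))"

lemma segment_0: "segment w inp P N A s 0 s"
  by (simp add: segment_def)

lemma segment_1: "inside P N A s \<Longrightarrow> step w inp P s = s' \<Longrightarrow> segment w inp P N A s 1 s'"
  by (simp add: segment_def steps_Suc)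

lemma segment_trans:
  assumes "segment w inp P N A s t s'" "segment w inp P N A s' u s''"
  shows "segment w inp P N A s (t + u) s''"
proof -
  have "inside P N A (steps w inp P v s)" if "v < t + u" for v
  proof (cases "v < t")
    case False
    then have "v = t + (v - t)" "v - t < u" using that by auto
    then show ?thesis using assms steps_add[of w inp P t "v - t" s] by (auto simp: segment_def)
  qed (use assms in \<open>auto simp: segment_def\<close>)
  then show ?thesis using assms by (simp add: segment_def steps_add)
qed

lemma segment_mono: "segment w inp P N A s t s' \<Longrightarrow> A \<subseteq> B \<Longrightarrow> segment w inp P N B s t s'"
  by (auto simp: segment_def inside_def)

lemma step_inside:
  assumes "pc s < length P"
  shows "step w inp P s = \<lparr>pc = new_pc (mem s) (pc s) (P ! pc s), mem = new_mem w inp (mem s) (P ! pc s),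
     hi = Max (insert (hi s) (Suc ` accessed (mem s) (P ! pc s))), out = out s @ written (mem s) (P ! pc s)\<rparr>"
  using assms by (simp add: step_def halted_def Let_def)

text \<open>Jump targets are absolute, so \<open>c\<close> is compiled for the offset
  \<open>length p0\<close>, and the rule induction runs over all contexts: the jumps around a
  subcommand become part of its \<open>p0\<close> and \<open>p1\<close>. The step counts match
  because the first branch of \<open>Cond\<close> passes \<open>JumpZero\<close> and the closing
  \<open>Jump\<close>, the second only \<open>JumpZero\<close>.\<close>

lemma exec_segment:
  assumes "exec w inp N c m os t m' os'"
  shows "P = p0 @ comp (length p0) c @ p1 \<Longrightarrow> pc s = length p0 \<Longrightarrow> mem s = m \<Longrightarrow> out s = os \<Longrightarrow>
    \<exists>s'. segment w inp P N {length p0..<length p0 + clen c} s t s' \<and>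
      pc s' = length p0 + clen c \<and> mem s' = m' \<and> out s' = os'"
  using assms
proof (induction arbitrary: p0 p1 s rule: exec.induct)
  case (exec_Skip m os)
  then show ?case by (auto intro: segment_0)
next
  case (exec_Ins I m os)
  then have *: "pc s < length P" "P ! pc s = I" by auto
  have "segment w inp P N {length p0..<length p0 + 1} s 1 (step w inp P s)"
    using exec_Ins * by (intro segment_1) (auto simp: inside_def)
  then show ?case
    using exec_Ins * by (auto simp: step_inside new_pc_straight)
next
  case (exec_Seq c1 m os t1 m1 os1 c2 t2 m2 os2)
  obtain s1 where s1: "segment w inp P N {length p0..<length p0 + clen c1} s t1 s1"
    "pc s1 = length p0 + clen c1" "mem s1 = m1" "out s1 = os1"
    using exec_Seq.IH(1)[of p0 "comp (length p0 + clen c1) c2 @ p1" s] exec_Seq.prems by auto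
  obtain s2 where s2: "segment w inp P N {length p0 + clen c1..<length p0 + clen c1 + clen c2} s1 t2 s2"
    "pc s2 = length p0 + clen c1 + clen c2" "mem s2 = m2" "out s2 = os2"
    using exec_Seq.IH(2)[of "p0 @ comp (length p0) c1" p1 s1] exec_Seq.prems s1 by auto
  have "segment w inp P N {length p0..<length p0 + clen (c1 ;; c2)} s (t1 + t2) s2"
    by (rule segment_trans[OF segment_mono[OF s1(1)] segment_mono[OF s2(1)]]) auto
  then show ?case using s2 by auto
next
  case (exec_CondT m r c1 os t m1 os1 c2)
  let ?A = "{length p0..<length p0 + clen (Cond r c1 c2)}"
  have *: "pc s < length P" "P ! pc s = JumpZero r (length p0 + clen c1 + 2)"
    using exec_CondT.prems by auto
  define s0 where "s0 = step w inp P s"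
  have s0: "pc s0 = length p0 + 1" "mem s0 = m" "out s0 = os"
    using * exec_CondT.prems exec_CondT.hyps by (auto simp: s0_def step_inside)
  have 0: "segment w inp P N ?A s 1 s0"
    using * exec_CondT.prems exec_CondT.hyps s0_def by (intro segment_1) (auto simp: inside_def)
  obtain s1 where s1: "segment w inp P N {Suc (length p0)..<length p0 + 1 + clen c1} s0 t s1"
    "pc s1 = length p0 + 1 + clen c1" "mem s1 = m1" "out s1 = os1"
    using exec_CondT.IH[of "p0 @ [JumpZero r (length p0 + clen c1 + 2)]"
        "Jump (length p0 + clen c1 + clen c2 + 2) # comp (length p0 + clen c1 + 2) c2 @ p1" s0]
      exec_CondT.prems s0 by auto
  have **: "pc s1 < length P" "P ! pc s1 = Jump (length p0 + clen c1 + clen c2 + 2)"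
    using exec_CondT.prems s1 by (auto simp: nth_append)
  have 2: "segment w inp P N ?A s1 1 (step w inp P s1)"
    using ** s1 by (intro segment_1) (auto simp: inside_def)
  have "segment w inp P N ?A s (1 + (t + 1)) (step w inp P s1)"
    by (rule segment_trans[OF 0 segment_trans[OF segment_mono[OF s1(1)] 2]]) auto
  then show ?case using s1 ** by (auto simp: step_inside)
next
  case (exec_CondF m r c2 os t m1 os1 c1)
  let ?A = "{length p0..<length p0 + clen (Cond r c1 c2)}"
  have *: "pc s < length P" "P ! pc s = JumpZero r (length p0 + clen c1 + 2)"
    using exec_CondF.prems by auto
  define s0 where "s0 = step w inp P s"
  have s0: "pc s0 = length p0 + clen c1 + 2" "mem s0 = m" "out s0 = os"
    using * exec_CondF.prems exec_CondF.hyps by (auto simp: s0_def step_inside)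
  have 0: "segment w inp P N ?A s 1 s0"
    using * exec_CondF.prems exec_CondF.hyps s0_def by (intro segment_1) (auto simp: inside_def)
  obtain s1 where s1: "segment w inp P N {length p0 + clen c1 + 2..<length p0 + clen c1 + 2 + clen c2} s0 t s1"
    "pc s1 = length p0 + clen c1 + 2 + clen c2" "mem s1 = m1" "out s1 = os1"
    using exec_CondF.IH[of "p0 @ JumpZero r (length p0 + clen c1 + 2) # comp (Suc (length p0)) c1 @
        [Jump (length p0 + clen c1 + clen c2 + 2)]" p1 s0]
      exec_CondF.prems s0 by auto
  have "segment w inp P N ?A s (1 + t) s1"
    by (rule segment_trans[OF 0 segment_mono[OF s1(1)]]) auto
  then show ?case using s1 by auto
next
  case (exec_WhileF m r c os)
  have *: "pc s < length P" "P ! pc s = JumpZero r (length p0 + clen c + 2)"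
    using exec_WhileF.prems by auto
  have "segment w inp P N {length p0..<length p0 + clen (While r c)} s 1 (step w inp P s)"
    using * exec_WhileF.prems exec_WhileF.hyps by (intro segment_1) (auto simp: inside_def)
  then show ?case using * exec_WhileF.prems exec_WhileF.hyps by (auto simp: step_inside)
next
  case (exec_WhileT m r c os t1 m1 os1 t2 m2 os2)
  let ?A = "{length p0..<length p0 + clen (While r c)}"
  have *: "pc s < length P" "P ! pc s = JumpZero r (length p0 + clen c + 2)"
    using exec_WhileT.prems by auto
  define s0 where "s0 = step w inp P s"
  have s0: "pc s0 = length p0 + 1" "mem s0 = m" "out s0 = os"
    using * exec_WhileT.prems exec_WhileT.hyps by (auto simp: s0_def step_inside)
  have 0: "segment w inp P N ?A s 1 s0"
    using * exec_WhileT.prems exec_WhileT.hyps s0_def by (intro segment_1) (auto simp: inside_def)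
  obtain s1 where s1: "segment w inp P N {Suc (length p0)..<length p0 + 1 + clen c} s0 t1 s1"
    "pc s1 = length p0 + 1 + clen c" "mem s1 = m1" "out s1 = os1"
    using exec_WhileT.IH(1)[of "p0 @ [JumpZero r (length p0 + clen c + 2)]" "Jump (length p0) # p1" s0]
      exec_WhileT.prems s0 by auto
  have **: "pc s1 < length P" "P ! pc s1 = Jump (length p0)"
    using exec_WhileT.prems s1 by (auto simp: nth_append)
  have 2: "segment w inp P N ?A s1 1 (step w inp P s1)"
    using ** s1 by (intro segment_1) (auto simp: inside_def)
  obtain s2 where s2: "segment w inp P N ?A (step w inp P s1) t2 s2"
    "pc s2 = length p0 + clen (While r c)" "mem s2 = m2" "out s2 = os2"
    using exec_WhileT.IH(2)[of p0 p1 "step w inp P s1"] exec_WhileT.prems s1 **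
    by (auto simp: step_inside)
  have "segment w inp P N ?A s (1 + (t1 + (1 + t2))) s2"
    by (rule segment_trans[OF 0 segment_trans[OF segment_mono[OF s1(1)] segment_trans[OF 2 s2(1)]]]) auto
  then show ?case using s2 by auto
qed

lemma step_hi_le:
  assumes "inside P N A s" "hi s \<le> N"
  shows "hi (step w inp P s) \<le> N"
proof -
  have "finite (accessed (mem s) (P ! pc s))" using finite_subset assms(1)
    by (auto simp: inside_def)
  then show ?thesis using assms by (auto simp: inside_def step_inside)
qed

lemma segment_hi: "segment w inp P N A s t s' \<Longrightarrow> hi s \<le> N \<Longrightarrow> hi s' \<le> N"
proof (induction t arbitrary: s')
  case (Suc t)
  then have "segment w inp P N A s t (steps w inp P t s)" "inside P N A (steps w inp P t s)"
    by (auto simp: segment_def)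
  then show ?case using Suc by (auto simp: segment_def steps_Suc intro: step_hi_le)
qed (simp add: segment_def)

section \<open>Running time from the number of configurations\<close>

lemma new_mem_less:
  assumes "accessed m I \<subseteq> {..<N}" "\<forall>a<N. m a < 2 ^ w"
  shows "\<forall>a<N. new_mem w inp m I a < 2 ^ w"
  using assms by (cases I) (auto simp: take_bit_nat_less_exp)

lemma new_mem_frame: "accessed m I \<subseteq> {..<N} \<Longrightarrow> N \<le> a \<Longrightarrow> new_mem w inp m I a = m a"
  by (cases I) auto

text \<open>Neither \<open>hi\<close> nor \<open>out\<close> influences control, so the
  configurations to be counted for the time bound are pairs of a program counter and a
  memory.\<close>

lemma steps_cong:
  assumes "pc s = pc s'" "mem s = mem s'"
  shows "pc (steps w inp P t s) = pc (steps w inp P t s') \<and> mem (steps w inp P t s) = mem (steps w inp P t s')"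
  by (induction t) (use assms in \<open>auto simp: steps_Suc step_def halted_def Let_def\<close>)

text \<open>A deterministic run that leaves the code never repeats a configuration, so its length is
  bounded by the number of configurations.\<close>

lemma exec_time:
  assumes ex: "exec w inp N c m os t m' os'" and m: "\<forall>a<N. m a < 2 ^ w"
  shows "t \<le> clen c * 2 ^ (w * N)"
proof -
  define P where "P = comp 0 c"
  define s where "s = \<lparr>pc = 0, mem = m, hi = 0, out = os\<rparr>"
  obtain s' where seg: "segment w inp P N {0..<clen c} s t s'" and s': "pc s' = clen c"
    using exec_segment[OF ex, of P "[]" "[]" s] by (auto simp: P_def s_def)
  define q where "q u = steps w inp P u s" for u
  have ins: "inside P N {0..<clen c} (q u)" if "u < t" for u
    using seg that by (auto simp: segment_def q_def)
  have mem: "(\<forall>a<N. mem (q u) a < 2 ^ w) \<and> (\<forall>a\<ge>N. mem (q u) a = m a)" if "u \<le> t" for u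
    using that
  proof (induction u)
    case 0
    then show ?case using m by (simp add: q_def s_def)
  next
    case (Suc u)
    have i: "inside P N {0..<clen c} (q u)" using ins Suc by simp
    have "q (Suc u) = step w inp P (q u)" by (simp add: q_def steps_Suc)
    then have "mem (q (Suc u)) = new_mem w inp (mem (q u)) (P ! pc (q u))"
      using i by (simp add: step_inside inside_def)
    then show ?case using Suc i new_mem_less new_mem_frame
      by (metis Suc_leD inside_def)
  qed
  \<comment> \<open>Cells from \<open>N\<close> on keep their initial values, so the part below
    \<open>N\<close> already determines the memory.\<close>
  define f where "f u = (pc (q u), restrict (mem (q u)) {..<N})" for u
  have "inj_on f {..<t}"
  proof (rule linorder_inj_onI')
    fix u v assume uv: "u \<in> {..<t}" "v \<in> {..<t}" "u < v"
    show "f u \<noteq> f v"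
    proof
      assume eq: "f u = f v"
      have "mem (q u) a = mem (q v) a" for a
      proof (cases "a < N")
        case True
        have "restrict (mem (q u)) {..<N} a = restrict (mem (q v)) {..<N} a" using eq by (simp add: f_def)
        then show ?thesis using True by simp
      next
        case False
        then show ?thesis using mem[of u] mem[of v] uv by simp
      qed
      \<comment> \<open>If the times \<open>u < v\<close> agreed, then after \<open>t - v\<close>
        further steps the run from time \<open>u\<close> would also stand at the end of the code,
        although \<open>u + (t - v) < t\<close>.\<close>
      then have "pc (steps w inp P (t - v) (q u)) = pc (steps w inp P (t - v) (q v))"
        using steps_cong[of "q u" "q v"] eq by (simp add: f_def fun_eq_iff)
      moreover have "steps w inp P (t - v) (q v) = s'"
        using seg uv steps_add[of w inp P v "t - v" s] by (simp add: segment_def q_def)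
      moreover have "steps w inp P (t - v) (q u) = q (u + (t - v))"
        by (simp add: q_def steps_add)
      moreover have "u + (t - v) < t" using uv by auto
      ultimately show False using ins[of "u + (t - v)"] s' by (simp add: inside_def)
    qed
  qed
  moreover have "f ` {..<t} \<subseteq> {..<clen c} \<times> (\<Pi>\<^sub>E a\<in>{..<N}. {..<2 ^ w})"
  proof (rule image_subsetI)
    fix u assume "u \<in> {..<t}"
    then have u: "u < t" by simp
    show "f u \<in> {..<clen c} \<times> (\<Pi>\<^sub>E a\<in>{..<N}. {..<2 ^ w})"
      using ins[OF u] mem[of u] u by (simp add: f_def inside_def restrict_PiE_iff)
  qed
  ultimately have "card {..<t} \<le> card ({..<clen c} \<times> (\<Pi>\<^sub>E a\<in>{..<N}. {..<(2::nat) ^ w}))"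
    by (intro card_inj_on_le[of f]) (auto intro!: finite_PiE)
  also have "\<dots> = clen c * 2 ^ (w * N)"
    by (simp add: card_cartesian_product card_PiE power_mult)
  finally show ?thesis by simp
qed

lemma exec_runs_within:
  assumes ex: "exec w inp N c (\<lambda>_. 0) [] t m' os'"
    and "real t \<le> T" "real (w * N) \<le> sp"
  shows "runs_within w (comp 0 c) inp os' T sp"
proof -
  obtain s' where seg: "segment w inp (comp 0 c) N {0..<clen c} init t s'" and s': "pc s' = clen c" "out s' = os'"
    using exec_segment[OF ex, of "comp 0 c" "[]" "[]" init] by (auto simp: init_def)
  have "hi s' \<le> N" using segment_hi[OF seg] by (simp add: init_def)
  then have "real (w * hi s') \<le> real (w * N)" by (intro of_nat_mono mult_le_mono2)
  then have "real (w * hi s') \<le> sp" using assms(3) by linarith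
  then show ?thesis using assms(2) seg s'
    unfolding runs_within_def run_steps by (intro exI[of _ t]) (auto simp: segment_def halted_def)
qed

section \<open>Weakest preconditions and scans of an instance\<close>

text \<open>The default 0 is that of \<open>Read\<close> beyond the end of the input.\<close>

definition nth0 :: "nat list \<Rightarrow> nat \<Rightarrow> nat" where
  "nth0 xs p = (if p < length xs then xs ! p else 0)"

lemma nth0_snoc: "nth0 (xs @ [x]) p = (if p = length xs then x else nth0 xs p)"
  by (auto simp: nth0_def nth_append)

text \<open>A value that becomes known too late may be streamed as 0 and corrected afterwards: only
  the lookup of its own position changes.\<close>

lemma nth0_patch: "nth0 (xs @ y # ys) p = (if p = length xs then y else nth0 (xs @ 0 # ys) p)"
  by (auto simp: nth0_def nth_append nth_Cons')

text \<open>A trailing placeholder 0 looks like the end of the list, so it can be streamed by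
  advancing the position alone.\<close>

lemma nth0_snoc_0: "nth0 (xs @ [0]) p = nth0 xs p"
  by (auto simp: nth0_def nth_append)

definition fr :: "nat set \<Rightarrow> (nat \<Rightarrow> nat) \<Rightarrow> (nat \<Rightarrow> nat) \<Rightarrow> bool" where
  "fr A m m' \<longleftrightarrow> (\<forall>a. a \<notin> A \<longrightarrow> m' a = m a)"

lemma fr_refl [simp]: "fr A m m"
  by (simp add: fr_def)

lemma fr_upd [simp]: "a \<in> A \<Longrightarrow> fr A m0 m \<Longrightarrow> fr A m0 (m(a := v))"
  by (auto simp: fr_def)

lemma fr_trans: "fr A m0 m1 \<Longrightarrow> fr B m1 m2 \<Longrightarrow> A \<subseteq> C \<Longrightarrow> B \<subseteq> C \<Longrightarrow> fr C m0 m2"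
  unfolding fr_def by (metis subsetD)

lemma fr_mono: "fr A m0 m1 \<Longrightarrow> A \<subseteq> C \<Longrightarrow> fr C m0 m1"
  by (auto simp: fr_def)

lemma frD: "fr A m m' \<Longrightarrow> a \<notin> A \<Longrightarrow> m' a = m a"
  by (auto simp: fr_def)

text \<open>No instruction copies a cell; the disjunction of a word with itself does.\<close>

abbreviation "MOV k i \<equiv> Ins (Op Or k i i)"

text \<open>Cell 0 holds the constant 1.\<close>

definition For :: "nat \<Rightarrow> nat \<Rightarrow> nat \<Rightarrow> com \<Rightarrow> com" where
  "For x t ub body = Ins (Const x 0) ;; Ins (Op Less t x ub) ;;
     While t (body ;; Ins (Op Add x x 0) ;; Ins (Op Less t x ub))"

inductive_cases exec_SeqE: "exec w inp N (c1 ;; c2) m os t m' os'"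

locale ram =
  fixes w :: nat and inp :: "nat list" and N :: nat
begin

text \<open>Total correctness: a terminating run within \<open>N\<close> cells is part of the claim.
  The number of steps is forgotten, since \<open>exec_time\<close> recovers a bound from
  \<open>w\<close> and \<open>N\<close>.\<close>

definition wp :: "com \<Rightarrow> ((nat \<Rightarrow> nat) \<Rightarrow> nat list \<Rightarrow> bool) \<Rightarrow> (nat \<Rightarrow> nat) \<Rightarrow> nat list \<Rightarrow> bool" where
  "wp c Q m os \<longleftrightarrow> (\<exists>t m' os'. exec w inp N c m os t m' os' \<and> Q m' os')"

lemma wp_mono: "wp c Q m os \<Longrightarrow> (\<And>m' os'. Q m' os' \<Longrightarrow> Q' m' os') \<Longrightarrow> wp c Q' m os"
  unfolding wp_def by blast

lemma wp_Skip: "Q m os \<Longrightarrow> wp Skip Q m os"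
  unfolding wp_def using exec_Skip by blast

lemma wp_Seq: "wp c1 (\<lambda>m' os'. wp c2 Q m' os') m os \<Longrightarrow> wp (c1 ;; c2) Q m os"
  unfolding wp_def by (elim exE conjE) (intro exI conjI, rule exec_Seq)

lemma wp_Seq_iff: "wp (c1 ;; c2) Q m os \<longleftrightarrow> wp c1 (\<lambda>m' os'. wp c2 Q m' os') m os"
  unfolding wp_def by (blast elim: exec_SeqE intro: exec_Seq)

lemma wp_Cond:
  "r < N \<Longrightarrow> (m r \<noteq> 0 \<Longrightarrow> wp c1 Q m os) \<Longrightarrow> (m r = 0 \<Longrightarrow> wp c2 Q m os) \<Longrightarrow> wp (Cond r c1 c2) Q m os"
  unfolding wp_def by (cases "m r = 0") (metis exec_CondF, metis exec_CondT)

lemma wp_Ins: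
  "straight I \<Longrightarrow> accessed m I \<subseteq> {..<N} \<Longrightarrow> Q (new_mem w inp m I) (os @ written m I) \<Longrightarrow> wp (Ins I) Q m os"
  unfolding wp_def using exec_Ins by blast

lemma wp_Const: "k < N \<Longrightarrow> v < 2 ^ w \<Longrightarrow> Q (m(k := v)) os \<Longrightarrow> wp (Ins (Const k v)) Q m os"
  by (rule wp_Ins) (auto simp: take_bit_nat_eq_self)

lemma wp_Add: "k < N \<Longrightarrow> i < N \<Longrightarrow> j < N \<Longrightarrow> m i + m j < 2 ^ w \<Longrightarrow> Q (m(k := m i + m j)) os \<Longrightarrow>
    wp (Ins (Op Add k i j)) Q m os"
  by (rule wp_Ins) (auto simp: take_bit_nat_eq_self)

lemma wp_Mul: "k < N \<Longrightarrow> i < N \<Longrightarrow> j < N \<Longrightarrow> m i * m j < 2 ^ w \<Longrightarrow> Q (m(k := m i * m j)) os \<Longrightarrow>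
    wp (Ins (Op Mul k i j)) Q m os"
  by (rule wp_Ins) (auto simp: take_bit_nat_eq_self)

lemma wp_Sub: "k < N \<Longrightarrow> i < N \<Longrightarrow> j < N \<Longrightarrow> m j \<le> m i \<Longrightarrow> m i < 2 ^ w \<Longrightarrow> Q (m(k := m i - m j)) os \<Longrightarrow>
    wp (Ins (Op Sub k i j)) Q m os"
proof (rule wp_Ins)
  assume *: "m j \<le> m i" "m i < 2 ^ w" "Q (m(k := m i - m j)) os"
  have "m i + 2 ^ w - m j = m i - m j + 2 ^ w" using * by simp
  then have "take_bit w (m i + 2 ^ w - m j) = (m i - m j + 2 ^ w) mod 2 ^ w"
    by (simp only: take_bit_eq_mod)
  also have "\<dots> = m i - m j"
    using less_imp_diff_less[OF *(2), of "m j"] by (simp only: mod_add_self2 mod_less)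
  finally show "Q (new_mem w inp m (Op Sub k i j)) (os @ written m (Op Sub k i j))"
    using * by simp
qed auto

lemma wp_Less: "k < N \<Longrightarrow> i < N \<Longrightarrow> j < N \<Longrightarrow> 0 < w \<Longrightarrow> Q (m(k := of_bool (m i < m j))) os \<Longrightarrow>
    wp (Ins (Op Less k i j)) Q m os"
  by (rule wp_Ins) (auto simp: take_bit_nat_eq_self)

lemma wp_Equal: "k < N \<Longrightarrow> i < N \<Longrightarrow> j < N \<Longrightarrow> 0 < w \<Longrightarrow> Q (m(k := of_bool (m i = m j))) os \<Longrightarrow>
    wp (Ins (Op Equal k i j)) Q m os"
  by (rule wp_Ins) (auto simp: take_bit_nat_eq_self)

lemma wp_Mod: "k < N \<Longrightarrow> i < N \<Longrightarrow> j < N \<Longrightarrow> m i mod m j < 2 ^ w \<Longrightarrow> Q (m(k := m i mod m j)) os \<Longrightarrow>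
    wp (Ins (Op Mod k i j)) Q m os"
  by (rule wp_Ins) (auto simp: take_bit_nat_eq_self)

lemma wp_MOV: "k < N \<Longrightarrow> i < N \<Longrightarrow> m i < 2 ^ w \<Longrightarrow> Q (m(k := m i)) os \<Longrightarrow> wp (MOV k i) Q m os"
  by (rule wp_Ins) (auto simp: take_bit_nat_eq_self)

lemma wp_Read: "k < N \<Longrightarrow> i < N \<Longrightarrow> m i < length inp \<Longrightarrow> inp ! m i < 2 ^ w \<Longrightarrow>
    Q (m(k := inp ! m i)) os \<Longrightarrow> wp (Ins (Read k i)) Q m os"
  by (rule wp_Ins) (auto simp: take_bit_nat_eq_self)

lemma wp_Load: "k < N \<Longrightarrow> i < N \<Longrightarrow> m i < N \<Longrightarrow> Q (m(k := m (m i))) os \<Longrightarrow> wp (Ins (Load k i)) Q m os"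
  by (rule wp_Ins) auto

lemma wp_Store: "i < N \<Longrightarrow> j < N \<Longrightarrow> m i < N \<Longrightarrow> Q (m(m i := m j)) os \<Longrightarrow> wp (Ins (Store i j)) Q m os"
  by (rule wp_Ins) auto

lemma wp_Write: "i < N \<Longrightarrow> Q m (os @ [m i]) \<Longrightarrow> wp (Ins (Write i)) Q m os"
  by (rule wp_Ins) auto

lemmas wp_rules = wp_Skip wp_Seq wp_Cond wp_Const wp_Add wp_Mul wp_Sub wp_Less wp_Equal wp_Mod
  wp_MOV wp_Read wp_Load wp_Store wp_Write

text \<open>The invariant is indexed by the completed rounds and their total number \<open>T\<close>
  is given in advance, so termination is the induction from \<open>T\<close> downwards.\<close>

lemma wp_While_count:
  assumes "J 0 m os" "r < N"
    and body: "\<And>k m os. k < T \<Longrightarrow> J k m os \<Longrightarrow> m r \<noteq> 0 \<and> wp c (J (Suc k)) m os"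
    and fin: "\<And>m os. J T m os \<Longrightarrow> m r = 0 \<and> Q m os"
  shows "wp (While r c) Q m os"
proof -
  have "wp (While r c) Q m os" if "k \<le> T" "J k m os" for k m os
    using that
  proof (induction arbitrary: m os rule: inc_induct)
    case base
    then show ?case unfolding wp_def using exec_WhileF fin[OF base] \<open>r < N\<close> by blast
  next
    case (step k)
    obtain t1 m1 os1 where 1: "exec w inp N c m os t1 m1 os1" "J (Suc k) m1 os1" "m r \<noteq> 0"
      using body step unfolding wp_def by meson
    then obtain t2 m2 os2 where "exec w inp N (While r c) m1 os1 t2 m2 os2" "Q m2 os2"
      using step.IH unfolding wp_def by meson
    then show ?case unfolding wp_def using exec_WhileT[OF 1(3) \<open>r < N\<close> 1(1)] by blast
  qed
  then show ?thesis using assms(1) by blast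
qed

text \<open>\<open>J\<close> must be indifferent to the counter \<open>x\<close> and the test cell
  \<open>t\<close>; thus invariants speak only of the work done in the first \<open>k\<close>
  rounds, and the body has to leave \<open>x\<close> as it found it.\<close>

lemma wp_For:
  assumes cells: "x < N" "t < N" "ub < N" "0 < w" "x \<noteq> 0" "t \<noteq> 0" "x \<noteq> t" "x \<noteq> ub" "t \<noteq> ub"
    and L: "L < 2 ^ w"
    and stable: "\<And>k m os u v. J k m os \<Longrightarrow> J k (m(x := u, t := v)) os"
    and ub: "\<And>k m os. J k m os \<Longrightarrow> m ub = L \<and> m 0 = 1"
    and init: "J 0 m os"
    and body: "\<And>k m os. k < L \<Longrightarrow> J k m os \<Longrightarrow> m x = k \<Longrightarrow>
      wp body (\<lambda>m' os'. m' x = k \<and> J (Suc k) m' os') m os"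
    and fin: "\<And>m os. J L m os \<Longrightarrow> Q m os"
  shows "wp (For x t ub body) Q m os"
proof -
  define I where "I k m os \<longleftrightarrow> J k m os \<and> m x = k \<and> m t = of_bool (k < L)" for k :: nat and m :: "nat \<Rightarrow> nat" and os
  have st: "I k (m(x := k, t := of_bool (k < L))) os" if "J k m os" for k m os
    using stable[OF that] cells by (simp add: I_def)
  have N0: "0 < N" using cells by auto
  have bd: "wp (body ;; Ins (Op Add x x 0) ;; Ins (Op Less t x ub)) (I (Suc k)) m os"
    if k: "k < L" and I: "I k m os" for k m os
  proof (rule wp_Seq, rule wp_mono[OF body[OF k]])
    fix m' os' assume *: "m' x = k \<and> J (Suc k) m' os'"
    then have "m' ub = L" "m' 0 = 1" using ub by auto
    then show "wp (Ins (Op Add x x 0) ;; Ins (Op Less t x ub)) (I (Suc k)) m' os'"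
      using * cells L k N0 st[of "Suc k" m' os'] by (intro wp_rules) (auto simp: fun_upd_def)
  qed (use I in \<open>auto simp: I_def\<close>)
  show ?thesis unfolding For_def
  proof (intro wp_rules cells N0)
    have *: "I 0 (m(x := 0, t := of_bool (0 < L))) os" by (rule st[OF init])
    show "wp (While t (body ;; Ins (Op Add x x 0) ;; Ins (Op Less t x ub))) Q
       (m(x := 0, t := of_bool ((m(x := 0)) x < (m(x := 0)) ub))) os"
      by (rule wp_While_count[where J = I and T = L])
        (use * cells ub[OF init] bd fin in \<open>auto simp: I_def\<close>)
  qed (auto)
qed

end

section \<open>Scans of the ground set and of the family at one level\<close>

definition code_within :: "nat set \<Rightarrow> nat list \<Rightarrow> bool" where
  "code_within V c \<longleftrightarrow> set (tl c) \<subseteq> V"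

text \<open>
  A level of the recursion: the command \<open>mu\<close> decides membership in \<open>V\<close>, reading its argument from cell
  \<open>yc\<close> and leaving the answer in cell \<open>rc\<close>.  Cells 0 to 3 hold 1, \<open>n\<close>, the position of the
  encoded instance in the input, and the modulus \<open>2 ^ ws\<close> of the simulated machine; \<open>mu\<close> uses
  only cells below \<open>z\<close>.
\<close>

locale level = ram +
  fixes n :: nat and pre :: "nat list" and cs :: "nat list list" and ws :: nat
    and mu :: com and yc rc z :: nat and V :: "nat set"
  assumes inp: "inp = pre @ n # n # [0..<n] @ length cs # concat cs"
    and codes: "\<And>c. c \<in> set cs \<Longrightarrow> \<exists>xs. c = length xs # xs \<and> set xs \<subseteq> {..<n}"
    and room: "length inp + 10 < 2 ^ w"
    and cells: "4 \<le> yc" "yc < z" "4 \<le> rc" "rc < z" "z + 21 \<le> N"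
    and V: "V \<subseteq> {..<n}"
    and mu0: "\<And>m os. m 0 = 1 \<Longrightarrow> m 1 = n \<Longrightarrow> m 2 = length pre \<Longrightarrow> m 3 = 2 ^ ws \<Longrightarrow> m yc < n \<Longrightarrow>
      wp mu (\<lambda>m' os'. os' = os \<and> m' rc = of_bool (m yc \<in> V) \<and> fr {4..<z} m m') m os"
begin

definition glob :: "(nat \<Rightarrow> nat) \<Rightarrow> bool" where
  "glob m \<longleftrightarrow> m 0 = 1 \<and> m (Suc 0) = n \<and> m 2 = length pre \<and> m 3 = 2 ^ ws"

lemma mu: "glob m \<Longrightarrow> m yc < n \<Longrightarrow>
   wp mu (\<lambda>m' os'. os' = os \<and> m' rc = of_bool (m yc \<in> V) \<and> fr {4..<z} m m') m os"
  using mu0 by (simp add: glob_def)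

lemma glob_fr: "glob m \<Longrightarrow> fr A m m' \<Longrightarrow> A \<subseteq> {4..} \<Longrightarrow> glob m'"
proof -
  assume *: "glob m" "fr A m m'" "A \<subseteq> {4..}"
  have "m' a = m a" if "a < 4" for a
    by (rule frD[OF *(2)]) (use *(3) that in auto)
  then show ?thesis using *(1) by (simp add: glob_def)
qed

lemma glob_upd [simp]: "4 \<le> a \<Longrightarrow> glob m \<Longrightarrow> glob (m(a := v))"
  by (auto simp: glob_def)

lemma glob_simps: "glob m \<Longrightarrow> m 0 = 1" "glob m \<Longrightarrow> m (Suc 0) = n" "glob m \<Longrightarrow> m 2 = length pre" "glob m \<Longrightarrow> m 3 = 2 ^ ws"
  by (auto simp: glob_def)

text \<open>The gap \<open>z\<close>, \<open>z + 1\<close> holds the argument and the answer of the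
  calling level; from \<open>z + 12\<close> on the users of a scan keep their own results.\<close>

definition scratch :: "nat set" where
  "scratch = {4..<z} \<union> {z + 2..<z + 12}"

lemma w_pos: "0 < w"
  using room by (cases w) auto

lemma one_less: "Suc 0 < 2 ^ w"
  using room by simp

lemma n_less: "n + 10 < 2 ^ w"
  using room by (simp add: inp)

text \<open>The invariant \<open>J\<close> sees just the list of elements of \<open>V\<close> met so
  far. Everything else that the scan does, including the calls of \<open>mu\<close>, is confined to
  \<open>scratch\<close>, to which \<open>J\<close> has to be indifferent.\<close>

lemma wp_scanU:
  assumes stable: "\<And>xs m m' os. J xs m os \<Longrightarrow> fr scratch m m' \<Longrightarrow> J xs m' os"
    and init: "glob m" "J [] m os"
    and body: "\<And>x m os. x \<in> V \<Longrightarrow> glob m \<Longrightarrow> m (z + 2) = x \<Longrightarrow> J (filter (\<lambda>x. x \<in> V) [0..<x]) m os \<Longrightarrow>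
      wp body (\<lambda>m' os'. glob m' \<and> m' (z + 2) = x \<and> J (filter (\<lambda>x. x \<in> V) [0..<x] @ [x]) m' os') m os"
    and fin: "\<And>m' os'. glob m' \<Longrightarrow> J (filter (\<lambda>x. x \<in> V) [0..<n]) m' os' \<Longrightarrow> Q m' os'"
  shows "wp (For (z + 2) (z + 3) 1 (MOV yc (z + 2) ;; mu ;; Cond rc body Skip)) Q m os"
proof -
  let ?f = "\<lambda>x. filter (\<lambda>x. x \<in> V) [0..<x]"
  show ?thesis
  proof (rule wp_For[where J = "\<lambda>k m os. glob m \<and> J (?f k) m os" and L = n])
    fix k m os u v
    assume "glob m \<and> J (?f k) m os"
    then show "glob (m(z + 2 := u, z + 3 := v)) \<and> J (?f k) (m(z + 2 := u, z + 3 := v)) os"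
      using cells by (auto simp: scratch_def intro!: stable[of _ m])
  next
    fix k m os
    assume k: "k < n" and J: "glob m \<and> J (?f k) m os" and mk: "m (z + 2) = k"
    have *: "fr {4..<z} m (m(yc := k))" using cells by simp
    show "wp (MOV yc (z + 2) ;; mu ;; Cond rc body Skip)
      (\<lambda>m' os'. m' (z + 2) = k \<and> glob m' \<and> J (?f (Suc k)) m' os') m os"
    proof (intro wp_Seq wp_MOV)
      show "wp mu (\<lambda>m' os'. wp (Cond rc body Skip)
        (\<lambda>m' os'. m' (z + 2) = k \<and> glob m' \<and> J (?f (Suc k)) m' os') m' os') (m(yc := m (z + 2))) os"
      proof (rule wp_mono[OF mu])
        fix m' os'
        assume "os' = os \<and> m' rc = of_bool ((m(yc := m (z + 2))) yc \<in> V) \<and> fr {4..<z} (m(yc := m (z + 2))) m'"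
        then have m': "os' = os" "m' rc = of_bool (k \<in> V)" "fr {4..<z} m m'"
          using mk fr_trans[OF *, of "{4..<z}" m' "{4..<z}"] by auto
        have g: "glob m'" by (rule glob_fr[OF _ m'(3)]) (use J in auto)
        have z2: "m' (z + 2) = k" using frD[OF m'(3)] mk by simp
        have J': "J (?f k) m' os'" using J m'(1) stable fr_mono[OF m'(3), of scratch] by (auto simp: scratch_def)
        show "wp (Cond rc body Skip)
          (\<lambda>m' os'. m' (z + 2) = k \<and> glob m' \<and> J (?f (Suc k)) m' os') m' os'"
        proof (intro wp_Cond wp_Skip)
          assume "m' rc \<noteq> 0"
          then have "k \<in> V" using m' by auto
          then show "wp body (\<lambda>m' os'. m' (z + 2) = k \<and> glob m' \<and> J (?f (Suc k)) m' os') m' os'"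
            using body[of k m' os'] g z2 J' by (auto intro: wp_mono)
        next
          assume "m' rc = 0"
          then have "k \<notin> V" using m' by auto
          then show "m' (z + 2) = k \<and> glob m' \<and> J (?f (Suc k)) m' os'" using z2 g J' by simp
        qed (use cells in auto)
      qed (use J k mk cells in auto)
    qed (use cells mk k n_less in auto)
  next
    show "Q m os" if "glob m \<and> J (?f n) m os" for m os
      using fin that by auto
  qed (use cells init n_less w_pos in \<open>auto simp: glob_simps\<close>)
qed

text \<open>The 3 counts the entries that hold \<open>n\<close>, the size of the ground set and the
  number of sets.\<close>

definition pos :: "nat \<Rightarrow> nat" where
  "pos l = length pre + n + 3 + length (concat (take l cs))"

text \<open>Since the head of a code is the cardinality, a code is selected iff the coded set lies
  in \<open>V\<close>; for \<open>V\<close> the ground set after \<open>j\<close> rounds this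
  selects the family after \<open>j\<close> rounds.\<close>

abbreviation sel :: "nat list \<Rightarrow> bool" where
  "sel \<equiv> code_within V"

lemma pos_Suc: "l < length cs \<Longrightarrow> pos (Suc l) = pos l + length (cs ! l)"
  by (simp add: pos_def take_Suc_conv_app_nth)

lemma inp_pos:
  assumes "l < length cs"
  shows "t < length (cs ! l) \<Longrightarrow> inp ! (pos l + t) = cs ! l ! t"
    and "pos l + length (cs ! l) \<le> length inp"
proof -
  have "inp = (pre @ n # n # [0..<n] @ length cs # concat (take l cs)) @ cs ! l @ concat (drop (Suc l) cs)"
    unfolding inp using id_take_nth_drop[OF assms] by (metis (no_types) append.assoc append_Cons concat.simps(2) concat_append)
  moreover have "length (pre @ n # n # [0..<n] @ length cs # concat (take l cs)) = pos l"
    by (simp add: pos_def)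
  ultimately obtain A B where AB: "inp = A @ cs ! l @ B" "length A = pos l" by blast
  show "t < length (cs ! l) \<Longrightarrow> inp ! (pos l + t) = cs ! l ! t" using AB by (auto simp: nth_append)
  show "pos l + length (cs ! l) \<le> length inp" using AB by auto
qed

text \<open>Every code, even that of the empty set, contributes at least its length entry; hence the
  number of sets fits into a word whenever the length of the input does.\<close>

lemma length_cs: "length cs \<le> length (concat cs)"
proof -
  have "(\<Sum>c\<leftarrow>cs. 1) \<le> (\<Sum>c\<leftarrow>cs. length c)"
    by (rule sum_list_mono) (use codes in force)
  then show ?thesis by (simp add: length_concat sum_list_triv)
qed

text \<open>The product in cell \<open>z + 9\<close> is the conjunction of the answers so far. The
  extra 1 in the address skips the length entry of the code that starts at the position in
  \<open>z + 5\<close>.\<close>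

abbreviation check_set :: com where
  "check_set \<equiv> For (z + 7) (z + 8) (z + 6)
    (Ins (Op Add (z + 10) (z + 5) 0) ;; Ins (Op Add (z + 10) (z + 10) (z + 7)) ;;
     Ins (Read yc (z + 10)) ;; mu ;; Ins (Op Mul (z + 9) (z + 9) rc))"

abbreviation advance :: com where
  "advance \<equiv> Ins (Op Add (z + 5) (z + 5) (z + 6)) ;; Ins (Op Add (z + 5) (z + 5) 0)"

abbreviation scanF_loop :: "com \<Rightarrow> com" where
  "scanF_loop body \<equiv> For (z + 2) (z + 3) (z + 4)
    (Ins (Read (z + 6) (z + 5)) ;; Ins (Const (z + 9) 1) ;; check_set ;; Cond (z + 9) body Skip ;; advance)"

text \<open>The entry with the number of sets stands at \<open>2 + length pre + n\<close>: the
  constant 2 skips the two entries \<open>n\<close>, and the cells 2 and 1 contribute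
  \<open>length pre\<close> and \<open>n\<close>.\<close>

definition scanF :: "com \<Rightarrow> com" where
  "scanF body =
     Ins (Const (z + 5) 2) ;; Ins (Op Add (z + 5) (z + 5) 2) ;; Ins (Op Add (z + 5) (z + 5) 1) ;;
     Ins (Read (z + 4) (z + 5)) ;; Ins (Op Add (z + 5) (z + 5) 0) ;;
     scanF_loop body"

lemma wp_scanF_inner:
  assumes glob: "glob m" and l: "l < length cs" and q: "m (z + 5) = pos l"
    and s: "m (z + 6) = length (cs ! l) - 1" and ok: "m (z + 9) = 1"
  shows "wp check_set
      (\<lambda>m' os'. os' = os \<and> fr ({4..<z} \<union> {z + 7..<z + 11}) m m' \<and> m' (z + 9) = of_bool (sel (cs ! l))) m os"
proof -
  let ?A = "{4..<z} \<union> {z + 7..<z + 11}"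
  obtain xs where xs: "cs ! l = length xs # xs" "set xs \<subseteq> {..<n}"
    using codes[of "cs ! l"] l by auto
  have in1: "inp ! (pos l + 1 + t) = xs ! t \<and> pos l + 1 + t < length inp" if "t < length xs" for t
    using inp_pos(1)[OF l, of "Suc t"] inp_pos(2)[OF l] that xs by simp
  have xs_n: "xs ! t < n" if "t < length xs" for t using xs that nth_mem by fastforce
  have len: "length xs < 2 ^ w" using inp_pos(2)[OF l] room xs by simp
  let ?J = "\<lambda>k m' os'. os' = os \<and> fr ?A m m' \<and> m' (z + 9) = of_bool (set (take k xs) \<subseteq> V)"
  show ?thesis
  proof (rule wp_For[where J = ?J and L = "length xs"])
    fix k m' os'
    assume k: "k < length xs" and J: "?J k m' os'" and mk: "m' (z + 7) = k"
    have "?A \<subseteq> {4..}" using cells by auto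
    then have g': "glob m'" using glob_fr[OF glob, of ?A m'] J by blast
    have q': "m' (z + 5) = pos l" using J q by (auto simp: frD)
    have rn: "inp ! (pos l + 1 + k) = xs ! k" "pos l + 1 + k < length inp" using in1 k by auto
    define m1 where "m1 = m'(z + 10 := pos l + 1 + k, yc := xs ! k)"
    have f1: "fr ?A m' m1" "m1 (z + 7) = k" using cells mk by (auto simp: m1_def)
    have g1: "glob m1" using g' cells by (simp add: m1_def)
    have y: "m1 yc = xs ! k" using cells by (simp add: m1_def)
    define QQ where "QQ m'' os'' \<longleftrightarrow> m'' (z + 7) = k \<and> ?J (Suc k) m'' os''" for m'' os''
    have 1: "wp (mu ;; Ins (Op Mul (z + 9) (z + 9) rc))
       QQ m1 os'"
    proof (rule wp_Seq, rule wp_mono[OF mu[OF g1]])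
      show "m1 yc < n" using xs_n k y by simp
    next
      fix m2 os2 assume *: "os2 = os' \<and> m2 rc = of_bool (m1 yc \<in> V) \<and> fr {4..<z} m1 m2"
      have z9: "m2 (z + 9) = of_bool (set (take k xs) \<subseteq> V)" and z7: "m2 (z + 7) = k"
        using * J f1 cells by (auto simp: frD m1_def)
      have f2: "fr ?A m m2" using J f1 * by (meson fr_trans order_refl Un_upper1)
      have "{0..<Suc k} = insert k {0..<k}" by auto
      then have tk: "(set (take (Suc k) xs) \<subseteq> V) = (set (take k xs) \<subseteq> V \<and> xs ! k \<in> V)"
        using k by (auto simp: take_Suc_conv_app_nth)
      show "wp (Ins (Op Mul (z + 9) (z + 9) rc)) QQ m2 os2"
        by (intro wp_rules) (use cells * J y z9 z7 f2 w_pos one_less tk in \<open>auto simp: QQ_def of_bool_conj\<close>)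
    qed
    show "wp (Ins (Op Add (z + 10) (z + 5) 0) ;; Ins (Op Add (z + 10) (z + 10) (z + 7)) ;;
         Ins (Read yc (z + 10)) ;; mu ;; Ins (Op Mul (z + 9) (z + 9) rc))
       (\<lambda>m'' os''. m'' (z + 7) = k \<and> ?J (Suc k) m'' os'') m' os'"
      unfolding QQ_def[symmetric]
      apply (rule wp_Seq)
      apply (rule wp_Add)
      using cells apply (simp_all add: glob_simps[OF g'] q')
      using rn(2) room apply simp
      apply (rule wp_Seq)
      apply (rule wp_Add)
      using cells apply (simp_all add: mk)
      using rn(2) room apply simp
      apply (rule wp_Seq)
      apply (rule wp_Read)
      using cells apply simp_all
      using rn(2) apply simp
      using rn(1) xs_n[OF k] n_less apply simp
      using 1 rn(1) apply (simp add: m1_def)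
      done
  next
    show "?J k (m'(z + 7 := u, z + 8 := v)) os'" if "?J k m' os'" for k m' os' u v
      using that by simp
  next
    show "m' (z + 6) = length xs \<and> m' 0 = 1" if "?J k m' os'" for k m' os'
      using that glob cells s xs by (auto simp: frD glob_simps)
  next
    show "os' = os \<and> fr ?A m m' \<and> m' (z + 9) = of_bool (sel (cs ! l))" if "?J (length xs) m' os'" for m' os'
      using that xs by (simp add: code_within_def)
  qed (use cells w_pos len ok in auto)
qed

text \<open>The body may consult \<open>z + 5\<close> and \<open>z + 6\<close> for the position and
  size of the current code, but must preserve them, because the step to the next code is computed
  from them.\<close>

lemma wp_scanF:
  assumes stable: "\<And>xs m m' os. J xs m os \<Longrightarrow> fr scratch m m' \<Longrightarrow> J xs m' os"
    and init: "glob m" "J [] m os"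
    and body: "\<And>l m os. l < length cs \<Longrightarrow> sel (cs ! l) \<Longrightarrow> glob m \<Longrightarrow> m (z + 5) = pos l \<Longrightarrow>
      m (z + 6) = length (cs ! l) - 1 \<Longrightarrow> J (filter sel (take l cs)) m os \<Longrightarrow>
      wp body (\<lambda>m' os'. glob m' \<and> (\<forall>a\<in>{z + 2, z + 4, z + 5, z + 6}. m' a = m a) \<and>
        J (filter sel (take l cs) @ [cs ! l]) m' os') m os"
    and fin: "\<And>m' os'. glob m' \<Longrightarrow> J (filter sel cs) m' os' \<Longrightarrow> Q m' os'"
  shows "wp (scanF body) Q m os"
proof -
  let ?f = "\<lambda>k. filter sel (take k cs)"
  define J' where "J' k m os \<longleftrightarrow> glob m \<and> m (z + 4) = length cs \<and> m (z + 5) = pos k \<and> J (?f k) m os" for k m os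
  have len_cs: "inp ! (2 + length pre + n) = length cs" "2 + length pre + n < length inp"
    "length cs < 2 ^ w"
    using length_cs room by (auto simp: inp nth_append nth_Cons')
  define loop where "loop = scanF_loop body"
  have loop: "wp loop Q m os" if "J' 0 m os" for m os
    unfolding loop_def
  proof (rule wp_For[where J = J' and L = "length cs"])
    fix k m os u v
    assume "J' k m os"
    then show "J' k (m(z + 2 := u, z + 3 := v)) os"
      using cells by (auto simp: J'_def scratch_def intro!: stable[of _ m])
  next
    show "J' 0 m os" by (rule that)
  next
    fix k m os
    assume k: "k < length cs" and J: "J' k m os" and mk: "m (z + 2) = k"
    let ?post = "\<lambda>m' os'. m' (z + 2) = k \<and> J' (Suc k) m' os'"
    obtain xs where c: "cs ! k = length xs # xs" using codes[of "cs ! k"] k by auto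
    have len: "pos k + length (cs ! k) \<le> length inp" "0 < length (cs ! k)" "pos k < length inp"
      using inp_pos(2)[OF k] c by simp_all
    have hd: "inp ! pos k = length (cs ! k) - 1" using inp_pos(1)[OF k, of 0] c by simp
    define m1 where "m1 = m(z + 6 := length (cs ! k) - 1, z + 9 := 1)"
    have g1: "glob m1" using J cells by (simp add: m1_def J'_def)
    have J1: "J (?f k) m1 os" using J by (auto simp: J'_def m1_def scratch_def intro!: stable[of _ m])
    have m1: "m1 (z + 2) = k" "m1 (z + 4) = length cs" "m1 (z + 5) = pos k" "m1 (z + 6) = length (cs ! k) - 1" "m1 (z + 9) = 1"
      using J mk by (auto simp: m1_def J'_def)
    let ?A = "{4..<z} \<union> {z + 7..<z + 11}"
    have end_part: "wp (advance)
       ?post m2 os2"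
      if "glob m2" "m2 (z + 2) = k" "m2 (z + 4) = length cs" "m2 (z + 5) = pos k" "m2 (z + 6) = length (cs ! k) - 1"
        "J (?f (Suc k)) m2 os2" for m2 os2
    proof -
      have "J (?f (Suc k)) (m2(z + 5 := v)) os2" for v
        by (rule stable[OF that(6)]) (simp add: scratch_def)
      moreover have "Suc (pos k + m2 (z + 6)) = pos (Suc k)" "pos (Suc k) + 10 < 2 ^ w"
        using that(5) len room by (auto simp: pos_Suc[OF k])
      moreover have "m2 0 = 1" using that(1) by (simp add: glob_simps)
      ultimately show ?thesis
        by (intro wp_rules) (use that(1-4) cells in \<open>simp_all add: J'_def\<close>)
    qed
    have rest: "wp (Cond (z + 9) body Skip ;;
       advance)
       ?post m2 os2"
      if "os2 = os \<and> fr ?A m1 m2 \<and> m2 (z + 9) = of_bool (sel (cs ! k))" for m2 os2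
    proof -
      have "?A \<subseteq> {4..}" using cells by auto
      then have g2: "glob m2" using glob_fr[OF g1, of ?A m2] that by blast
      have m2: "m2 (z + 2) = k" "m2 (z + 4) = length cs" "m2 (z + 5) = pos k" "m2 (z + 6) = length (cs ! k) - 1"
        using that m1 by (auto simp: frD)
      have "?A \<subseteq> scratch" by (auto simp: scratch_def)
      then have J2: "J (?f k) m2 os2" using J1 that by (meson fr_mono stable)
      show ?thesis
      proof (intro wp_Seq wp_Cond wp_Skip)
        assume "m2 (z + 9) \<noteq> 0"
        then have s: "sel (cs ! k)" using that by auto
        show "wp body (wp (advance)
           ?post) m2 os2"
          apply (rule wp_mono[OF body[OF k s g2 m2(3) m2(4) J2]])
          apply (rule end_part)
          using m2 k s by (simp_all add: take_Suc_conv_app_nth)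
      next
        assume "m2 (z + 9) = 0"
        then have s: "\<not> sel (cs ! k)" using that by auto
        show "wp (Ins (Op Add (z + 5) (z + 5) (z + 6))) (\<lambda>m' os'. wp (Ins (Op Add (z + 5) (z + 5) 0))
           ?post m' os') m2 os2"
          apply (rule end_part[unfolded wp_Seq_iff])
          using m2 k s g2 J2 by (simp_all add: take_Suc_conv_app_nth)
      qed (use cells in auto)
    qed
    show "wp (Ins (Read (z + 6) (z + 5)) ;; Ins (Const (z + 9) 1) ;;
       check_set ;;
       Cond (z + 9) body Skip ;;
       advance)
     ?post m os"
    proof (rule wp_Seq, rule wp_Read)
      show "wp (Ins (Const (z + 9) 1) ;;
       check_set ;;
       Cond (z + 9) body Skip ;;
       advance)
       ?post (m(z + 6 := inp ! m (z + 5))) os"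
      proof (rule wp_Seq, rule wp_Const)
        show "wp (check_set ;;
       Cond (z + 9) body Skip ;;
       advance)
       ?post (m(z + 6 := inp ! m (z + 5), z + 9 := 1)) os"
          using J hd by (intro wp_Seq[of _ _ _ "m(z + 6 := inp ! m (z + 5), z + 9 := 1)"] wp_mono[OF wp_scanF_inner[OF _ k] rest])
            (use g1 m1 in \<open>auto simp: m1_def J'_def\<close>)
      qed (use cells room in auto)
    qed (use cells J len hd room in \<open>auto simp: J'_def\<close>)
  next
    show "Q m os" if "J' (length cs) m os" for m os
      using that fin by (simp add: J'_def)
  next
    show "m (z + 4) = length cs \<and> m 0 = 1" if "J' k m os" for k m os
      using that by (simp add: J'_def glob_simps)
  qed (use cells w_pos len_cs in auto)
  have J0: "J' 0 (m(z + 5 := 2 + length pre + n + 1, z + 4 := length cs)) os"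
    using init cells by (auto simp: J'_def pos_def scratch_def intro!: stable[of _ m])
  show ?thesis
    unfolding scanF_def loop_def[symmetric]
    apply (intro wp_Seq wp_Const wp_Add wp_Read)
    using cells len_cs room loop[OF J0] glob_simps[OF init(1)]
    by (simp_all add: ac_simps fun_upd_twist)
qed

end

section \<open>Reading the virtual input\<close>

text \<open>This is the input on which a simulated program runs, expressed through the codes of the
  original family, which are what a scan can see. The \<open>n\<close> after the query is that of
  the original instance.\<close>

definition virtual_input :: "nat \<Rightarrow> nat list list \<Rightarrow> nat set \<Rightarrow> nat \<Rightarrow> nat list" where
  "virtual_input n cs V x = x # n # length (filter (\<lambda>x. x \<in> V) [0..<n]) # filter (\<lambda>x. x \<in> V) [0..<n] @
     length (filter (code_within V) cs) # concat (filter (code_within V) cs)"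

context level
begin

definition emit :: "nat \<Rightarrow> com" where
  "emit e = Ins (Op Equal (z + 10) (z + 14) (z + 12)) ;; Cond (z + 10) (MOV (z + 13) e) Skip ;;
     Ins (Op Add (z + 14) (z + 14) 0)"

text \<open>The default of \<open>nth0\<close> covers both phases: the catching cell holds 0 until
  position \<open>p\<close> has been streamed.\<close>

definition emitted :: "nat \<Rightarrow> nat list \<Rightarrow> (nat \<Rightarrow> nat) \<Rightarrow> bool" where
  "emitted p xs m \<longleftrightarrow> m (z + 12) = p \<and> m (z + 13) = nth0 xs p \<and> m (z + 14) = length xs"

lemma emitted_fr:
  assumes "emitted p xs m" "fr A m m'" "A \<inter> {z + 12..<z + 15} = {}"
  shows "emitted p xs m'"
proof -
  have "m' a = m a" if "a \<in> {z + 12..<z + 15}" for a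
    using assms that by (intro frD) auto
  then show ?thesis using assms(1) by (simp add: emitted_def)
qed

lemma wp_emit:
  assumes "glob m" "emitted p xs m" "m e < 2 ^ w" "e < N" "e \<noteq> z + 10" "length xs + 1 < 2 ^ w"
    and fin: "\<And>m'. fr {z + 10, z + 13, z + 14} m m' \<Longrightarrow> glob m' \<Longrightarrow> emitted p (xs @ [m e]) m' \<Longrightarrow> Q m' os"
  shows "wp (emit e) Q m os"
proof -
  have m0: "m 0 = 1" using assms(1) by (rule glob_simps)
  have m: "m (z + 12) = p" "m (z + 13) = nth0 xs p" "m (z + 14) = length xs"
    using assms(2) by (auto simp: emitted_def)
  let ?m1 = "m(z + 10 := of_bool (length xs = p))"
  let ?m2 = "if length xs = p then ?m1(z + 13 := m e) else ?m1"
  let ?m3 = "?m2(z + 14 := length xs + 1)"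
  have Q: "Q ?m3 os"
    by (rule fin) (use assms(1) m cells in \<open>auto simp: emitted_def nth0_snoc\<close>)
  show ?thesis
    unfolding emit_def
  proof (intro wp_Seq wp_Equal)
    show "wp (Cond (z + 10) (MOV (z + 13) e) Skip) (wp (Ins (Op Add (z + 14) (z + 14) 0)) Q)
      (m(z + 10 := of_bool (m (z + 14) = m (z + 12)))) os"
    proof (cases "length xs = p")
      case True
      then show ?thesis
        using Q by (intro wp_Cond wp_MOV wp_Skip wp_Add) (use assms cells m m0 in auto)
    next
      case False
      then show ?thesis
        using Q by (intro wp_Cond wp_MOV wp_Skip wp_Add) (use assms cells m m0 in auto)
    qed
  qed (use cells w_pos in auto)
qed

abbreviation emit_elems :: com where
  "emit_elems \<equiv> For (z + 2) (z + 3) 1 (MOV yc (z + 2) ;; mu ;; Cond rc (emit (z + 2)) Skip)"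

abbreviation emit_code :: com where
  "emit_code \<equiv> For (z + 7) (z + 8) (z + 11)
    (Ins (Op Add (z + 10) (z + 5) (z + 7)) ;; Ins (Read (z + 9) (z + 10)) ;; emit (z + 9))"

abbreviation emit_set :: com where
  "emit_set \<equiv> Ins (Op Add (z + 16) (z + 16) 0) ;; Ins (Op Add (z + 11) (z + 6) 0) ;; emit_code"

abbreviation patch_sets :: com where
  "patch_sets \<equiv> Ins (Op Equal (z + 10) (z + 15) (z + 12)) ;; Cond (z + 10) (MOV (z + 13) (z + 16)) Skip"

text \<open>
  Cell \<open>z + 14\<close> counts the emitted values, and cell \<open>z + 13\<close> catches the one at the position given in
  cell \<open>z + 12\<close>.  Each of the two cardinalities is known only after its list has been scanned, so
  its position is skipped and the value is patched in afterwards.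
\<close>

definition fetch :: com where
  "fetch = Ins (Const (z + 13) 0) ;; Ins (Const (z + 14) 0) ;;
     emit z ;; emit 1 ;; Ins (Op Add (z + 14) (z + 14) 0) ;;
     emit_elems ;;
     Ins (Const (z + 10) 2) ;; Ins (Op Equal (z + 10) (z + 10) (z + 12)) ;;
     Cond (z + 10) (Ins (Const (z + 10) 3) ;; Ins (Op Sub (z + 13) (z + 14) (z + 10))) Skip ;;
     MOV (z + 15) (z + 14) ;; Ins (Const (z + 16) 0) ;; Ins (Op Add (z + 14) (z + 14) 0) ;;
     scanF emit_set ;;
     patch_sets"

abbreviation virt :: "nat \<Rightarrow> nat list" where
  "virt \<equiv> virtual_input n cs V"

lemma length_concat_sel: "length (concat (filter sel (take l cs))) + length (cs ! l) \<le> length (concat cs)"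
  if "l < length cs"
proof -
  have *: "length (concat (filter sel xs)) \<le> length (concat xs)" for xs :: "nat list list"
    by (induction xs) auto
  have "length (concat cs) = length (concat (take (Suc l) cs)) + length (concat (drop (Suc l) cs))"
    by (metis append_take_drop_id concat_append length_append)
  then show ?thesis using *[of "take l cs"] that by (simp add: take_Suc_conv_app_nth)
qed

lemma wp_emit_code:
  assumes l: "l < length cs" and glob: "glob m" and q: "m (z + 5) = pos l"
    and s: "m (z + 11) = length (cs ! l)"
    and em: "emitted p xs m" and len: "length xs + length (cs ! l) + 1 < 2 ^ w"
    and fin: "\<And>m'. fr ({z + 7..<z + 11} \<union> {z + 13, z + 14}) m m' \<Longrightarrow> glob m' \<Longrightarrow>
       emitted p (xs @ cs ! l) m' \<Longrightarrow> Q m' os"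
  shows "wp emit_code Q m os"
proof -
  let ?A = "{z + 7..<z + 11} \<union> {z + 13, z + 14}"
  let ?J = "\<lambda>k m' os'. os' = os \<and> glob m' \<and> fr ?A m m' \<and> emitted p (xs @ take k (cs ! l)) m'"
  obtain ys where ys: "cs ! l = length ys # ys" "set ys \<subseteq> {..<n}"
    using codes[of "cs ! l"] l by auto
  have small: "x < 2 ^ w" if "x \<in> set (cs ! l)" for x
    using that ys n_less len by (fastforce simp: subset_iff)
  show ?thesis
  proof (rule wp_For[where J = ?J and L = "length (cs ! l)"])
    fix k m' os' u v
    assume J: "?J k m' os'"
    then have em': "emitted p (xs @ take k (cs ! l)) m'" by simp
    have f': "fr {z + 7, z + 8} m' (m'(z + 7 := u, z + 8 := v))" by simp
    have "emitted p (xs @ take k (cs ! l)) (m'(z + 7 := u, z + 8 := v))"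
      by (rule emitted_fr[OF em' f']) auto
    then show "?J k (m'(z + 7 := u, z + 8 := v)) os'"
      using J by simp
  next
    fix k m' os'
    assume k: "k < length (cs ! l)" and J: "?J k m' os'" and mk: "m' (z + 7) = k"
    have q': "m' (z + 5) = pos l" using J q by (auto simp: frD)
    have i: "inp ! (pos l + k) = cs ! l ! k" "pos l + k < length inp"
      using inp_pos(1)[OF l k] inp_pos(2)[OF l] k by auto
    let ?m = "m'(z + 10 := pos l + k, z + 9 := cs ! l ! k)"
    have f': "fr {z + 9, z + 10} m' ?m" by simp
    have em': "emitted p (xs @ take k (cs ! l)) ?m"
      by (rule emitted_fr[OF _ f']) (use J in auto)
    have e: "wp (emit (z + 9)) (\<lambda>m'' os''. m'' (z + 7) = k \<and> ?J (Suc k) m'' os'') ?m os'"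
    proof (rule wp_emit[OF _ em'])
      fix m2 assume *: "fr {z + 10, z + 13, z + 14} ?m m2" "glob m2"
        "emitted p ((xs @ take k (cs ! l)) @ [?m (z + 9)]) m2"
      have "m2 (z + 7) = k" using *(1) mk by (simp add: frD)
      moreover have "fr ?A m m2"
        by (rule fr_trans[where A = ?A, OF _ *(1)]) (use J in auto)
      ultimately show "m2 (z + 7) = k \<and> ?J (Suc k) m2 os'"
        using * J k by (simp add: take_Suc_conv_app_nth)
    qed (use J k len cells small in auto)
    show "wp (Ins (Op Add (z + 10) (z + 5) (z + 7)) ;; Ins (Read (z + 9) (z + 10)) ;; emit (z + 9))
      (\<lambda>m'' os''. m'' (z + 7) = k \<and> ?J (Suc k) m'' os'') m' os'"
    proof (rule wp_Seq, rule wp_Add)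
      show "wp (Ins (Read (z + 9) (z + 10)) ;; emit (z + 9))
        (\<lambda>m'' os''. m'' (z + 7) = k \<and> ?J (Suc k) m'' os'') (m'(z + 10 := m' (z + 5) + m' (z + 7))) os'"
      proof (rule wp_Seq, rule wp_Read)
        show "wp (emit (z + 9)) (\<lambda>m'' os''. m'' (z + 7) = k \<and> ?J (Suc k) m'' os'')
         (m'(z + 10 := m' (z + 5) + m' (z + 7), z + 9 := inp ! (m'(z + 10 := m' (z + 5) + m' (z + 7))) (z + 10))) os'"
          using e q' mk i by (simp only: fun_upd_same)
      qed (use cells q' mk i k small in auto)
    qed (use cells q' mk i room in auto)
  next
    show "Q m' os'" if "?J (length (cs ! l)) m' os'" for m' os'
      using that fin by simp
  next
    show "m' (z + 11) = length (cs ! l) \<and> m' 0 = 1" if "?J k m' os'" for k m' os'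
      using that s by (auto simp: frD glob_simps)
  qed (use cells w_pos len em glob in auto)
qed

lemma wp_fetch:
  assumes glob: "glob m" and x: "m z < n" and p: "m (z + 12) = p"
    and fin: "\<And>m'. fr (scratch \<union> {z + 13..<z + 17}) m m' \<Longrightarrow> m' (z + 13) = nth0 (virt (m z)) p \<Longrightarrow> Q m' os"
  shows "wp fetch Q m os"
proof -
  define us where "us = filter (\<lambda>x. x \<in> V) [0..<n]"
  define A where "A = scratch \<union> {z + 13..<z + 17}"
  have A4: "A \<subseteq> {4..}" using cells by (auto simp: A_def scratch_def)
  have len_us: "length us \<le> n" using length_filter_le[of "\<lambda>x. x \<in> V" "[0..<n]"] by (simp add: us_def)
  have len_room: "n + 4 + length (concat cs) + 9 < 2 ^ w" using room by (simp add: inp)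
  have scratchA: "scratch \<subseteq> A" by (simp add: A_def)
  have scr: "scratch \<inter> {z + 12..<z + 15} = {}" "scratch \<inter> {z + 15, z + 16} = {}" by (auto simp: scratch_def)
  define x where "x = m z"
  \<comment> \<open>The final 0 stands for the size of the ground set, unknown until the elements
    have been scanned.\<close>
  define H1 where "H1 = [x, n, 0]"
  define J1 where "J1 xs m' os' \<longleftrightarrow> os' = os \<and> fr A m m' \<and> emitted p (H1 @ xs) m'"
    for xs :: "nat list" and m' :: "nat \<Rightarrow> nat" and os'
  \<comment> \<open>Here the first placeholder is already patched, and a second one, for the number
    of selected sets, closes the list.\<close>
  define H2 where "H2 = x # n # length us # us @ [0]"
  define J2 where "J2 ds m' os' \<longleftrightarrow> os' = os \<and> fr A m m' \<and> emitted p (H2 @ concat ds) m' \<and>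
      m' (z + 15) = 3 + length us \<and> m' (z + 16) = length ds"
    for ds :: "nat list list" and m' :: "nat \<Rightarrow> nat" and os'
  have virt: "virt x = x # n # length us # us @ length (filter sel cs) # concat (filter sel cs)"
    by (simp add: virtual_input_def us_def)

  have end_part: "wp patch_sets Q m' os'"
    if g: "glob m'" and J: "J2 (filter sel cs) m' os'" for m' os'
  proof -
    have m': "m' (z + 12) = p" "m' (z + 13) = nth0 (H2 @ concat (filter sel cs)) p"
      "m' (z + 15) = 3 + length us" "m' (z + 16) = length (filter sel cs)" "os' = os" "fr A m m'"
      using J by (auto simp: J2_def emitted_def)
    have *: "nth0 (virt x) p = (if p = 3 + length us then length (filter sel cs) else m' (z + 13))"
      using nth0_patch[of "x # n # length us # us" "length (filter sel cs)" "concat (filter sel cs)" p]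
      by (simp add: virt m' H2_def)
    have lc: "length (filter sel cs) < 2 ^ w"
      using length_filter_le[of sel cs] length_cs len_room by linarith
    show ?thesis
      unfolding wp_Seq_iff
    proof (intro wp_Equal)
      show "wp (Cond (z + 10) (MOV (z + 13) (z + 16)) Skip) Q (m'(z + 10 := of_bool (m' (z + 15) = m' (z + 12)))) os'"
      proof (cases "3 + length us = p")
        case True
        have "Q (m'(z + 10 := 1, z + 13 := length (filter sel cs))) os"
          by (rule fin) (use True m' * in \<open>auto simp: A_def scratch_def x_def\<close>)
        then show ?thesis using True m' lc cells by (intro wp_Cond wp_MOV wp_Skip) auto
      next
        case False
        have "Q (m'(z + 10 := 0)) os"
          by (rule fin) (use False m' * in \<open>auto simp: A_def scratch_def x_def\<close>)
        then show ?thesis using False m' cells by (intro wp_Cond wp_MOV wp_Skip) auto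
      qed
    qed (use cells w_pos in auto)
  qed

  have mid: "wp (scanF emit_set ;;
     patch_sets) Q m' os"
    if g: "glob m'" and J: "J2 [] m' os" for m'
  proof (rule wp_Seq, rule wp_scanF[where J = J2])
    fix xs m1 m2 os1
    assume J: "J2 xs m1 os1" and f: "fr scratch m1 m2"
    have "fr A m m2" by (rule fr_trans[where A = A, OF _ f _ scratchA]) (use J in \<open>auto simp: J2_def\<close>)
    moreover have "emitted p (H2 @ concat xs) m2"
      using J emitted_fr[OF _ f scr(1)] by (simp add: J2_def)
    moreover have "m2 (z + 15) = m1 (z + 15)" "m2 (z + 16) = m1 (z + 16)"
      using scr by (auto intro!: frD[OF f])
    ultimately show "J2 xs m2 os1" using J by (simp add: J2_def)
  next
    show "J2 [] m' os" "glob m'" by fact+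
  next
    fix l m1 os1
    assume l: "l < length cs" and s: "sel (cs ! l)" and g1: "glob m1" and q: "m1 (z + 5) = pos l"
      and sz: "m1 (z + 6) = length (cs ! l) - 1" and J: "J2 (filter sel (take l cs)) m1 os1"
    let ?post = "\<lambda>m' os'. glob m' \<and> (\<forall>a\<in>{z + 2, z + 4, z + 5, z + 6}. m' a = m1 a) \<and> J2 (filter sel (take l cs) @ [cs ! l]) m' os'"
    let ?ds = "filter sel (take l cs)"
    have pos_len: "0 < length (cs ! l)" using codes[of "cs ! l"] l by auto
    have cl: "length ?ds + 1 \<le> length cs"
      using length_filter_le[of sel "take l cs"] l by simp
    define m2 where "m2 = m1(z + 16 := length ?ds + 1, z + 11 := length (cs ! l))"
    have fm: "fr {z + 11, z + 16} m1 m2" by (simp add: m2_def)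
    have em: "emitted p (H2 @ concat ?ds) m2"
      by (rule emitted_fr[OF _ fm]) (use J in \<open>auto simp: J2_def\<close>)
    have len: "length (H2 @ concat ?ds) + length (cs ! l) + 1 < 2 ^ w"
      using length_concat_sel[OF l] len_us len_room by (simp add: H2_def)
    have 1: "wp emit_code
        ?post m2 os1"
    proof (rule wp_emit_code[OF l _ _ _ em len])
      fix m3
      assume f3: "fr ({z + 7..<z + 11} \<union> {z + 13, z + 14}) m2 m3" and g3: "glob m3"
        and e3: "emitted p ((H2 @ concat ?ds) @ cs ! l) m3"
      have "fr A m m3"
      proof (rule fr_trans[where A = A, OF _ f3])
        show "fr A m m2" using J by (auto simp: J2_def m2_def A_def scratch_def)
      qed (auto simp: A_def scratch_def)
      moreover have "m3 a = m2 a" if "a \<in> {z + 2, z + 4, z + 5, z + 6, z + 15, z + 16}" for a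
        using that by (intro frD[OF f3]) auto
      ultimately show "glob m3 \<and> (\<forall>a\<in>{z + 2, z + 4, z + 5, z + 6}. m3 a = m1 a) \<and>
        J2 (filter sel (take l cs) @ [cs ! l]) m3 os1"
        using J e3 g3 by (simp add: J2_def m2_def)
    qed (use g1 q m2_def cells in auto)
    show "wp emit_set
        ?post m1 os1"
      unfolding wp_Seq_iff
    proof (intro wp_Add)
      have "m1 (z + 16) + m1 0 = length ?ds + 1" "m1 (z + 6) + m1 0 = length (cs ! l)"
        using J sz pos_len glob_simps(1)[OF g1] by (auto simp: J2_def)
      then show "wp emit_code
        ?post
        (m1(z + 16 := m1 (z + 16) + m1 0, z + 11 := (m1(z + 16 := m1 (z + 16) + m1 0)) (z + 6) +
              (m1(z + 16 := m1 (z + 16) + m1 0)) 0)) os1"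
        using 1 by (simp add: m2_def)
      show "m1 (z + 16) + m1 0 < 2 ^ w"
        using cl length_cs len_room J glob_simps(1)[OF g1] by (simp add: J2_def)
      show "(m1(z + 16 := m1 (z + 16) + m1 0)) (z + 6) + (m1(z + 16 := m1 (z + 16) + m1 0)) 0 < 2 ^ w"
        using sz pos_len len glob_simps(1)[OF g1] by simp
    qed (use cells in auto)
  next
    show "wp patch_sets Q m1 os1"
      if "glob m1" "J2 (filter sel cs) m1 os1" for m1 os1
      using end_part that by blast
  qed

  have mid2: "wp (Ins (Const (z + 10) 2) ;; Ins (Op Equal (z + 10) (z + 10) (z + 12)) ;;
     Cond (z + 10) (Ins (Const (z + 10) 3) ;; Ins (Op Sub (z + 13) (z + 14) (z + 10))) Skip ;;
     MOV (z + 15) (z + 14) ;; Ins (Const (z + 16) 0) ;; Ins (Op Add (z + 14) (z + 14) 0) ;; c) Q m' os'"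
    if g: "glob m'" and J: "J1 us m' os'" and c: "\<And>m'. glob m' \<Longrightarrow> J2 [] m' os \<Longrightarrow> wp c Q m' os" for m' os' c
  proof -
    have m': "m' (z + 12) = p" "m' (z + 13) = nth0 (H1 @ us) p" "m' (z + 14) = 3 + length us" "os' = os" "fr A m m'"
      using J by (auto simp: J1_def emitted_def H1_def)
    \<comment> \<open>Position 2 is that of the first placeholder; the program obtains the size as
      the number of streamed values minus 3, the entries in front of the elements.\<close>
    have *: "nth0 H2 p = (if p = 2 then length us else m' (z + 13))"
      using nth0_snoc_0[of "x # n # length us # us" p] nth0_patch[of "[x, n]" "length us" us p]
      by (simp add: H2_def m' H1_def)
    have fin2: "wp c Q m2 os" if "fr A m' m2" "glob m2" "m2 (z + 12) = p" "m2 (z + 13) = nth0 H2 p"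
      "m2 (z + 14) = 4 + length us" "m2 (z + 15) = 3 + length us" "m2 (z + 16) = 0" for m2
    proof (rule c)
      show "J2 [] m2 os" using that m' fr_trans[OF m'(5) that(1)] by (simp add: J2_def emitted_def H2_def)
    qed (rule that)
    have tail: "wp (MOV (z + 15) (z + 14) ;; Ins (Const (z + 16) 0) ;; Ins (Op Add (z + 14) (z + 14) 0) ;; c) Q m2 os"
      if "fr A m' m2" "glob m2" "m2 (z + 12) = p" "m2 (z + 13) = nth0 H2 p" "m2 (z + 14) = 3 + length us" for m2
      unfolding wp_Seq_iff
      apply (intro wp_MOV wp_Const wp_Add fin2)
      using that cells len_us len_room glob_simps(1)[OF that(2)] by (simp_all add: A_def)
    show ?thesis
    proof (cases "p = 2")
      case True
      have t: "wp (MOV (z + 15) (z + 14) ;; Ins (Const (z + 16) 0) ;; Ins (Op Add (z + 14) (z + 14) 0) ;; c) Q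
        (m'(z + 10 := 3, z + 13 := length us)) os"
        by (rule tail) (use True * m' g cells in \<open>auto simp: A_def scratch_def\<close>)
      show ?thesis
        apply (rule wp_Seq, rule wp_Const)
        using cells len_room apply simp_all
        apply (rule wp_Seq, rule wp_Equal)
        using cells w_pos m' True apply simp_all
        apply (rule wp_Seq, rule wp_Cond)
        using cells m' True apply simp_all
        apply (rule wp_Seq, rule wp_Const)
        using cells len_room apply simp_all
        apply (rule wp_Sub)
        using cells m' len_us len_room t by simp_all
    next
      case False
      have t: "wp (MOV (z + 15) (z + 14) ;; Ins (Const (z + 16) 0) ;; Ins (Op Add (z + 14) (z + 14) 0) ;; c) Q
        (m'(z + 10 := 0)) os"
        by (rule tail) (use False * m' g cells in \<open>auto simp: A_def scratch_def\<close>)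
      show ?thesis
        apply (rule wp_Seq, rule wp_Const)
        using cells len_room apply simp_all
        apply (rule wp_Seq, rule wp_Equal)
        using cells w_pos m' False apply simp_all
        apply (rule wp_Seq, rule wp_Cond)
        using cells m' False apply simp_all
        apply (rule wp_Skip)
        using t by simp
    qed
  qed

  have first: "wp emit_elems Q' m' os"
    if g: "glob m'" and J: "J1 [] m' os" and fin': "\<And>m' os'. glob m' \<Longrightarrow> J1 us m' os' \<Longrightarrow> Q' m' os'" for m' Q'
  proof (rule wp_scanU[where J = J1])
    fix xs m1 m2 os1
    assume J: "J1 xs m1 os1" and f: "fr scratch m1 m2"
    have "fr A m m2" by (rule fr_trans[where A = A, OF _ f _ scratchA]) (use J in \<open>auto simp: J1_def\<close>)
    moreover have "emitted p (H1 @ xs) m2"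
      using J emitted_fr[OF _ f scr(1)] by (simp add: J1_def)
    ultimately show "J1 xs m2 os1" using J by (simp add: J1_def)
  next
    fix y m1 os1
    assume y: "y \<in> V" and g1: "glob m1" and m1: "m1 (z + 2) = y" and J: "J1 (filter (\<lambda>x. x \<in> V) [0..<y]) m1 os1"
    have yn: "y < n" using y V by auto
    have len: "length (H1 @ filter (\<lambda>x. x \<in> V) [0..<y]) + 1 < 2 ^ w"
      using length_filter_le[of "\<lambda>x. x \<in> V" "[0..<y]"] yn len_room by (simp add: H1_def)
    show "wp (emit (z + 2)) (\<lambda>m' os'. glob m' \<and> m' (z + 2) = y \<and> J1 (filter (\<lambda>x. x \<in> V) [0..<y] @ [y]) m' os') m1 os1"
    proof (rule wp_emit[OF g1 _ _ _ _ len])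
      fix m2
      assume f: "fr {z + 10, z + 13, z + 14} m1 m2" and g2: "glob m2"
        and e: "emitted p ((H1 @ filter (\<lambda>x. x \<in> V) [0..<y]) @ [m1 (z + 2)]) m2"
      have "fr A m m2" by (rule fr_trans[where A = A, OF _ f]) (use J in \<open>auto simp: J1_def A_def scratch_def\<close>)
      moreover have "m2 (z + 2) = y" using f m1 by (simp add: frD)
      ultimately show "glob m2 \<and> m2 (z + 2) = y \<and> J1 (filter (\<lambda>x. x \<in> V) [0..<y] @ [y]) m2 os1"
        using J e g2 m1 by (simp add: J1_def)
    qed (use J m1 yn len_room cells in \<open>auto simp: J1_def\<close>)
  qed (use that in \<open>auto simp: us_def\<close>)

  define rest where "rest = emit_elems ;;
     Ins (Const (z + 10) 2) ;; Ins (Op Equal (z + 10) (z + 10) (z + 12)) ;;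
     Cond (z + 10) (Ins (Const (z + 10) 3) ;; Ins (Op Sub (z + 13) (z + 14) (z + 10))) Skip ;;
     MOV (z + 15) (z + 14) ;; Ins (Const (z + 16) 0) ;; Ins (Op Add (z + 14) (z + 14) 0) ;;
     scanF emit_set ;;
     patch_sets"
  have rest: "wp rest Q m' os" if "glob m'" "J1 [] m' os" for m'
    unfolding rest_def by (rule wp_Seq, rule first[OF that]) (rule mid2, assumption+, rule mid)
  define m0 where "m0 = m(z + 13 := 0, z + 14 := 0)"
  have m0: "emitted p [] m0" "glob m0" "fr A m m0" "m0 z = x"
    using p glob cells by (auto simp: m0_def emitted_def nth0_def A_def x_def)
  have xn: "x < 2 ^ w" "x < n" using x n_less by (auto simp: x_def)
  have emits: "wp (emit z ;; emit 1 ;; Ins (Op Add (z + 14) (z + 14) 0) ;; rest) Q m0 os"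
  proof (rule wp_Seq, rule wp_emit[OF m0(2,1)])
    fix m1
    assume f1: "fr {z + 10, z + 13, z + 14} m0 m1" and g1: "glob m1" and e1: "emitted p ([] @ [m0 z]) m1"
    show "wp (emit 1 ;; Ins (Op Add (z + 14) (z + 14) 0) ;; rest) Q m1 os"
    proof (rule wp_Seq, rule wp_emit[OF g1 e1])
      fix m2
      assume f2: "fr {z + 10, z + 13, z + 14} m1 m2" and g2: "glob m2" and e2: "emitted p (([] @ [m0 z]) @ [m1 1]) m2"
      let ?m = "m2(z + 14 := 3)"
      have e2': "emitted p [x, n] m2" using e2 m0(4) glob_simps(2)[OF g1] by simp
      have e3: "emitted p H1 ?m"
        using e2' nth0_snoc_0[of "[x, n]" p] by (auto simp: emitted_def H1_def)
      have sub: "{z + 10, z + 13, z + 14} \<subseteq> A" by (auto simp: A_def scratch_def)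
      have "fr A m m2" by (rule fr_trans[OF fr_trans[OF m0(3) f1 order_refl sub] f2 order_refl sub])
      then have "J1 [] ?m os" using e3 by (simp add: J1_def A_def)
      then have *: "wp rest Q ?m os" using g2 cells by (intro rest) auto
      show "wp (Ins (Op Add (z + 14) (z + 14) 0) ;; rest) Q m2 os"
        by (rule wp_Seq, rule wp_Add)
          (use * e2' glob_simps(1)[OF g2] cells room in \<open>auto simp: emitted_def numeral_3_eq_3\<close>)
    qed (use g1 cells n_less in \<open>auto simp: glob_simps\<close>)
  qed (use cells m0 xn one_less in auto)
  show ?thesis
    unfolding fetch_def rest_def[symmetric]
    by (rule wp_Seq, rule wp_Const, simp_all, (use cells in simp)?, rule wp_Seq, rule wp_Const)
      (use cells emits in \<open>simp_all add: m0_def\<close>)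
qed

end

section \<open>Simulation of a program\<close>

text \<open>
  The simulated memory starts at cell \<open>z + 21\<close>, the simulated program counter is cell \<open>z + 17\<close>,
  and the last output is kept in cell \<open>z + 19\<close>.  Values are reduced modulo the content of cell 3.
\<close>

primrec sim_instr :: "nat \<Rightarrow> com \<Rightarrow> nat \<Rightarrow> nat \<Rightarrow> instr \<Rightarrow> com" where
  "sim_instr z fe L p (Const k v) = Ins (Const (z + 21 + k) v) ;;
     Ins (Op Mod (z + 21 + k) (z + 21 + k) 3) ;; Ins (Const (z + 17) (Suc p))"
| "sim_instr z fe L p (Op f k i j) = Ins (Op f (z + 21 + k) (z + 21 + i) (z + 21 + j)) ;;
     Ins (Op Mod (z + 21 + k) (z + 21 + k) 3) ;; Ins (Const (z + 17) (Suc p))"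
| "sim_instr z fe L p (Load k i) = Ins (Const (z + 20) (z + 21)) ;;
     Ins (Op Add (z + 20) (z + 20) (z + 21 + i)) ;; Ins (Load (z + 21 + k) (z + 20)) ;;
     Ins (Const (z + 17) (Suc p))"
| "sim_instr z fe L p (Store i j) = Ins (Const (z + 20) (z + 21)) ;;
     Ins (Op Add (z + 20) (z + 20) (z + 21 + i)) ;; Ins (Store (z + 20) (z + 21 + j)) ;;
     Ins (Const (z + 17) (Suc p))"
| "sim_instr z fe L p (Read k i) = MOV (z + 12) (z + 21 + i) ;; fe ;;
     Ins (Op Mod (z + 21 + k) (z + 13) 3) ;; Ins (Const (z + 17) (Suc p))"
| "sim_instr z fe L p (Write i) = MOV (z + 19) (z + 21 + i) ;; Ins (Const (z + 17) (Suc p))"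
| "sim_instr z fe L p (Jump l) = Ins (Const (z + 17) (min l L))"
| "sim_instr z fe L p (JumpZero i l) =
     Cond (z + 21 + i) (Ins (Const (z + 17) (Suc p))) (Ins (Const (z + 17) (min l L)))"

text \<open>Jump targets are constants of the program, so a chain of comparisons has to replace a
  computed jump.\<close>

primrec dispatch :: "nat \<Rightarrow> com \<Rightarrow> nat \<Rightarrow> nat \<Rightarrow> instr list \<Rightarrow> com" where
  "dispatch z fe L p [] = Skip"
| "dispatch z fe L p (I # Is) = Ins (Const (z + 20) p) ;; Ins (Op Equal (z + 20) (z + 20) (z + 17)) ;;
     Cond (z + 20) (sim_instr z fe L p I) (dispatch z fe L (Suc p) Is)"

text \<open>Simulations at one level reuse the same cells, while \<open>run\<close> begins with zero
  memory.\<close>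

primrec clear :: "nat \<Rightarrow> nat \<Rightarrow> com" where
  "clear z 0 = Skip"
| "clear z (Suc h) = clear z h ;; Ins (Const (z + h) 0)"

definition simulate :: "nat \<Rightarrow> com \<Rightarrow> program \<Rightarrow> nat \<Rightarrow> com" where
  "simulate z fe P H = clear (z + 21) H ;; Ins (Const (z + 17) 0) ;; Ins (Const (z + 19) 0) ;;
     Ins (Const (z + 18) (length P)) ;; Ins (Op Less (z + 18) (z + 17) (z + 18)) ;;
     While (z + 18) (dispatch z fe (length P) 0 P ;;
       Ins (Const (z + 18) (length P)) ;; Ins (Op Less (z + 18) (z + 17) (z + 18)))"

text \<open>\<open>binop_val\<close> depends on the word length only for \<open>Sub\<close>, and
  there \<open>2 ^ w\<close> and \<open>2 ^ v\<close> agree modulo \<open>2 ^ v\<close>. Hence the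
  same instruction on longer words, followed by one reduction, is exact.\<close>

lemma take_bit_binop:
  assumes "v \<le> w" "x < 2 ^ v" "y < 2 ^ v"
  shows "take_bit w (binop_val w f x y) mod 2 ^ v = take_bit v (binop_val v f x y)"
proof -
  have *: "take_bit w k mod 2 ^ v = take_bit v k" for k :: nat
    using assms(1) by (simp add: take_bit_take_bit flip: take_bit_eq_mod)
  show ?thesis
  proof (cases "f = Sub")
    case True
    have "(2::nat) ^ w = 2 ^ v * 2 ^ (w - v)" using assms(1) by (simp flip: power_add)
    then have "(2::nat) ^ w = 2 ^ v + 2 ^ v * (2 ^ (w - v) - 1)" by (simp add: diff_mult_distrib2)
    then have "x + 2 ^ w - y = (x + 2 ^ v - y) + 2 ^ v * (2 ^ (w - v) - 1)" using assms(3) by simp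
    then have "(x + 2 ^ w - y) mod 2 ^ v = (x + 2 ^ v - y) mod 2 ^ v" by (metis mod_mult_self2)
    then show ?thesis using True by (simp add: *) (simp add: take_bit_eq_mod)
  next
    case False
    then show ?thesis by (cases f) (simp_all add: * del: take_bit_and take_bit_or take_bit_xor)
  qed
qed

lemma step_mem_less: "(\<forall>a. mem s a < 2 ^ w) \<Longrightarrow> (\<forall>a. mem (step w inp P s) a < 2 ^ w)"
proof (cases "halted P s")
  case False
  assume *: "\<forall>a. mem s a < 2 ^ w"
  have "\<forall>a. new_mem w inp m I a < 2 ^ w" if "\<forall>a. m a < 2 ^ w" for m I
    using that by (cases I) (auto simp: take_bit_nat_less_exp)
  then show ?thesis using False * by (simp add: step_def Let_def)
qed (simp add: step_def)

lemma finite_accessed: "finite (accessed m I)"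
  by (cases I) auto

lemma hi_step: "hi s \<le> hi (step w inp P s)"
  by (simp add: step_def Let_def finite_accessed)

lemma run_Suc: "run w inp P (Suc t) = step w inp P (run w inp P t)"
  by (simp add: run_def)

lemma hi_run_mono: "t \<le> u \<Longrightarrow> hi (run w inp P t) \<le> hi (run w inp P u)"
  by (rule lift_Suc_mono_le[of "\<lambda>t. hi (run w inp P t)"]) (simp_all add: run_Suc hi_step)

lemma run_halted:
  assumes "halted P (run w inp P t)" "t \<le> u"
  shows "run w inp P u = run w inp P t"
  using assms(2) by (induction u rule: dec_induct) (use assms(1) in \<open>auto simp: run_Suc step_def\<close>)

lemma mem_run_less: "mem (run w inp P t) a < 2 ^ w"
proof -
  have "\<forall>a. mem (run w inp P t) a < 2 ^ w"
    by (induction t) (simp add: run_def init_def, simp add: run_Suc step_mem_less)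
  then show ?thesis by blast
qed

context ram
begin

lemma wp_Const_take_bit: "k < N \<Longrightarrow> Q (m(k := take_bit w v)) os \<Longrightarrow> wp (Ins (Const k v)) Q m os"
  by (rule wp_Ins) auto

lemma wp_Op: "k < N \<Longrightarrow> i < N \<Longrightarrow> j < N \<Longrightarrow> Q (m(k := take_bit w (binop_val w f (m i) (m j)))) os \<Longrightarrow>
    wp (Ins (Op f k i j)) Q m os"
  by (rule wp_Ins) auto

lemma wp_clear: "b + h \<le> N \<Longrightarrow> (\<And>m'. fr {b..<b + h} m m' \<Longrightarrow> (\<forall>a<h. m' (b + a) = 0) \<Longrightarrow> Q m' os) \<Longrightarrow>
   wp (clear b h) Q m os"
proof (induction h arbitrary: Q)
  case 0
  then show ?case by (auto intro: wp_Skip)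
next
  case (Suc h)
  show ?case unfolding clear.simps
  proof (rule wp_Seq, rule Suc.IH)
    fix m' assume *: "fr {b..<b + h} m m'" "\<forall>a<h. m' (b + a) = 0"
    have "Q (m'(b + h := 0)) os"
    proof (rule Suc.prems(2))
      show "fr {b..<b + Suc h} m (m'(b + h := 0))"
        using fr_mono[OF *(1), of "{b..<b + Suc h}"] by simp
      show "\<forall>a<Suc h. (m'(b + h := 0)) (b + a) = 0" using *(2) by (auto simp: less_Suc_eq)
    qed
    then show "wp (Ins (Const (b + h) 0)) Q m' os" using Suc.prems(1) by (intro wp_Const) auto
  qed (use Suc.prems in auto)
qed

lemma wp_dispatch:
  assumes "z + 21 \<le> N" "0 < w" "p < 2 ^ w"
  shows "k \<le> p \<Longrightarrow> p - k < length Is \<Longrightarrow> m (z + 17) = p \<Longrightarrow>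
    (\<And>m'. fr {z + 20} m m' \<Longrightarrow> wp (sim_instr z fe L p (Is ! (p - k))) Q m' os) \<Longrightarrow>
    wp (dispatch z fe L k Is) Q m os"
proof (induction Is arbitrary: k m)
  case (Cons I Is)
  let ?m = "m(z + 20 := of_bool (k = p))"
  have "wp (Cond (z + 20) (sim_instr z fe L k I) (dispatch z fe L (Suc k) Is)) Q ?m os"
  proof (rule wp_Cond)
    assume "?m (z + 20) \<noteq> 0"
    then have k: "k = p" by (auto split: if_splits)
    have "fr {z + 20} m ?m" by simp
    from Cons.prems(4)[OF this] show "wp (sim_instr z fe L k I) Q ?m os"
      by (simp only: k diff_self_eq_0 nth_Cons_0)
  next
    assume "?m (z + 20) = 0"
    then have "k \<noteq> p" by (auto split: if_splits)
    then have k: "Suc k \<le> p" using Cons.prems by simp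
    then have pk: "p - k = Suc (p - Suc k)" by simp
    show "wp (dispatch z fe L (Suc k) Is) Q ?m os"
    proof (rule Cons.IH[OF k])
      fix m' assume "fr {z + 20} ?m m'"
      then have "fr {z + 20} m m'" by (rule fr_trans[where A = "{z + 20}", rotated]) auto
      then show "wp (sim_instr z fe L p (Is ! (p - Suc k))) Q m' os"
        using Cons.prems(4)[of m'] pk by simp
    qed (use Cons.prems pk in auto)
  qed (use assms in auto)
  moreover have "k < 2 ^ w" using assms Cons.prems by linarith
  ultimately show ?case
    unfolding dispatch.simps by (intro wp_Seq wp_Const wp_Equal) (use assms Cons.prems in simp_all)
qed simp

end

text \<open>\<open>P_runs\<close> promises termination only for \<open>x \<in> V\<close>, which is
  why membership in \<open>V\<close> is tested before a simulation starts. The bound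
  \<open>ws < w\<close> makes the modulus \<open>2 ^ ws\<close> itself a word.\<close>

locale sim = level +
  fixes P :: program and H :: nat and T :: "nat set"
  assumes space: "z + 21 + H \<le> N" "N < 2 ^ w"
    and P_less: "length P < 2 ^ w"
    and ws_less: "ws < w"
    and P_runs: "\<And>x. x \<in> V \<Longrightarrow> \<exists>t. halted P (run ws (virt x) P t) \<and>
       out (run ws (virt x) P t) = [of_bool (x \<in> T)] \<and> hi (run ws (virt x) P t) \<le> H"
begin

definition simcells :: "nat set" where
  "simcells = {4..<z} \<union> {z + 2..<z + 21 + H}"

text \<open>All halting positions are identified with \<open>length P\<close>, because a jump target
  may be too large for a word. Only the last output is kept: the runs in question write a single
  truth value.\<close>

definition rel :: "config \<Rightarrow> (nat \<Rightarrow> nat) \<Rightarrow> bool" where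
  "rel s m \<longleftrightarrow> m (z + 17) = min (pc s) (length P) \<and> (\<forall>a<H. m (z + 21 + a) = mem s a) \<and>
     (out s \<noteq> [] \<longrightarrow> m (z + 19) = last (out s))"

lemma simcells_4: "simcells \<subseteq> {4..}"
  using cells by (auto simp: simcells_def)

lemma ws_pow: "(2::nat) ^ ws < 2 ^ w"
  using ws_less by simp

lemma wp_sim_instr:
  assumes p: "pc s = p" "p < length P" and rel: "rel s m" and s: "\<forall>a. mem s a < 2 ^ ws"
    and acc: "accessed (mem s) (P ! p) \<subseteq> {..<H}"
    and glob: "glob m" and x: "m z = x" "x < n"
    and fin: "\<And>m'. glob m' \<Longrightarrow> fr simcells m m' \<Longrightarrow> rel (step ws (virt x) P s) m' \<Longrightarrow> Q m' os"
  shows "wp (sim_instr z fetch (length P) p (P ! p)) Q m os"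
proof -
  have st: "step ws (virt x) P s = \<lparr>pc = new_pc (mem s) p (P ! p), mem = new_mem ws (virt x) (mem s) (P ! p),
     hi = Max (insert (hi s) (Suc ` accessed (mem s) (P ! p))), out = out s @ written (mem s) (P ! p)\<rparr>"
    using step_inside[of s P] p by simp
  have m3: "m 3 = 2 ^ ws" "4 \<le> z" using glob_simps(4)[OF glob] cells by auto
  have sm: "mem s a < 2 ^ ws" "mem s a < 2 ^ w" for a
    using s ws_pow less_trans by blast+
  have vm: "m (z + 21 + a) = mem s a" if "a < H" for a
    using rel that by (simp add: rel_def)
  have pL: "Suc p < 2 ^ w" "min l (length P) < 2 ^ w" for l using p P_less by auto
  have res: "out s \<noteq> [] \<longrightarrow> m (z + 19) = last (out s)" using rel by (simp add: rel_def)
  have rel': "rel (step ws (virt x) P s) m'"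
    if "m' (z + 17) = min (new_pc (mem s) p (P ! p)) (length P)"
      "\<And>a. a < H \<Longrightarrow> m' (z + 21 + a) = new_mem ws (virt x) (mem s) (P ! p) a"
      "out s @ written (mem s) (P ! p) \<noteq> [] \<Longrightarrow> m' (z + 19) = last (out s @ written (mem s) (P ! p))" for m'
    using that by (simp add: rel_def st)
  show ?thesis
  proof (cases "P ! p")
    case (Const k v)
    have k: "k < H" using acc Const by simp
    have "take_bit w v mod 2 ^ ws = take_bit ws v"
      using ws_less by (simp add: take_bit_take_bit flip: take_bit_eq_mod)
    moreover have "Q (m(z + 21 + k := take_bit ws v, z + 17 := Suc p)) os"
      by (rule fin) (use k glob p res Const vm in \<open>auto simp: simcells_def intro!: rel'\<close>)
    moreover have "take_bit ws v < 2 ^ w"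
      using ws_pow take_bit_nat_less_exp less_trans by blast
    ultimately show ?thesis
      unfolding Const sim_instr.simps
      by (intro wp_Seq wp_Const_take_bit[of "z + 21 + k"] wp_Mod wp_Const)
        (use k space m3 pL in simp_all)
  next
    case (Op f k i j)
    have k: "k < H" "i < H" "j < H" using acc Op by simp_all
    let ?v = "take_bit ws (binop_val ws f (mem s i) (mem s j))"
    have "take_bit w (binop_val w f (mem s i) (mem s j)) mod 2 ^ ws = ?v"
      using take_bit_binop[of ws w "mem s i" "mem s j" f] ws_less sm by simp
    moreover have "Q (m(z + 21 + k := ?v, z + 17 := Suc p)) os"
      by (rule fin) (use k glob p res Op vm in \<open>auto simp: simcells_def intro!: rel'\<close>)
    moreover have "?v < 2 ^ w"
      using ws_pow take_bit_nat_less_exp less_trans by blast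
    ultimately show ?thesis
      unfolding Op sim_instr.simps
      by (intro wp_Seq wp_Op[where f = f] wp_Mod wp_Const) (use k space m3 pL vm in simp_all)
  next
    case (Load k i)
    have k: "k < H" "i < H" "mem s i < H" using acc Load by simp_all
    have "Q (m(z + 20 := z + 21 + mem s i, z + 21 + k := mem s (mem s i), z + 17 := Suc p)) os"
      by (rule fin) (use k glob p res Load vm in \<open>auto simp: simcells_def intro!: rel'\<close>)
    then show ?thesis
      unfolding Load sim_instr.simps
      by (intro wp_Seq wp_Const wp_Add wp_Load) (use k space pL vm in simp_all)
  next
    case (Store i j)
    have k: "i < H" "j < H" "mem s i < H" using acc Store by simp_all
    have "Q (m(z + 20 := z + 21 + mem s i, z + 21 + mem s i := mem s j, z + 17 := Suc p)) os"
      by (rule fin) (use k glob p res Store vm in \<open>auto simp: simcells_def intro!: rel'\<close>)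
    then show ?thesis
      unfolding Store sim_instr.simps
      by (intro wp_Seq wp_Const wp_Add wp_Store) (use k space pL vm in simp_all)
  next
    case (Read k i)
    have k: "k < H" "i < H" using acc Read by simp_all
    let ?m = "m(z + 12 := mem s i)"
    have 1: "wp (fetch ;; Ins (Op Mod (z + 21 + k) (z + 13) 3) ;; Ins (Const (z + 17) (Suc p))) Q ?m os"
    proof (rule wp_Seq, rule wp_fetch[where p = "mem s i"])
      fix m1
      assume f1: "fr (scratch \<union> {z + 13..<z + 17}) ?m m1" and r: "m1 (z + 13) = nth0 (virt (?m z)) (mem s i)"
      let ?v = "take_bit ws (nth0 (virt x) (mem s i))"
      let ?m2 = "m1(z + 21 + k := ?v, z + 17 := Suc p)"
      have v: "?v = (if mem s i < length (virt x) then take_bit ws (virt x ! mem s i) else 0)"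
        by (simp add: nth0_def)
      have f2: "fr simcells m m1"
        by (rule fr_trans[where A = simcells, OF _ f1]) (auto simp: simcells_def scratch_def)
      \<comment> \<open>\<open>fetch\<close> stays below \<open>z + 17\<close>, so the simulated
        counter, output and memory survive the reading.\<close>
      have same: "m1 a = m a" if "z + 17 \<le> a" for a
      proof -
        have "m1 a = ?m a" by (rule frD[OF f1]) (use that in \<open>auto simp: scratch_def\<close>)
        then show ?thesis using that by auto
      qed
      have g1: "glob m1" by (rule glob_fr[OF glob f2 simcells_4])
      have "Q ?m2 os"
      proof (rule fin)
        show "fr simcells m ?m2" using f2 k by (simp add: simcells_def)
        show "rel (step ws (virt x) P s) ?m2"
        proof (rule rel')
          show "?m2 (z + 21 + a) = new_mem ws (virt x) (mem s) (P ! p) a" if "a < H" for a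
            using that same vm[OF that] by (simp add: Read v del: take_bit_of_0)
        qed (use Read same p res in auto)
      qed (use g1 in simp)
      moreover have "?v < 2 ^ w" using ws_pow take_bit_nat_less_exp less_trans by blast
      ultimately show "wp (Ins (Op Mod (z + 21 + k) (z + 13) 3) ;; Ins (Const (z + 17) (Suc p))) Q m1 os"
        by (intro wp_Seq wp_Mod wp_Const)
          (use k space pL r x glob_simps(4)[OF g1] in \<open>simp_all add: take_bit_eq_mod\<close>)
    qed (use glob x cells in auto)
    show ?thesis
      unfolding Read sim_instr.simps
      by (rule wp_Seq, rule wp_MOV) (use 1 k space vm[OF k(2)] sm in simp_all)
  next
    case (Write i)
    have k: "i < H" using acc Write by simp
    have "Q (m(z + 19 := mem s i, z + 17 := Suc p)) os"
      by (rule fin) (use k glob p res Write vm in \<open>auto simp: simcells_def intro!: rel'\<close>)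
    then show ?thesis
      unfolding Write sim_instr.simps
      by (intro wp_Seq wp_MOV wp_Const) (use k space pL vm sm in simp_all)
  next
    case (Jump l)
    have "Q (m(z + 17 := min l (length P))) os"
      by (rule fin) (use glob p res Jump vm in \<open>auto simp: simcells_def intro!: rel'\<close>)
    then show ?thesis
      unfolding Jump sim_instr.simps by (intro wp_Const) (use space pL in simp_all)
  next
    case (JumpZero i l)
    have k: "i < H" using acc JumpZero by simp
    have "Q (m(z + 17 := (if mem s i = 0 then min l (length P) else Suc p))) os"
      by (rule fin) (use glob p res JumpZero vm in \<open>auto simp: simcells_def intro!: rel'\<close>)
    then show ?thesis
      unfolding JumpZero sim_instr.simps by (intro wp_Cond wp_Const) (use k space pL vm in simp_all)
  qed
qed

abbreviation test :: com where
  "test \<equiv> Ins (Const (z + 18) (length P)) ;; Ins (Op Less (z + 18) (z + 17) (z + 18))"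

abbreviation loop :: com where
  "loop \<equiv> While (z + 18) (dispatch z fetch (length P) 0 P ;; test)"

lemma wp_simulate:
  assumes glob: "glob m" and x: "m z = x" "x \<in> V"
    and fin: "\<And>m'. glob m' \<Longrightarrow> fr simcells m m' \<Longrightarrow> m' (z + 19) = of_bool (x \<in> T) \<Longrightarrow> Q m' os"
  shows "wp (simulate z fetch P H) Q m os"
proof -
  define r where "r t = run ws (virt x) P t" for t
  obtain t where t: "halted P (r t)" "out (r t) = [of_bool (x \<in> T)]" "hi (r t) \<le> H"
    using P_runs x unfolding r_def by blast
  \<comment> \<open>The given \<open>t\<close> may lie beyond the halting time; the loop makes
    exactly as many rounds as there are steps up to the first halt.\<close>
  define t0 where "t0 = (LEAST t. halted P (r t))"
  have t0: "halted P (r t0)" "t0 \<le> t" unfolding t0_def by (rule LeastI, rule t, rule Least_le, rule t)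
  have rt: "r t = r t0" using run_halted[of P ws "virt x" t0 t] t0 by (simp add: r_def)
  have act: "pc (r k) < length P \<and> accessed (mem (r k)) (P ! pc (r k)) \<subseteq> {..<H}" if k: "k < t0" for k
  proof -
    have nh: "pc (r k) < length P" using not_less_Least[of k "\<lambda>t. halted P (r t)"] k by (auto simp: t0_def halted_def)
    \<comment> \<open>\<open>hi\<close> never decreases, so the final space bound limits every
      single access before it.\<close>
    have "hi (r (Suc k)) \<le> H" using hi_run_mono[of "Suc k" t ws "virt x" P] k t0 t by (simp add: r_def)
    then have "\<forall>a\<in>accessed (mem (r k)) (P ! pc (r k)). Suc a \<le> H"
      using nh by (simp add: r_def run_Suc step_inside finite_accessed)
    then show ?thesis using nh by (auto simp: Suc_le_eq)
  qed
  have xn: "x < n" using x V by auto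
  have znot: "z \<notin> simcells" by (auto simp: simcells_def)
  define I where "I k m' os' \<longleftrightarrow> os' = os \<and> glob m' \<and> fr simcells m m' \<and> rel (r k) m' \<and>
     m' (z + 18) = of_bool (pc (r k) < length P)" for k m' os'
  have test: "wp test (I k) m' os"
    if g: "glob m'" and f: "fr simcells m m'" and rel: "rel (r k) m'" for k m'
  proof -
    have "rel (r k) (m'(z + 18 := v))" for v using rel by (auto simp: rel_def)
    then have "I k (m'(z + 18 := of_bool (pc (r k) < length P))) os"
      using g f cells by (simp add: I_def simcells_def)
    then show ?thesis
      by (intro wp_Seq wp_Const wp_Less) (use cells w_pos P_less rel in \<open>auto simp: rel_def min_less_iff_disj\<close>)
  qed
  have loop: "wp loop Q m' os'"
    if "I 0 m' os'" for m' os'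
  proof (rule wp_While_count[where J = I and T = t0])
    fix k m1 os1
    assume k: "k < t0" and I: "I k m1 os1"
    then have m1: "os1 = os" "glob m1" "fr simcells m m1" "rel (r k) m1" "m1 (z + 18) = of_bool (pc (r k) < length P)"
      by (auto simp: I_def)
    have "wp (dispatch z fetch (length P) 0 P ;; test) (I (Suc k)) m1 os"
    proof (rule wp_Seq, rule wp_dispatch[where p = "pc (r k)"])
      fix m2 assume f2: "fr {z + 20} m1 m2"
      have rel2: "rel (r k) m2"
      proof -
        have "m2 a = m1 a" if "a \<noteq> z + 20" for a using frD[OF f2] that by simp
        then show ?thesis using m1(4) by (simp add: rel_def)
      qed
      have g2: "glob m2" by (rule glob_fr[OF m1(2) f2]) (use cells in auto)
      have f2': "fr simcells m m2" by (rule fr_trans[OF m1(3) f2]) (auto simp: simcells_def)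
      show "wp (sim_instr z fetch (length P) (pc (r k)) (P ! (pc (r k) - 0)))
         (wp test (I (Suc k))) m2 os"
        unfolding diff_zero
      proof (rule wp_sim_instr[where s = "r k" and x = x])
        fix m3 assume g3: "glob m3" and f3: "fr simcells m2 m3" and rel3: "rel (step ws (virt x) P (r k)) m3"
        show "wp test (I (Suc k)) m3 os"
        proof (rule test[OF g3])
          show "fr simcells m m3" by (rule fr_trans[OF f2' f3 order_refl order_refl])
          show "rel (r (Suc k)) m3" using rel3 by (simp add: r_def run_Suc)
        qed
      qed (use act[OF k] rel2 g2 x xn frD[OF f2' znot] mem_run_less in \<open>auto simp: r_def\<close>)
    qed (use cells w_pos act[OF k] P_less m1 in \<open>auto simp: rel_def\<close>)
    then show "m1 (z + 18) \<noteq> 0 \<and> wp (dispatch z fetch (length P) 0 P ;; test) (I (Suc k)) m1 os1"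
      using act[OF k] m1 by simp
  next
    fix m1 os1
    assume I: "I t0 m1 os1"
    have "m1 (z + 18) = 0" using I t0 by (simp add: I_def halted_def)
    moreover have "Q m1 os1" using I t rt by (auto simp: I_def rel_def intro!: fin)
    ultimately show "m1 (z + 18) = 0 \<and> Q m1 os1" by simp
  qed (use that cells in auto)
  show ?thesis
    unfolding simulate_def
  proof (rule wp_Seq, rule wp_clear)
    fix m1 assume f1: "fr {z + 21..<z + 21 + H} m m1" and 0: "\<forall>a<H. m1 (z + 21 + a) = 0"
    let ?m2 = "m1(z + 17 := 0, z + 19 := 0)"
    have "{z + 21..<z + 21 + H} \<subseteq> {4..}" using cells by auto
    then have g2: "glob ?m2" using glob_fr[OF glob f1] cells by simp
    have "fr simcells m m1" by (rule fr_mono[OF f1]) (auto simp: simcells_def)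
    then have f2: "fr simcells m ?m2" by (simp add: simcells_def)
    have rel: "rel (r 0) ?m2" using 0 by (simp add: rel_def r_def run_def init_def)
    have t: "wp (Ins (Const (z + 18) (length P)) ;; Ins (Op Less (z + 18) (z + 17) (z + 18)) ;; loop) Q ?m2 os"
      using wp_mono[OF test[OF g2 f2 rel] loop] by (simp only: wp_Seq_iff)
    show "wp (Ins (Const (z + 17) 0) ;; Ins (Const (z + 19) 0) ;;
       Ins (Const (z + 18) (length P)) ;; Ins (Op Less (z + 18) (z + 17) (z + 18)) ;; loop) Q m1 os"
      by (rule wp_Seq, rule wp_Const, (use cells in simp)[1], simp, rule wp_Seq, rule wp_Const)
        (use cells t in simp_all)
  qed (use space in auto)
qed

end

section \<open>Recursion over the levels\<close>

text \<open>Cells 0 to 3 are global. A block holds an argument, an answer, the work cells of scans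
  and simulation, and from offset 21 on the memory of the simulated program.\<close>

definition blk :: "nat \<Rightarrow> nat \<Rightarrow> nat" where
  "blk H j = 4 + j * (21 + H)"

lemma blk_Suc: "blk H (Suc j) = blk H j + 21 + H"
  by (simp add: blk_def)

lemma blk_ge: "4 \<le> blk H j"
  by (simp add: blk_def)

text \<open>Every argument below \<open>n\<close> lies in the initial ground set, so the base case
  answers 1. In the step, the answer for the previous ground set guards the simulation and remains
  the answer if it is 0; otherwise the comparison with cell 0, which contains 1, negates the verdict
  at offset 19.\<close>

primrec memU :: "(nat \<Rightarrow> program) \<Rightarrow> nat \<Rightarrow> nat \<Rightarrow> com" where
  "memU P H 0 = Ins (Const (blk H 0 + 1) 1)"
| "memU P H (Suc j) = MOV (blk H j) (blk H (Suc j)) ;; memU P H j ;; MOV (blk H (Suc j) + 1) (blk H j + 1) ;;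
     Cond (blk H (Suc j) + 1)
       (simulate (blk H (Suc j)) (level.fetch (memU P H j) (blk H j) (blk H j + 1) (blk H (Suc j))) (P (Suc j)) H ;;
        Ins (Op Less (blk H (Suc j) + 1) (blk H (Suc j) + 19) 0)) Skip"

text \<open>The loop raises cell 3 to \<open>2 ^ (b * \<lceil>log 2 n\<rceil> + e)\<close>, the modulus of the simulated machine.\<close>

definition prologue :: "nat \<Rightarrow> nat \<Rightarrow> com \<Rightarrow> com" where
  "prologue b e off = Ins (Const 0 1) ;; off ;; Ins (Read 1 2) ;; Ins (Const 3 (2 ^ e)) ;; Ins (Const 4 1) ;;
     Ins (Op Less 5 4 1) ;;
     While 5 (Ins (Op Add 4 4 4) ;; Ins (Const 5 (2 ^ b)) ;; Ins (Op Mul 3 3 5) ;; Ins (Op Less 5 4 1))"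

text \<open>Cell 2 must receive the length of the query in front of the instance: 0 when
  enumerating, 1 for an element.\<close>

definition off_const :: "nat \<Rightarrow> com" where
  "off_const v = Ins (Const 2 v)"

text \<open>The code of a set is one longer than the number with which it starts.\<close>

definition off_set :: com where
  "off_set = Ins (Const 4 0) ;; Ins (Read 2 4) ;; Ins (Op Add 2 2 0)"

definition enum_S :: "(nat \<Rightarrow> program) \<Rightarrow> nat \<Rightarrow> nat \<Rightarrow> com" where
  "enum_S P H i = (let z = blk H (Suc i); j = i - 1 in
     For (z + 2) (z + 3) 1 (MOV (blk H j) (z + 2) ;; memU P H j ;; Cond (blk H j + 1)
       (MOV (blk H i) (z + 2) ;; memU P H i ;; Cond (blk H i + 1) Skip (Ins (Write (z + 2)))) Skip))"

definition enum_U :: "(nat \<Rightarrow> program) \<Rightarrow> nat \<Rightarrow> nat \<Rightarrow> com" where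
  "enum_U P H i = (let z = blk H (Suc i) in
     For (z + 2) (z + 3) 1 (MOV (blk H i) (z + 2) ;; memU P H i ;; Cond (blk H i + 1) (Ins (Write (z + 2))) Skip))"

definition enum_F :: "(nat \<Rightarrow> program) \<Rightarrow> nat \<Rightarrow> nat \<Rightarrow> com" where
  "enum_F P H i = (let z = blk H (Suc i) in
     level.scanF (memU P H i) (blk H i) (blk H i + 1) z
      (Ins (Op Add (z + 11) (z + 6) 0) ;; For (z + 7) (z + 8) (z + 11)
        (Ins (Op Add (z + 10) (z + 5) (z + 7)) ;; Ins (Read (z + 9) (z + 10)) ;; Ins (Write (z + 9)))))"

text \<open>The first answer is parked in cell \<open>z\<close>, above everything that
  \<open>memU P H i\<close> changes. The final \<open>Less\<close> of two truth values yields 1 iff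
  the first answer is positive and the second negative.\<close>

definition query_S :: "(nat \<Rightarrow> program) \<Rightarrow> nat \<Rightarrow> nat \<Rightarrow> com" where
  "query_S P H i = (let z = blk H (Suc i); j = i - 1 in
     Ins (Const z 0) ;; Ins (Read (blk H j) z) ;; memU P H j ;; MOV z (blk H j + 1) ;;
     Ins (Const (z + 1) 0) ;; Ins (Read (blk H i) (z + 1)) ;; memU P H i ;;
     Ins (Op Less z (blk H i + 1) z) ;; Ins (Write z))"

definition query_U :: "(nat \<Rightarrow> program) \<Rightarrow> nat \<Rightarrow> nat \<Rightarrow> com" where
  "query_U P H i = (let z = blk H (Suc i) in
     Ins (Const z 0) ;; Ins (Read (blk H i) z) ;; memU P H i ;; Ins (Write (blk H i + 1)))"

text \<open>
  The code of the queried set is a prefix of the input, and a code starts with its length, so a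
  code \<open>c\<close> is that of the query iff it agrees with the first \<open>length c\<close> entries of the input.
\<close>

definition query_F :: "(nat \<Rightarrow> program) \<Rightarrow> nat \<Rightarrow> nat \<Rightarrow> com" where
  "query_F P H i = (let z = blk H (Suc i) in
     Ins (Const (z + 12) 0) ;;
     level.scanF (memU P H i) (blk H i) (blk H i + 1) z
      (Ins (Const (z + 9) 1) ;; Ins (Op Add (z + 11) (z + 6) 0) ;; For (z + 7) (z + 8) (z + 11)
        (Ins (Op Add (z + 10) (z + 5) (z + 7)) ;; Ins (Read (z + 13) (z + 10)) ;; Ins (Read (z + 14) (z + 7)) ;;
         Ins (Op Equal (z + 13) (z + 13) (z + 14)) ;; Ins (Op Mul (z + 9) (z + 9) (z + 13))) ;;
       Cond (z + 9) (Ins (Const (z + 12) 1)) Skip) ;;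
     Ins (Write (z + 12)))"

section \<open>Correctness of the six programs on large instances\<close>

lemma (in level) glob_fr_low: "glob m \<Longrightarrow> fr {4..<x} m m' \<Longrightarrow> glob m'"
  by (rule glob_fr) auto

text \<open>\<open>lg\<close> is characterised by comparisons with powers of two because these are
  what the doubling loop of \<open>prologue\<close> tests. \<open>N\<close> leaves room for block
  \<open>i + 1\<close>, in which the outermost scan works.\<close>

locale inst = ram +
  fixes n :: nat and pre :: "nat list" and cs :: "nat list list" and ws b e lg :: nat
    and P :: "nat \<Rightarrow> program" and H i :: nat and U T :: "nat \<Rightarrow> nat set"
  assumes inp: "inp = pre @ n # n # [0..<n] @ length cs # concat cs"
    and codes: "\<And>c. c \<in> set cs \<Longrightarrow> \<exists>xs. c = length xs # xs \<and> set xs \<subseteq> {..<n}"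
    and room: "length inp + 10 < 2 ^ w"
    and pre_less: "\<And>v. v \<in> set pre \<Longrightarrow> v < 2 ^ w"
    and N: "N = blk H (i + 2)" "N < 2 ^ w"
    and U0: "U 0 = {..<n}" and U_Suc: "\<And>j. U (Suc j) = U j - T (Suc j)"
    and T_sub: "\<And>j. j < i \<Longrightarrow> T (Suc j) \<subseteq> U j"
    and P_less: "\<And>j. j < i \<Longrightarrow> length (P (Suc j)) < 2 ^ w"
    and ws: "ws < w" "ws = b * lg + e" "1 \<le> b"
    and lg: "\<And>t. n \<le> 2 ^ t \<longleftrightarrow> lg \<le> t"
    and P_runs: "\<And>j x. j < i \<Longrightarrow> x \<in> U j \<Longrightarrow> \<exists>t. halted (P (Suc j)) (run ws (virtual_input n cs (U j) x) (P (Suc j)) t) \<and>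
       out (run ws (virtual_input n cs (U j) x) (P (Suc j)) t) = [of_bool (x \<in> T (Suc j))] \<and>
       hi (run ws (virtual_input n cs (U j) x) (P (Suc j)) t) \<le> H"
begin

lemma U_sub: "U j \<subseteq> {..<n}"
  by (induction j) (auto simp: U0 U_Suc)

text \<open>\<open>z\<close> is arbitrary because the routine for \<open>j\<close> is called from
  several places: by the next level from its own block, and by the final programs from block
  \<open>i + 1\<close>. In the induction step the hypothesis makes \<open>fetch\<close> available,
  and with it the simulation of \<open>P (Suc j)\<close>.\<close>

lemma level_memU:
  "j \<le> i \<Longrightarrow> blk H (Suc j) \<le> z \<Longrightarrow> z + 21 \<le> N \<Longrightarrow>
     level w inp N n pre cs ws (memU P H j) (blk H j) (blk H j + 1) z (U j)"
proof (induction j arbitrary: z)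
  case 0
  show ?case
  proof (unfold_locales)
    fix m os
    assume "m 1 = n" "m (blk H 0) < n"
    then show "wp (memU P H 0) (\<lambda>m' os'. os' = os \<and> m' (blk H 0 + 1) = of_bool (m (blk H 0) \<in> U 0) \<and> fr {4..<z} m m') m os"
      unfolding memU.simps by (intro wp_Const) (use 0 room U0 in \<open>auto simp: blk_def\<close>)
  qed (use inp codes room 0 U_sub in \<open>auto simp: blk_def\<close>)
next
  case (Suc j)
  define z1 where "z1 = blk H (Suc j)"
  have z1: "blk H j + 21 + H = z1" "z1 + 21 + H \<le> z" "z + 21 \<le> N" "4 \<le> blk H j"
    using Suc.prems by (auto simp: z1_def blk_def)
  have L: "level w inp N n pre cs ws (memU P H j) (blk H j) (blk H j + 1) z1 (U j)"
    by (rule Suc.IH) (use Suc.prems z1 in \<open>auto simp: z1_def\<close>)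
  interpret L: level w inp N n pre cs ws "memU P H j" "blk H j" "blk H j + 1" z1 "U j"
    by (rule L)
  interpret S: sim w inp N n pre cs ws "memU P H j" "blk H j" "blk H j + 1" z1 "U j" "P (Suc j)" H "T (Suc j)"
    by unfold_locales (use z1 N(2) P_less ws P_runs Suc.prems in auto)
  show ?case
  proof (unfold_locales)
    fix m os
    assume g: "m 0 = 1" "m 1 = n" "m 2 = length pre" "m 3 = 2 ^ ws" and y: "m (blk H (Suc j)) < n"
    define y where "y = m z1"
    have yn: "y < n" "y < 2 ^ w" using y L.n_less by (auto simp: y_def z1_def)
    let ?Q = "\<lambda>m' (os' :: nat list). os' = os \<and> m' (z1 + 1) = of_bool (y \<in> U (Suc j)) \<and> fr {4..<z} m m'"
    let ?m = "m(blk H j := y)"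
    have g': "L.glob ?m" using g z1 by (simp add: L.glob_def)
    have sub: "{4..<z1} \<subseteq> {4..<z}" "S.simcells \<subseteq> {4..<z}" using z1 by (auto simp: S.simcells_def)
    let ?c = "Cond (z1 + 1) (simulate z1 L.fetch (P (Suc j)) H ;; Ins (Op Less (z1 + 1) (z1 + 19) 0)) Skip"
    have cond: "wp ?c ?Q m2 os"
      if f2: "fr {4..<z} m m2" and z2: "m2 z1 = y" and r: "m2 (z1 + 1) = of_bool (y \<in> U j)" and g2: "L.glob m2" for m2
    proof (rule wp_Cond)
      assume "m2 (z1 + 1) \<noteq> 0"
      then have yU: "y \<in> U j" using r by auto
      show "wp (simulate z1 L.fetch (P (Suc j)) H ;; Ins (Op Less (z1 + 1) (z1 + 19) 0)) ?Q m2 os"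
      proof (rule wp_Seq, rule S.wp_simulate[OF g2 z2 yU])
        fix m3 assume g3: "L.glob m3" and f3: "fr S.simcells m2 m3" and r3: "m3 (z1 + 19) = of_bool (y \<in> T (Suc j))"
        have "fr {4..<z} m m3" by (rule fr_trans[OF f2 f3 order_refl sub(2)])
        then show "wp (Ins (Op Less (z1 + 1) (z1 + 19) 0)) ?Q m3 os"
          by (intro wp_Less) (use z1 r3 yU L.w_pos L.glob_simps(1)[OF g3] in \<open>auto simp: U_Suc\<close>)
      qed
    next
      assume "m2 (z1 + 1) = 0"
      then have "y \<notin> U j" using r by auto
      then show "wp Skip ?Q m2 os" using r f2 by (intro wp_Skip) (auto simp: U_Suc)
    qed (use z1 in auto)
    have "wp (memU P H (Suc j)) ?Q m os"
      unfolding memU.simps z1_def[symmetric]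
    proof (rule wp_Seq, rule wp_MOV)
      show "wp (memU P H j ;; MOV (z1 + 1) (blk H j + 1) ;; ?c) ?Q (m(blk H j := m z1)) os"
        unfolding y_def[symmetric]
      proof (rule wp_Seq, rule wp_mono[OF L.mu[OF g']])
        fix m1 os1
        assume *: "os1 = os \<and> m1 (blk H j + 1) = of_bool (?m (blk H j) \<in> U j) \<and> fr {4..<z1} ?m m1"
        have f1: "fr {4..<z} m m1"
          by (rule fr_trans[of "{4..<z}" m ?m "{4..<z1}"]) (use * z1 in auto)
        have m1: "m1 (blk H j + 1) = of_bool (y \<in> U j)" using * by simp
        have "m1 z1 = ?m z1" by (rule frD[of "{4..<z1}" ?m m1]) (use * in auto)
        then have z: "m1 z1 = y" using z1 by (simp add: y_def)
        have g1: "L.glob m1" by (rule L.glob_fr_low[OF g', of z1]) (use * in blast)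
        let ?m2 = "m1(z1 + 1 := of_bool (y \<in> U j))"
        have "wp (?c) ?Q ?m2 os"
          by (rule cond) (use f1 z1 z g1 in auto)
        then show "wp (MOV (z1 + 1) (blk H j + 1) ;; ?c) ?Q m1 os1"
          by (intro wp_Seq wp_MOV) (use * m1 z1 L.one_less in auto)
      qed (use yn in auto)
    qed (use z1 yn in \<open>auto simp: y_def\<close>)
    then show "wp (memU P H (Suc j)) (\<lambda>m' os'. os' = os \<and>
        m' (blk H (Suc j) + 1) = of_bool (m (blk H (Suc j)) \<in> U (Suc j)) \<and> fr {4..<z} m m') m os"
      by (simp add: y_def z1_def)
  qed (use inp codes room z1 U_sub in \<open>auto simp: z1_def\<close>)
qed

sublocale L: level w inp N n pre cs ws "memU P H i" "blk H i" "blk H i + 1" "blk H (Suc i)" "U i"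
  by (rule level_memU) (auto simp: N blk_def)

sublocale M: level w inp N n pre cs ws "memU P H (i - 1)" "blk H (i - 1)" "blk H (i - 1) + 1" "blk H (Suc i)" "U (i - 1)"
  by (rule level_memU) (auto simp: N blk_def)

lemma N_eq: "N = blk H i + 42 + 2 * H" "blk H (Suc i) = blk H i + 21 + H"
  by (auto simp: N blk_def)

lemma wp_prologue:
  assumes off: "\<And>m Q. m 0 = 1 \<Longrightarrow> (\<And>m'. m' 0 = 1 \<Longrightarrow> m' 2 = length pre \<Longrightarrow> Q m' os) \<Longrightarrow> wp off Q m os"
    and fin: "\<And>m'. L.glob m' \<Longrightarrow> Q m' os"
  shows "wp (prologue b e off) Q m os"
proof -
  let ?body = "Ins (Op Add 4 4 4) ;; Ins (Const 5 (2 ^ b)) ;; Ins (Op Mul 3 3 5) ;; Ins (Op Less 5 4 1)"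
  let ?loop = "While 5 ?body"
  have N5: "5 < N" using N_eq by simp
  have nn: "inp ! length pre = n" "length pre < length inp" by (simp_all add: inp nth_append)
  have pw: "(2::nat) ^ t < 2 ^ w" if "t \<le> ws" for t using ws that by simp
  define J where "J k m' os' \<longleftrightarrow> os' = os \<and> m' 0 = 1 \<and> m' (Suc 0) = n \<and> m' 2 = length pre \<and>
     m' 3 = 2 ^ (b * k + e) \<and> m' 4 = 2 ^ k \<and> m' 5 = of_bool (2 ^ k < n)" for k :: nat and m' :: "nat \<Rightarrow> nat" and os' :: "nat list"
  have loop: "wp (?loop) Q m' os"
    if "J 0 m' os" for m'
  proof (rule wp_While_count[where J = J and T = lg])
    fix k m' os'
    assume k: "k < lg" and J: "J k m' os'"
    have lt: "2 ^ k < n" using lg[of k] k by auto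
    \<comment> \<open>As \<open>k < lg\<close>, the exponent reached in this round is at most
      \<open>ws < w\<close>, so the product does not wrap around.\<close>
    have "b * Suc k + e \<le> ws" using ws k by (simp add: Suc_le_eq del: mult_Suc_right)
    then have 1: "(2::nat) ^ (b * k + e) * 2 ^ b < 2 ^ w" "b \<le> ws" "Suc k \<le> ws"
      using pw[of "b * Suc k + e"] ws(3) mult_le_mono1[OF ws(3), of "Suc k"] by (auto simp: power_add mult_ac)
    have "(2::nat) ^ k + 2 ^ k < 2 ^ w" using pw[OF 1(3)] by simp
    then have "wp ?body (J (Suc k)) m' os'"
      by (intro wp_rules) (use J N5 1 pw[OF 1(2)] L.w_pos in \<open>auto simp: J_def power_add mult_ac\<close>)
    then show "m' 5 \<noteq> 0 \<and> wp ?body (J (Suc k)) m' os'"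
      using J lt by (simp add: J_def)
  next
    fix m' os'
    assume J: "J lg m' os'"
    have "\<not> 2 ^ lg < n" using lg[of lg] by simp
    moreover have "L.glob m'" unfolding L.glob_def using J ws(2) by (simp add: J_def)
    ultimately show "m' 5 = 0 \<and> Q m' os'" using J fin[of m'] by (simp add: J_def)
  qed (use that N5 in auto)
  have e_less: "(2::nat) ^ e < 2 ^ w" using pw[of e] ws by simp
  show ?thesis
    unfolding prologue_def
  proof (rule wp_Seq, rule wp_Const)
    show "wp (off ;; Ins (Read 1 2) ;; Ins (Const 3 (2 ^ e)) ;; Ins (Const 4 1) ;; Ins (Op Less 5 4 1) ;;
     ?loop) Q (m(0 := 1)) os"
    proof (rule wp_Seq, rule off)
      fix m' :: "nat \<Rightarrow> nat" assume m': "m' 0 = 1" "m' 2 = length pre"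
      let ?m = "m'(1 := n, 3 := 2 ^ e, 4 := 1, 5 := of_bool (1 < n))"
      have "J 0 ?m os" using m' by (simp add: J_def)
      then have *: "wp (?loop) Q ?m os"
        by (rule loop)
      show "wp (Ins (Read 1 2) ;; Ins (Const 3 (2 ^ e)) ;; Ins (Const 4 1) ;; Ins (Op Less 5 4 1) ;;
       ?loop) Q m' os"
        by (intro wp_Seq wp_Read wp_Const wp_Less) (use * m' nn N5 L.n_less L.one_less e_less L.w_pos in auto)
    qed auto
  qed (use N5 L.one_less in auto)
qed

lemma wp_prologue_const:
  assumes "\<And>m'. L.glob m' \<Longrightarrow> wp c Q m' os"
  shows "wp (prologue b e (off_const (length pre)) ;; c) Q m os"
proof (rule wp_Seq, rule wp_prologue)
  fix m :: "nat \<Rightarrow> nat" and Q :: "(nat \<Rightarrow> nat) \<Rightarrow> nat list \<Rightarrow> bool"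
  assume m: "m 0 = 1" and Q: "\<And>m'. m' 0 = 1 \<Longrightarrow> m' 2 = length pre \<Longrightarrow> Q m' os"
  have "length pre < 2 ^ w" using room by (simp add: inp)
  then show "wp (off_const (length pre)) Q m os"
    unfolding off_const_def by (intro wp_Const Q) (use m N_eq in auto)
qed (rule assms)

lemma wp_prologue_set:
  assumes "pre = length qs # qs" "\<And>m'. L.glob m' \<Longrightarrow> wp c Q m' os"
  shows "wp (prologue b e off_set ;; c) Q m os"
proof (rule wp_Seq, rule wp_prologue)
  fix m :: "nat \<Rightarrow> nat" and Q :: "(nat \<Rightarrow> nat) \<Rightarrow> nat list \<Rightarrow> bool" assume m: "m 0 = 1" and Q: "\<And>m'. m' 0 = 1 \<Longrightarrow> m' 2 = length pre \<Longrightarrow> Q m' os"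
  have *: "inp ! 0 = length qs" "0 < length inp" "Suc (length qs) < 2 ^ w" using room by (auto simp: inp assms(1))
  show "wp off_set Q m os"
    unfolding off_set_def
    by (intro wp_rules) (use * m N_eq room in \<open>auto simp: assms(1) intro!: Q\<close>)
qed (use assms in auto)

lemma wp_enum_U:
  assumes "L.glob m"
  shows "wp (enum_U P H i) (\<lambda>m' os'. os' = filter (\<lambda>x. x \<in> U i) [0..<n]) m []"
  unfolding enum_U_def Let_def
proof (rule L.wp_scanU[where J = "\<lambda>xs m os. os = xs"])
  fix x m os
  assume "L.glob m" "m (blk H (Suc i) + 2) = x" "os = filter (\<lambda>x. x \<in> U i) [0..<x]"
  then show "wp (Ins (Write (blk H (Suc i) + 2)))
       (\<lambda>m' os'. L.glob m' \<and> m' (blk H (Suc i) + 2) = x \<and> os' = filter (\<lambda>x. x \<in> U i) [0..<x] @ [x]) m os"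
    by (intro wp_Write) (auto simp: N_eq)
qed (use assms in auto)

lemma wp_enum_S:
  assumes "L.glob m" "1 \<le> i"
  shows "wp (enum_S P H i) (\<lambda>m' os'. os' = filter (\<lambda>x. x \<in> T i) [0..<n]) m []"
  unfolding enum_S_def Let_def
proof (rule M.wp_scanU[where J = "\<lambda>xs m os. os = filter (\<lambda>x. x \<notin> U i) xs"])
  fix x m os
  let ?z = "blk H (Suc i)"
  assume x: "x \<in> U (i - 1)" and g: "L.glob m" and m: "m (?z + 2) = x"
    and os: "os = filter (\<lambda>x. x \<notin> U i) (filter (\<lambda>x. x \<in> U (i - 1)) [0..<x])"
  have xn: "x < n" "x < 2 ^ w" using x M.V L.n_less by auto
  let ?m = "m(blk H i := x)"
  let ?Q = "\<lambda>m' (os' :: nat list). L.glob m' \<and> m' (?z + 2) = x \<and>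
     os' = filter (\<lambda>x. x \<notin> U i) (filter (\<lambda>x. x \<in> U (i - 1)) [0..<x] @ [x])"
  have g': "L.glob ?m" using g blk_ge[of H i] by simp
  have "wp (memU P H i ;; Cond (blk H i + 1) Skip (Ins (Write (?z + 2)))) ?Q ?m os"
  proof (rule wp_Seq, rule wp_mono[OF L.mu[OF g']])
    fix m' os' assume *: "os' = os \<and> m' (blk H i + 1) = of_bool (?m (blk H i) \<in> U i) \<and> fr {4..<?z} ?m m'"
    have g2: "L.glob m'" by (rule L.glob_fr_low[OF g', of ?z]) (use * in blast)
    have "m' (?z + 2) = ?m (?z + 2)" by (rule frD[of "{4..<?z}" ?m m']) (use * in auto)
    then have "m' (?z + 2) = x" using m by (simp add: N_eq)
    then show "wp (Cond (blk H i + 1) Skip (Ins (Write (?z + 2)))) ?Q m' os'"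
      by (intro wp_Cond wp_Skip wp_Write) (use * g2 os in \<open>auto simp: N_eq\<close>)
  qed (use xn in auto)
  then show "wp (MOV (blk H i) (?z + 2) ;; memU P H i ;; Cond (blk H i + 1) Skip (Ins (Write (?z + 2)))) ?Q m os"
    by (intro wp_Seq[of "Ins I" for I] wp_MOV) (use m xn in \<open>auto simp: N_eq\<close>)
next
  fix m' os'
  assume "os' = filter (\<lambda>x. x \<notin> U i) (filter (\<lambda>x. x \<in> U (i - 1)) [0..<n])"
  moreover have "(x \<in> U (i - 1) \<and> x \<notin> U i) = (x \<in> T i)" for x
    using U_Suc[of "i - 1"] T_sub[of "i - 1"] assms(2) by auto
  ultimately show "os' = filter (\<lambda>x. x \<in> T i) [0..<n]" by simp
qed (use assms in auto)

lemma wp_enum_F: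
  assumes "L.glob m"
  shows "wp (enum_F P H i) (\<lambda>m' os'. os' = concat (filter (\<lambda>c. set (tl c) \<subseteq> U i) cs)) m []"
  unfolding enum_F_def Let_def
proof (rule L.wp_scanF[where J = "\<lambda>ds m os. os = concat ds"])
  fix l m os
  let ?z = "blk H (Suc i)"
  let ?write = "For (?z + 7) (?z + 8) (?z + 11) (Ins (Op Add (?z + 10) (?z + 5) (?z + 7)) ;; Ins (Read (?z + 9) (?z + 10)) ;; Ins (Write (?z + 9)))"
  assume l: "l < length cs" and g: "L.glob m" and q: "m (?z + 5) = L.pos l"
    and s: "m (?z + 6) = length (cs ! l) - 1" and os: "os = concat (filter L.sel (take l cs))"
  let ?post = "\<lambda>m' os'. L.glob m' \<and> (\<forall>a\<in>{?z + 2, ?z + 4, ?z + 5, ?z + 6}. m' a = m a) \<and> os' = concat (filter L.sel (take l cs) @ [cs ! l])"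
  have len: "0 < length (cs ! l)" using codes[of "cs ! l"] l by auto
  have bound: "L.pos l + length (cs ! l) \<le> length inp" by (rule L.inp_pos(2)[OF l])
  have small: "x < 2 ^ w" if "x \<in> set (cs ! l)" for x
    using that codes[of "cs ! l"] l L.n_less bound room by (fastforce simp: subset_iff)
  let ?J = "\<lambda>k m' os'. L.glob m' \<and> fr {?z + 7..<?z + 12} m m' \<and> m' (?z + 11) = length (cs ! l) \<and> os' = os @ take k (cs ! l)"
  have 1: "wp ?write (?J (length (cs ! l))) m1 os1" if J: "?J 0 m1 os1" for m1 os1
  proof (rule wp_For[where J = ?J and L = "length (cs ! l)"])
    fix k m' os'
    assume k: "k < length (cs ! l)" and J: "?J k m' os'" and mk: "m' (?z + 7) = k"
    have q': "m' (?z + 5) = L.pos l" using J q by (auto simp: frD)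
    show "wp (Ins (Op Add (?z + 10) (?z + 5) (?z + 7)) ;; Ins (Read (?z + 9) (?z + 10)) ;; Ins (Write (?z + 9)))
       (\<lambda>m' os'. m' (?z + 7) = k \<and> ?J (Suc k) m' os') m' os'"
      by (intro wp_rules)
        (use J k mk q' bound room L.inp_pos(1)[OF l k] small[OF nth_mem[OF k]] in \<open>auto simp: N_eq take_Suc_conv_app_nth\<close>)
  next
    show "m' (?z + 11) = length (cs ! l) \<and> m' 0 = 1" if "?J k m' os'" for k m' os'
      using that by (simp add: L.glob_simps)
  qed (use J bound room L.w_pos in \<open>auto simp: N_eq\<close>)
  have "wp ?write
     ?post (m(?z + 11 := length (cs ! l))) os"
    by (rule wp_mono[OF 1]) (use g os in \<open>auto simp: frD N_eq\<close>)
  then show "wp (Ins (Op Add (?z + 11) (?z + 6) 0) ;; ?write)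
     ?post m os"
    by (intro wp_Seq wp_Add) (use s len bound room L.glob_simps(1)[OF g] in \<open>auto simp: N_eq\<close>)
next
  show "os' = concat (filter (\<lambda>c. set (tl c) \<subseteq> U i) cs)" if "os' = concat (filter L.sel cs)" for os'
    using that by (simp add: code_within_def[abs_def])
qed (use assms in auto)

lemma wp_query_U:
  assumes "L.glob m" "pre = [q]" "q < n"
  shows "wp (query_U P H i) (\<lambda>m' os'. os' = [of_bool (q \<in> U i)]) m []"
proof -
  let ?z = "blk H (Suc i)"
  let ?m = "m(?z := 0, blk H i := q)"
  have i0: "inp ! 0 = q" "0 < length inp" "q < 2 ^ w" using assms L.n_less by (auto simp: inp)
  have g': "L.glob ?m" using assms(1) blk_ge[of H] by simp
  have *: "wp (memU P H i ;; Ins (Write (blk H i + 1))) (\<lambda>m' os'. os' = [of_bool (q \<in> U i)]) ?m []"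
  proof (rule wp_Seq, rule wp_mono[OF L.mu[OF g']])
    fix m' and os' :: "nat list" assume "os' = [] \<and> m' (blk H i + 1) = of_bool (?m (blk H i) \<in> U i) \<and> fr {4..<?z} ?m m'"
    then show "wp (Ins (Write (blk H i + 1))) (\<lambda>m' os'. os' = [of_bool (q \<in> U i)]) m' os'"
      by (intro wp_Write) (auto simp: N_eq)
  qed (use assms(3) in auto)
  show ?thesis
    unfolding query_U_def Let_def
    by (intro wp_Seq[of "Ins I" for I] wp_Const wp_Read) (use i0 * in \<open>auto simp: N_eq\<close>)
qed

lemma wp_query_S:
  assumes "L.glob m" "pre = [q]" "q < n" "1 \<le> i"
  shows "wp (query_S P H i) (\<lambda>m' os'. os' = [of_bool (q \<in> T i)]) m []"
proof -
  let ?z = "blk H (Suc i)"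
  let ?j = "blk H (i - 1)"
  let ?Q = "\<lambda>m' (os' :: nat list). os' = [of_bool (q \<in> T i)]"
  have i0: "inp ! 0 = q" "0 < length inp" "q < 2 ^ w" using assms L.n_less by (auto simp: inp)
  have j: "?j + 21 + H = blk H i" using blk_Suc[of H "i - 1"] assms(4) by simp
  have inS: "(q \<in> T i) = (q \<in> U (i - 1) \<and> q \<notin> U i)"
    using U_Suc[of "i - 1"] T_sub[of "i - 1"] assms(4) by auto
  let ?c3 = "memU P H i ;; Ins (Op Less ?z (blk H i + 1) ?z) ;; Ins (Write ?z)"
  have 3: "wp ?c3 ?Q m' []" if g: "L.glob m'" and q: "m' (blk H i) = q" and r: "m' ?z = of_bool (q \<in> U (i - 1))" for m'
  proof (rule wp_Seq, rule wp_mono[OF L.mu[OF g]])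
    fix m2 and os2 :: "nat list" assume *: "os2 = [] \<and> m2 (blk H i + 1) = of_bool (m' (blk H i) \<in> U i) \<and> fr {4..<?z} m' m2"
    have "m2 ?z = m' ?z" by (rule frD[of "{4..<?z}" m' m2]) (use * in auto)
    then show "wp (Ins (Op Less ?z (blk H i + 1) ?z) ;; Ins (Write ?z)) ?Q m2 os2"
      by (intro wp_rules) (use * q r L.w_pos in \<open>auto simp: N_eq inS\<close>)
  qed (use q assms in auto)
  let ?c2 = "MOV ?z (?j + 1) ;; Ins (Const (?z + 1) 0) ;; Ins (Read (blk H i) (?z + 1)) ;; ?c3"
  have 2: "wp ?c2 ?Q m' []" if g: "L.glob m'" and r: "m' (?j + 1) = of_bool (q \<in> U (i - 1))" for m'
  proof -
    have "wp ?c3 ?Q (m'(?z := of_bool (q \<in> U (i - 1)), ?z + 1 := 0, blk H i := q)) []"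
      by (rule 3) (use g blk_ge[of H] in \<open>auto simp: N_eq\<close>)
    then show ?thesis
      by (intro wp_Seq[of "Ins I" for I] wp_MOV wp_Const wp_Read) (use i0 r j L.one_less in \<open>auto simp: N_eq\<close>)
  qed
  let ?m = "m(?z := 0, ?j := q)"
  have g': "L.glob ?m" using assms(1) blk_ge[of H] by simp
  have 1: "wp (memU P H (i - 1) ;; ?c2) ?Q ?m []"
  proof (rule wp_Seq, rule wp_mono[OF M.mu[OF g']])
    fix m2 and os2 :: "nat list" assume *: "os2 = [] \<and> m2 (?j + 1) = of_bool (?m ?j \<in> U (i - 1)) \<and> fr {4..<?z} ?m m2"
    have g2: "L.glob m2" by (rule L.glob_fr_low[OF g', of ?z]) (use * in blast)
    show "wp ?c2 ?Q m2 os2" using 2[OF g2] * by simp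
  qed (use assms in auto)
  show ?thesis
    unfolding query_S_def Let_def
    by (rule wp_Seq, rule wp_Const, (use j in \<open>simp add: N_eq\<close>)[1], simp, rule wp_Seq, rule wp_Read)
      (use i0 1 j in \<open>auto simp: N_eq\<close>)
qed

lemma wp_query_F:
  assumes g0: "L.glob m" and pre: "pre = length qs # qs"
  shows "wp (query_F P H i) (\<lambda>m' os'. os' = [of_bool (pre \<in> {c \<in> set cs. set (tl c) \<subseteq> U i})]) m []"
proof -
  let ?z = "blk H (Suc i)"
  let ?compare = "For (?z + 7) (?z + 8) (?z + 11) (Ins (Op Add (?z + 10) (?z + 5) (?z + 7)) ;; Ins (Read (?z + 13) (?z + 10)) ;; Ins (Read (?z + 14) (?z + 7)) ;; Ins (Op Equal (?z + 13) (?z + 13) (?z + 14)) ;; Ins (Op Mul (?z + 9) (?z + 9) (?z + 13)))"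
  let ?body = "Ins (Const (?z + 9) 1) ;; Ins (Op Add (?z + 11) (?z + 6) 0) ;; ?compare ;; Cond (?z + 9) (Ins (Const (?z + 12) 1)) Skip"
  let ?J = "\<lambda>ds m (os :: nat list). os = [] \<and> m (?z + 12) = of_bool (pre \<in> set ds)"
  have body: "wp ?body
     (\<lambda>m' os'. L.glob m' \<and> (\<forall>a\<in>{?z + 2, ?z + 4, ?z + 5, ?z + 6}. m' a = m a) \<and>
       ?J (filter L.sel (take l cs) @ [cs ! l]) m' os') m os"
    if l: "l < length cs" and g: "L.glob m" and q: "m (?z + 5) = L.pos l"
    and s: "m (?z + 6) = length (cs ! l) - 1" and J0: "?J (filter L.sel (take l cs)) m os" for l m os
  proof -
    let ?post = "\<lambda>m' os'. L.glob m' \<and> (\<forall>a\<in>{?z + 2, ?z + 4, ?z + 5, ?z + 6}. m' a = m a) \<and> ?J (filter L.sel (take l cs) @ [cs ! l]) m' os'"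
    obtain xs where xs: "cs ! l = length xs # xs" using codes[of "cs ! l"] l by auto
    have len: "0 < length (cs ! l)" using xs by simp
    have bound: "L.pos l + length (cs ! l) \<le> length inp" by (rule L.inp_pos(2)[OF l])
    have small: "x < 2 ^ w" if "x \<in> set (cs ! l)" for x
      using that codes[of "cs ! l"] l L.n_less bound room by (fastforce simp: subset_iff)
    \<comment> \<open>A comparison may run past the query into the instance, so every input entry
      must fit into a word, or \<open>Read\<close> would truncate it.\<close>
    have small': "inp ! k < 2 ^ w" if "k < length inp" for k
    proof -
      have "\<exists>ys. c = length ys # ys \<and> set ys \<subseteq> {..<n}" if "c \<in> set cs" for c using codes that .
      moreover have "length c \<le> length (concat cs)" if "c \<in> set cs" for c
        using that by (induction cs) auto
      ultimately have "v < 2 ^ w" if "v \<in> set (concat cs)" for v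
        using that room L.n_less by (fastforce simp: inp subset_iff)
      moreover have "inp ! k \<in> set inp" using that by simp
      ultimately show ?thesis
        using pre_less L.n_less L.length_cs room by (auto simp: inp)
    qed
    let ?K = "\<lambda>k m' (os' :: nat list). L.glob m' \<and> os' = [] \<and> fr ({?z + 7..<?z + 12} \<union> {?z + 13, ?z + 14}) m m' \<and>
       m' (?z + 11) = length (cs ! l) \<and> m' (?z + 9) = of_bool (\<forall>t<k. cs ! l ! t = inp ! t)"
    \<comment> \<open>Entry 0 is a length on both sides; once it agrees, \<open>pre\<close> and
      \<open>cs ! l\<close> are equally long, and agreement of all entries is equality.\<close>
    have eq: "(\<forall>t<length (cs ! l). cs ! l ! t = inp ! t) \<longleftrightarrow> pre = cs ! l"
    proof
      assume *: "\<forall>t<length (cs ! l). cs ! l ! t = inp ! t"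
      have "length xs = length qs" using *[rule_format, of 0] xs by (simp add: inp pre)
      then have "length pre = length (cs ! l)" using xs pre by simp
      then show "pre = cs ! l" using * by (intro nth_equalityI) (auto simp: inp nth_append)
    qed (auto simp: inp nth_append)
    have 1: "wp ?compare
        (?K (length (cs ! l))) m1 os1" if K: "?K 0 m1 os1" for m1 os1
    proof (rule wp_For[where J = ?K and L = "length (cs ! l)"])
      fix k m' os'
      assume k: "k < length (cs ! l)" and J: "?K k m' os'" and mk: "m' (?z + 7) = k"
      have q': "m' (?z + 5) = L.pos l" using J q by (auto simp: frD)
      show "wp (Ins (Op Add (?z + 10) (?z + 5) (?z + 7)) ;; Ins (Read (?z + 13) (?z + 10)) ;; Ins (Read (?z + 14) (?z + 7)) ;;
         Ins (Op Equal (?z + 13) (?z + 13) (?z + 14)) ;; Ins (Op Mul (?z + 9) (?z + 9) (?z + 13)))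
         (\<lambda>m' os'. m' (?z + 7) = k \<and> ?K (Suc k) m' os') m' os'"
        by (intro wp_rules)
          (use J k mk q' bound room L.inp_pos(1)[OF l k] small[OF nth_mem[OF k]] small'[of k] L.w_pos L.one_less
            in \<open>auto simp: N_eq less_Suc_eq\<close>)
    next
      show "m' (?z + 11) = length (cs ! l) \<and> m' 0 = 1" if "?K k m' os'" for k m' os'
        using that by (simp add: L.glob_simps)
    qed (use K bound room L.w_pos in \<open>auto simp: N_eq\<close>)
    let ?m = "m(?z + 9 := 1, ?z + 11 := length (cs ! l))"
    have 2: "wp (?compare ;;
       Cond (?z + 9) (Ins (Const (?z + 12) 1)) Skip)
     ?post ?m os"
    proof (rule wp_Seq, rule wp_mono[OF 1])
      show "?K 0 ?m os" using g J0 by (auto simp: N_eq)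
    next
      fix m' os'
      assume K: "?K (length (cs ! l)) m' os'"
      define hit where "hit \<longleftrightarrow> pre = cs ! l"
      define old where "old \<longleftrightarrow> pre \<in> set (filter L.sel (take l cs))"
      have tgt: "pre \<in> set (filter L.sel (take l cs) @ [cs ! l]) \<longleftrightarrow> old \<or> hit" by (auto simp: old_def hit_def)
      have same: "m' a = m a" if "a \<in> {?z + 2, ?z + 4, ?z + 5, ?z + 6, ?z + 12}" for a
        by (rule frD[of "{?z + 7..<?z + 12} \<union> {?z + 13, ?z + 14}" m m']) (use K that in auto)
      have "m' (?z + 12) = of_bool old" "\<forall>a\<in>{?z + 2, ?z + 4, ?z + 5, ?z + 6}. m' a = m a"
        using J0 same by (simp_all add: old_def)
      moreover have "m' (?z + 9) = of_bool hit" "L.glob m'" "os' = []"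
        using K eq by (simp_all add: hit_def)
      ultimately have m': "m' (?z + 12) = of_bool old" "\<forall>a\<in>{?z + 2, ?z + 4, ?z + 5, ?z + 6}. m' a = m a"
        "m' (?z + 9) = of_bool hit" "L.glob m'" "os' = []" by blast+
      show "wp (Cond (?z + 9) (Ins (Const (?z + 12) 1)) Skip)
       ?post m' os'"
        unfolding tgt by (intro wp_Cond wp_Const wp_Skip) (use m' L.one_less in \<open>auto simp: N_eq\<close>)
    qed
    show ?thesis
      by (intro wp_Seq[of "Ins I" for I] wp_Const wp_Add)
        (use 2 s len bound room L.glob_simps(1)[OF g] L.one_less in \<open>auto simp: N_eq\<close>)
  qed
  show ?thesis
    unfolding query_F_def Let_def
  proof (rule wp_Seq, rule wp_Const)
    show "wp (L.scanF ?body ;; Ins (Write (?z + 12)))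
     (\<lambda>m' os'. os' = [of_bool (pre \<in> {c \<in> set cs. set (tl c) \<subseteq> U i})]) (m(?z + 12 := 0)) []"
    proof (rule wp_Seq, rule L.wp_scanF[where J = ?J])
      fix xs and m m' :: "nat \<Rightarrow> nat" and os assume *: "?J xs m os" "fr L.scratch m m'"
      have "m' (?z + 12) = m (?z + 12)" by (rule frD[OF *(2)]) (auto simp: L.scratch_def)
      then show "?J xs m' os" using * by simp
    next
      show "L.glob (m(?z + 12 := 0))" using g0 by simp
      show "?J [] (m(?z + 12 := 0)) []" by simp
    next
      fix m' :: "nat \<Rightarrow> nat" and os' assume "?J (filter L.sel cs) m' os'"
      then show "wp (Ins (Write (?z + 12))) (\<lambda>m' os'. os' = [of_bool (pre \<in> {c \<in> set cs. set (tl c) \<subseteq> U i})]) m' os'"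
        by (intro wp_Write) (auto simp: N_eq code_within_def)
    qed (rule body)
  qed (use room in \<open>auto simp: N_eq\<close>)
qed

end

section \<open>Decision trees for small instances\<close>

primrec write_list :: "nat list \<Rightarrow> com" where
  "write_list [] = Skip"
| "write_list (y # ys) = Ins (Const 0 y) ;; Ins (Write 0) ;; write_list ys"

text \<open>\<open>f\<close> lives in the logic and not in the program: every vector of outcomes has
  its own leaf, so arbitrary answers can be hard-coded.\<close>

primrec decide :: "com list \<Rightarrow> (bool list \<Rightarrow> nat list) \<Rightarrow> com" where
  "decide [] f = write_list (f [])"
| "decide (c # cs) f = c ;; Cond 0 (decide cs (\<lambda>bs. f (True # bs))) (decide cs (\<lambda>bs. f (False # bs)))"

text \<open>This test gets by with a single cell; a comparison of the value with a constant takes a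
  second one.\<close>

definition nonzero_at :: "nat \<Rightarrow> com" where
  "nonzero_at p = Ins (Const 0 p) ;; Ins (Read 0 0)"

definition value_at :: "nat \<times> nat \<Rightarrow> com" where
  "value_at = (\<lambda>(p, v). Ins (Const 0 p) ;; Ins (Read 0 0) ;; Ins (Const 1 v) ;; Ins (Op Equal 0 0 1))"

lemma exec_write_list:
  assumes "\<forall>y\<in>set ys. y < 2 ^ w" "0 < N"
  shows "\<exists>m'. exec w inp N (write_list ys) m os (2 * length ys) m' (os @ ys)"
  using assms(1)
proof (induction ys arbitrary: m os)
  case Nil
  then show ?case by (auto intro: exec_Skip)
next
  case (Cons y ys)
  obtain m' where m': "exec w inp N (write_list ys) (m(0 := y)) (os @ [y]) (2 * length ys) m' ((os @ [y]) @ ys)"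
    using Cons by (metis list.set_intros(2))
  have 1: "exec w inp N (Ins (Const 0 y)) m os 1 (m(0 := y)) os"
    using exec_Ins[of "Const 0 y" m N w inp os] Cons assms(2) by (simp add: take_bit_nat_eq_self)
  have 2: "exec w inp N (Ins (Write 0)) (m(0 := y)) os 1 (m(0 := y)) (os @ [y])"
    using exec_Ins[of "Write 0" "m(0 := y)" N w inp os] assms(2) by simp
  show ?case
    using exec_Seq[OF 1 exec_Seq[OF 2 m']] by auto
qed

lemma exec_decide:
  assumes tests: "\<And>c m. c \<in> set cs \<Longrightarrow> \<exists>t m'. t \<le> K \<and> exec w inp N c m os t m' os \<and> (m' 0 \<noteq> 0 \<longleftrightarrow> val c)"
    and "0 < N" and "\<forall>y\<in>set (f (map val cs)). y < 2 ^ w"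
  shows "\<exists>t m'. t \<le> (K + 2) * length cs + 2 * length (f (map val cs)) \<and>
     exec w inp N (decide cs f) m os t m' (os @ f (map val cs))"
  using assms(1,3)
proof (induction cs arbitrary: f m)
  case Nil
  then show ?case using exec_write_list[of "f []" w N inp m os] assms(2) by auto
next
  case (Cons c cs)
  obtain t m1 where 1: "t \<le> K" "exec w inp N c m os t m1 os" "m1 0 \<noteq> 0 \<longleftrightarrow> val c"
    using Cons.prems(1)[of c m] by auto
  obtain t' m' where 2: "t' \<le> (K + 2) * length cs + 2 * length (f (val c # map val cs))"
    "exec w inp N (decide cs (\<lambda>bs. f (val c # bs))) m1 os t' m' (os @ f (val c # map val cs))"
    using Cons.IH[of "\<lambda>bs. f (val c # bs)" m1] Cons.prems by auto
  show ?case
  proof (cases "val c")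
    case True
    then have "exec w inp N (decide (c # cs) f) m os (t + (t' + 2)) m' (os @ f (val c # map val cs))"
      unfolding decide.simps using 1 2 assms(2) by (intro exec_Seq[OF 1(2)] exec_CondT) auto
    then show ?thesis using 1 2 by (intro exI[of _ "t + (t' + 2)"] exI[of _ m']) (auto simp: algebra_simps)
  next
    case False
    then have "exec w inp N (decide (c # cs) f) m os (t + (t' + 1)) m' (os @ f (val c # map val cs))"
      unfolding decide.simps using 1 2 assms(2) by (intro exec_Seq[OF 1(2)] exec_CondF) auto
    then show ?thesis using 1 2 by (intro exI[of _ "t + (t' + 1)"] exI[of _ m']) (auto simp: algebra_simps)
  qed
qed

lemma exec_nonzero_at:
  assumes "p < 2 ^ w" "\<forall>v\<in>set inp. v < 2 ^ w" "0 < N"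
  shows "\<exists>m'. exec w inp N (nonzero_at p) m os 2 m' os \<and> m' 0 = nth0 inp p"
proof -
  have 1: "exec w inp N (Ins (Const 0 p)) m os 1 (m(0 := p)) os"
    using exec_Ins[of "Const 0 p" m N w inp os] assms by (simp add: take_bit_nat_eq_self)
  have 2: "exec w inp N (Ins (Read 0 0)) (m(0 := p)) os 1 (m(0 := nth0 inp p)) os"
    using exec_Ins[of "Read 0 0" "m(0 := p)" N w inp os] assms by (auto simp: take_bit_nat_eq_self nth0_def)
  show ?thesis using exec_Seq[OF 1 2] unfolding nonzero_at_def by (auto simp: numeral_2_eq_2)
qed

lemma exec_value_at:
  assumes "p < 2 ^ w" "v < 2 ^ w" "\<forall>v\<in>set inp. v < 2 ^ w" "1 < N" "0 < w"
  shows "\<exists>m'. exec w inp N (value_at (p, v)) m os 4 m' os \<and> (m' 0 \<noteq> 0 \<longleftrightarrow> nth0 inp p = v)"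
proof -
  obtain m1 where 1: "exec w inp N (nonzero_at p) m os 2 m1 os" "m1 0 = nth0 inp p"
    using exec_nonzero_at[of p w inp N m os] assms by auto
  obtain t1 m0 os0 t2 where s: "exec w inp N (Ins (Const 0 p)) m os t1 m0 os0" "exec w inp N (Ins (Read 0 0)) m0 os0 t2 m1 os" "t1 + t2 = 2"
    using 1(1) unfolding nonzero_at_def by (auto elim!: exec_SeqE)
  have 2: "exec w inp N (Ins (Const 1 v)) m1 os 1 (m1(1 := v)) os"
    using exec_Ins[of "Const 1 v" m1 N w inp os] assms by (simp add: take_bit_nat_eq_self)
  have 3: "exec w inp N (Ins (Op Equal 0 0 1)) (m1(1 := v)) os 1 (m1(1 := v, 0 := of_bool (m1 0 = v))) os"
    using exec_Ins[of "Op Equal 0 0 1" "m1(1 := v)" N w inp os] assms by (cases "m1 0 = v") simp_all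
  have "exec w inp N (value_at (p, v)) m os (t1 + (t2 + (1 + 1))) (m1(1 := v, 0 := of_bool (m1 0 = v))) os"
    unfolding value_at_def prod.case by (intro exec_Seq[OF s(1)] exec_Seq[OF s(2)] exec_Seq[OF 2 3])
  moreover have "t1 + (t2 + (1 + 1)) = 4" using s(3) by simp
  ultimately show ?thesis using 1(2)
    by (intro exI[of _ "m1(1 := v, 0 := of_bool (m1 0 = v))"]) simp
qed

text \<open>
  The word length is \<open>B * l + C\<close> with \<open>l = \<lceil>log 2 n\<rceil>\<close>, so the constant \<open>2 ^ (C + B * t)\<close>
  is truncated to zero if and only if \<open>l \<le> t\<close>.  This tests the size of the instance with one cell.
\<close>

primrec ladder :: "nat \<Rightarrow> nat \<Rightarrow> (nat \<Rightarrow> com) \<Rightarrow> com \<Rightarrow> nat list \<Rightarrow> com" where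
  "ladder B C f big [] = big"
| "ladder B C f big (t # ts) = Ins (Const 0 (2 ^ (C + B * t))) ;; Cond 0 (ladder B C f big ts) (f t)"

lemma exec_ladder_test:
  assumes "0 < N"
  shows "exec (B * l + C) inp N (Ins (Const 0 (2 ^ (C + B * t)))) m os 1
     (m(0 := if B * l \<le> B * t then 0 else 2 ^ (C + B * t))) os"
proof -
  have "take_bit (B * l + C) ((2::nat) ^ (C + B * t)) = (if B * l \<le> B * t then 0 else 2 ^ (C + B * t))"
    by (auto simp: take_bit_eq_mod mod_eq_0_iff_dvd intro!: le_imp_power_dvd)
  then show ?thesis
    using exec_Ins[of "Const 0 (2 ^ (C + B * t))" m N "B * l + C" inp os] assms by simp
qed

text \<open>The rungs are tried in ascending order, so the first one that succeeds is
  \<open>t = l\<close> exactly. Each costs at most 3 steps: the constant, the test and the closing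
  jump.\<close>

lemma exec_ladder_small:
  assumes "0 < N" "0 < B" "s \<le> l" "l < u"
    and f: "\<And>m. \<exists>t m'. t \<le> T \<and> exec (B * l + C) inp N (f l) m os t m' os'"
  shows "\<exists>t m'. t \<le> T + 3 * (l + 1 - s) \<and> exec (B * l + C) inp N (ladder B C f big [s..<u]) m os t m' os'"
  using assms(3,4)
proof (induction arbitrary: m rule: inc_induct)
  case base
  obtain t m' where *: "t \<le> T" "exec (B * l + C) inp N (f l) (m(0 := 0)) os t m' os'" using f by blast
  have "exec (B * l + C) inp N (ladder B C f big [l..<u]) m os (1 + (t + 1)) m' os'"
    using exec_Seq[OF exec_ladder_test[OF assms(1), of B l C inp l m os] exec_CondF[OF _ assms(1)]] * base
    by (auto simp: upt_conv_Cons)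
  then show ?case using * by (intro exI[of _ "1 + (t + 1)"] exI[of _ m']) auto
next
  case (step s)
  let ?m = "m(0 := 2 ^ (C + B * s))"
  obtain t m' where *: "t \<le> T + 3 * (l + 1 - Suc s)" "exec (B * l + C) inp N (ladder B C f big [Suc s..<u]) ?m os t m' os'"
    using step by blast
  have "\<not> B * l \<le> B * s" using step assms(2) by simp
  then have "exec (B * l + C) inp N (ladder B C f big [s..<u]) m os (1 + (t + 2)) m' os'"
    using exec_Seq[OF exec_ladder_test[OF assms(1), of B l C inp s m os] exec_CondT[OF _ assms(1)]] * step
    by (auto simp: upt_conv_Cons)
  then show ?case using * step by (intro exI[of _ "1 + (t + 2)"] exI[of _ m']) auto
qed

text \<open>The ladder leaves a power of two in cell 0, so \<open>big\<close> has to be correct from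
  any memory of words and not only from zero.\<close>

lemma exec_ladder_big:
  assumes "0 < N" "0 < B" "u \<le> l"
    and big: "\<And>m. \<forall>a. m a < 2 ^ (B * l + C) \<Longrightarrow> \<exists>t m'. t \<le> T \<and> exec (B * l + C) inp N big m os t m' os'"
  shows "s \<le> u \<Longrightarrow> \<forall>a. m a < 2 ^ (B * l + C) \<Longrightarrow>
    \<exists>t m'. t \<le> T + 3 * (u - s) \<and> exec (B * l + C) inp N (ladder B C f big [s..<u]) m os t m' os'"
proof (induction arbitrary: m rule: inc_induct)
  case base
  then show ?case using big by simp
next
  case (step s)
  let ?m = "m(0 := 2 ^ (C + B * s))"
  have lt: "B * s < B * l" using step assms by simp
  then have "\<forall>a. ?m a < 2 ^ (B * l + C)" using step by simp
  then obtain t m' where *: "t \<le> T + 3 * (u - Suc s)" "exec (B * l + C) inp N (ladder B C f big [Suc s..<u]) ?m os t m' os'"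
    using step.IH by blast
  have "exec (B * l + C) inp N (ladder B C f big [s..<u]) m os (1 + (t + 2)) m' os'"
    using exec_Seq[OF exec_ladder_test[OF assms(1), of B l C inp s m os] exec_CondT[OF _ assms(1)]] * lt step
    by (auto simp: upt_conv_Cons)
  then show ?case using * step by (intro exI[of _ "1 + (t + 2)"] exI[of _ m']) auto
qed

section \<open>Rounded logarithms and the combination of small and large instances\<close>

definition clog :: "nat \<Rightarrow> nat" where
  "clog n = nat \<lceil>log 2 (real n)\<rceil>"

lemma clog_le_iff: "1 \<le> n \<Longrightarrow> n \<le> 2 ^ t \<longleftrightarrow> clog n \<le> t"
proof -
  assume n: "1 \<le> n"
  have "clog n \<le> t \<longleftrightarrow> log 2 (real n) \<le> real t"
    by (simp add: clog_def nat_le_iff ceiling_le_iff)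
  also have "\<dots> \<longleftrightarrow> real n \<le> 2 powr real t"
    using n by (subst log_le_iff) auto
  also have "\<dots> \<longleftrightarrow> real n \<le> real (2 ^ t)" by (simp add: powr_realpow)
  also have "\<dots> \<longleftrightarrow> n \<le> 2 ^ t" by (rule of_nat_le_iff)
  finally show ?thesis by simp
qed

lemma clog_bounds:
  assumes "2 \<le> n"
  shows "2 ^ clog n \<le> n ^ 2" "1 \<le> clog n" "1 \<le> log 2 (real n)" "real (clog n) \<le> 2 * log 2 (real n)"
    "log 2 (real n) \<le> real (clog n)" "n \<le> 2 ^ clog n"
proof -
  show c: "1 \<le> clog n" using clog_le_iff[of n 0] assms by simp
  have "\<not> n \<le> 2 ^ (clog n - 1)" using clog_le_iff[of n "clog n - 1"] c assms by simp
  then have "2 ^ clog n < 2 * n" using c by (cases "clog n") auto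
  also have "2 * n \<le> n ^ 2" using assms by (simp add: power2_eq_square)
  finally show "2 ^ clog n \<le> n ^ 2" by simp
  show l: "1 \<le> log 2 (real n)" using assms by (simp add: le_log_iff)
  have "real (clog n) < log 2 (real n) + 1" using l unfolding clog_def by linarith
  then show "real (clog n) \<le> 2 * log 2 (real n)" using l by simp
  show "log 2 (real n) \<le> real (clog n)" using l unfolding clog_def by linarith
  show "n \<le> 2 ^ clog n" using clog_le_iff[of n "clog n"] assms by simp
qed

lemma word_size_clog: "word_size b e n = b * clog n + e"
  by (simp add: word_size_def clog_def)

lemma nat_power_le_powr:
  assumes "1 \<le> n" "real k \<le> E"
  shows "real (n ^ k) \<le> real n powr E"
proof -
  have "real (n ^ k) = real n powr real k" using assms by (simp add: powr_realpow)
  also have "\<dots> \<le> real n powr E" using assms by (intro powr_mono) auto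
  finally show ?thesis .
qed

text \<open>\<open>D n\<close> collects the required pairs of input and output. Rung 0 of the ladder
  is the case \<open>n = 1\<close>, with one cell; the rungs up to \<open>t0\<close> use two cells,
  and beyond them \<open>big\<close> runs. One rung serves all \<open>n\<close> with the same
  \<open>clog n\<close>, hence \<open>det2\<close> relates inputs of different sizes. The three
  demands on \<open>E\<close> pay for the time of the decision trees, for \<open>big\<close>, and
  for the space of two cells.\<close>

lemma assemble:
  fixes D :: "nat \<Rightarrow> (nat list \<times> nat list) set" and E :: real
  assumes r: "1 \<le> r" "r \<le> B" and N: "2 \<le> N"
    and big: "\<And>n x y m. t0 < clog n \<Longrightarrow> (x, y) \<in> D n \<Longrightarrow>
       \<exists>t m'. exec (word_size B 100 n) x N big m [] t m' y"
    and big_len: "clen big \<le> 2 ^ t0"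
    and det2: "\<And>n n' x x' y y'. 2 \<le> n \<Longrightarrow> 2 \<le> n' \<Longrightarrow> (x, y) \<in> D n \<Longrightarrow> (x', y') \<in> D n' \<Longrightarrow>
       nth0 x = nth0 x' \<Longrightarrow> y = y'"
    and det1: "\<And>x x' y y'. (x, y) \<in> D 1 \<Longrightarrow> (x', y') \<in> D 1 \<Longrightarrow>
       (\<And>p. p < 8 \<Longrightarrow> nth0 x p = 0 \<longleftrightarrow> nth0 x' p = 0) \<Longrightarrow> y = y'"
    and bnd2: "\<And>n x y. 2 \<le> n \<Longrightarrow> (x, y) \<in> D n \<Longrightarrow>
       length x \<le> n ^ r \<and> length y \<le> n ^ r \<and> (\<forall>v\<in>set x \<union> set y. v < n ^ r)"
    and bnd1: "\<And>x y. (x, y) \<in> D 1 \<Longrightarrow> length y \<le> 8 \<and> (\<forall>v\<in>set x \<union> set y. v < 2 ^ 100)"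
    and E: "4 * real r \<le> E" "real N * (2 * real B + 100) + 2 \<le> E" "4 * real B + 200 \<le> E"
  shows "\<exists>prog. \<forall>n x y. 1 \<le> n \<longrightarrow> (x, y) \<in> D n \<longrightarrow>
     runs_within (word_size B 100 n) prog x y (100 * real n powr E) (E * log 2 (real n) + 100)"
proof -
  \<comment> \<open>As \<open>n \<le> 2 ^ t\<close> on rung \<open>t\<close>, these positions and
    values cover all inputs of that rung.\<close>
  define pairs where "pairs t = List.product [0..<(2 ^ t) ^ r] [0..<(2 ^ t) ^ r]" for t :: nat
  \<comment> \<open>The choice is unique by \<open>det1\<close> if some input of \<open>D 1\<close>
    has the outcome \<open>bs\<close>; no other leaf is reached from \<open>D 1\<close>.\<close>
  define f0 where "f0 bs = (SOME y. \<exists>x. (x, y) \<in> D 1 \<and> map (\<lambda>p. nth0 x p \<noteq> 0) [0..<8] = bs)" for bs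
  define ft where "ft t bs = (SOME y. \<exists>n x. 2 \<le> n \<and> clog n = t \<and> (x, y) \<in> D n \<and>
     map (\<lambda>(p, v). nth0 x p = v) (pairs t) = bs)" for t bs
  define f where "f t = (if t = 0 then decide (map nonzero_at [0..<8]) f0 else decide (map value_at (pairs t)) (ft t))" for t :: nat
  define prog where "prog = ladder B 100 f big [0..<Suc t0]"
  have B0: "0 < B" using r by simp
  have "runs_within (word_size B 100 n) (comp 0 prog) x y (100 * real n powr E) (E * log 2 (real n) + 100)"
    if n: "1 \<le> n" and xy: "(x, y) \<in> D n" for n x y
  proof -
    let ?w = "B * clog n + 100"
    consider "n = 1" | "2 \<le> n" "clog n \<le> t0" | "2 \<le> n" "t0 < clog n"
      using n by linarith
    then show ?thesis
    proof cases
      case 1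
      let ?bits = "map (\<lambda>p. nth0 x p \<noteq> 0) [0..<8]"
      have c0: "clog n = 0" using clog_le_iff[of n 0] 1 by simp
      have xy1: "(x, y) \<in> D 1" using xy 1 by simp
      have f0: "f0 ?bits = y"
        unfolding f0_def
      proof (rule some_equality)
        show "\<exists>x'. (x', y) \<in> D 1 \<and> map (\<lambda>p. nth0 x' p \<noteq> 0) [0..<8] = ?bits"
          using xy1 by blast
      next
        fix y' assume "\<exists>x'. (x', y') \<in> D 1 \<and> map (\<lambda>p. nth0 x' p \<noteq> 0) [0..<8] = ?bits"
        then obtain x' where x': "(x', y') \<in> D 1" "map (\<lambda>p. nth0 x' p \<noteq> 0) [0..<8] = ?bits"
          by blast
        have "(nth0 x' p = 0) = (nth0 x p = 0)" if "p < 8" for p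
          using x'(2) that by (simp add: map_eq_conv) (metis atLeastLessThan_iff le0 less_numeral_extra(3) neq0_conv)
        then show "y' = y" by (rule det1[OF x'(1) xy1])
      qed
      have small: "8 < (2::nat) ^ 100" "\<forall>v\<in>set x. v < 2 ^ 100" "\<forall>v\<in>set y. v < 2 ^ 100" "length y \<le> 8"
        using bnd1[OF xy1] by auto
      \<comment> \<open>\<open>exec_decide\<close> reads truth values off the tests themselves;
        \<open>p\<close> can be recovered because \<open>nonzero_at\<close> is injective.\<close>
      define val where "val c \<longleftrightarrow> (\<exists>p<8. c = nonzero_at p \<and> nth0 x p \<noteq> 0)" for c
      have val: "val (nonzero_at p) = (nth0 x p \<noteq> 0)" if "p < 8" for p
        using that by (auto simp: val_def nonzero_at_def)
      then have vals: "map val (map nonzero_at [0..<8]) = ?bits"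
        by simp
      have "\<exists>t m'. t \<le> (2 + 2) * 8 + 2 * length y \<and> exec ?w x 1 (f (clog n)) m [] t m' y" for m
      proof -
        have "\<exists>t m'. t \<le> (2 + 2) * length (map nonzero_at [0..<8]) +
             2 * length (f0 (map val (map nonzero_at [0..<8]))) \<and>
          exec 100 x 1 (decide (map nonzero_at [0..<8]) f0) m [] t m' ([] @ f0 (map val (map nonzero_at [0..<8])))"
        proof (rule exec_decide)
          fix c m assume "c \<in> set (map nonzero_at [0..<8])"
          then obtain p where p: "p < 8" "c = nonzero_at p" by auto
          obtain m' where "exec 100 x 1 (nonzero_at p) m [] 2 m' []" "m' 0 = nth0 x p"
            using exec_nonzero_at[of p 100 x 1 m "[]"] p small by auto
          then show "\<exists>t m'. t \<le> 2 \<and> exec 100 x 1 c m [] t m' [] \<and> (m' 0 \<noteq> 0) = val c"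
            by (intro exI[of _ 2] exI[of _ m']) (simp add: p(2) val[OF p(1)])
        qed (simp, unfold vals f0, rule small(3))
        then show ?thesis
          by (simp only: vals f0 c0 f_def length_map length_upt append_Nil if_True simp_thms mult_0_right add_0 diff_zero)
      qed
      then obtain t m' where t: "t \<le> (2 + 2) * 8 + 2 * length y + 3 * (clog n + 1 - 0)"
        "exec ?w x 1 prog (\<lambda>_. 0) [] t m' y"
        using exec_ladder_small[of 1 B 0 "clog n" "Suc t0" "(2 + 2) * 8 + 2 * length y" 100 x f "[]" y big "\<lambda>_. 0"] B0 c0
        unfolding prog_def by auto
      show ?thesis
        unfolding word_size_clog
        by (rule exec_runs_within[OF t(2)]) (use t(1) small c0 1 in auto)
    next
      case 2
      note cb = clog_bounds[OF 2(1)]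
      define t where "t = clog n"
      let ?bits = "map (\<lambda>(p, v). nth0 x p = v) (pairs t)"
      let ?L = "(2 ^ t) ^ r :: nat"
      have nL: "n ^ r \<le> ?L" using power_mono[OF cb(6), of r] by (simp add: t_def)
      have "(2::nat) ^ (t * r) < 2 ^ ?w"
      proof (rule power_strict_increasing)
        have "t * r \<le> B * clog n" using r by (simp add: t_def mult.commute mult_le_mono1)
        then show "t * r < ?w" by simp
      qed simp
      then have Lw: "?L < 2 ^ ?w" by (simp add: power_mult)
      have bnd: "length x \<le> n ^ r" "length y \<le> n ^ r" "\<forall>v\<in>set x. v < n ^ r" "\<forall>v\<in>set y. v < n ^ r"
        using bnd2[OF 2(1) xy] by auto
      have small: "\<forall>v\<in>set x. v < 2 ^ ?w" "\<forall>v\<in>set y. v < 2 ^ ?w"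
        using bnd nL Lw by (meson less_le_trans order_less_trans)+
      have ft: "ft t ?bits = y"
        unfolding ft_def
      proof (rule some_equality)
        show "\<exists>n x'. 2 \<le> n \<and> clog n = t \<and> (x', y) \<in> D n \<and>
           map (\<lambda>(p, v). nth0 x' p = v) (pairs t) = ?bits"
          using xy 2 t_def by blast
      next
        fix y' assume "\<exists>n x'. 2 \<le> n \<and> clog n = t \<and> (x', y') \<in> D n \<and>
           map (\<lambda>(p, v). nth0 x' p = v) (pairs t) = ?bits"
        then obtain n' x' where x': "2 \<le> n'" "clog n' = t" "(x', y') \<in> D n'"
          "map (\<lambda>(p, v). nth0 x' p = v) (pairs t) = ?bits"
          by blast
        have "n' ^ r \<le> ?L" using power_mono[OF clog_bounds(6)[OF x'(1)], of r] by (simp add: x'(2))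
        then have bnd': "length x' \<le> ?L" using bnd2[OF x'(1,3)] by auto
        have "nth0 x' p = nth0 x p" for p
        proof (cases "p < ?L")
          case True
          have "nth0 x p < ?L"
            using bnd(3) nL by (auto simp: nth0_def intro: less_le_trans)
          then have "(p, nth0 x p) \<in> set (pairs t)" using True by (auto simp: pairs_def)
          then have "(nth0 x' p = nth0 x p) = (nth0 x p = nth0 x p)" using x'(4) by (auto simp: map_eq_conv)
          then show ?thesis by simp
        qed (use bnd bnd' nL in \<open>auto simp: nth0_def\<close>)
        then show "y' = y" using det2[OF x'(1) 2(1) x'(3) xy] by blast
      qed
      define val where "val c \<longleftrightarrow> (\<exists>p v. c = value_at (p, v) \<and> nth0 x p = v)" for c
      have "val (value_at (p, v)) = (nth0 x p = v)" for p v
        by (auto simp: val_def value_at_def)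
      then have vals: "map val (map value_at (pairs t)) = ?bits"
        by auto
      have len: "length (pairs t) = (2 ^ t) ^ (2 * r)"
        by (simp add: pairs_def power_mult mult_2 power_add)
      let ?T = "(4 + 2) * (2 ^ t) ^ (2 * r) + 2 * length y"
      have "\<exists>u m'. u \<le> ?T \<and> exec ?w x 2 (f (clog n)) m [] u m' y" for m
      proof -
        have "\<exists>u m'. u \<le> (4 + 2) * length (map value_at (pairs t)) +
             2 * length (ft t (map val (map value_at (pairs t)))) \<and>
          exec ?w x 2 (decide (map value_at (pairs t)) (ft t)) m [] u m' ([] @ ft t (map val (map value_at (pairs t))))"
        proof (rule exec_decide)
          fix c m assume "c \<in> set (map value_at (pairs t))"
          then obtain p v where p: "p < ?L" "v < ?L" "c = value_at (p, v)" by (auto simp: pairs_def)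
          obtain m' where m': "exec ?w x 2 (value_at (p, v)) m [] 4 m' []" "(m' 0 \<noteq> 0) = (nth0 x p = v)"
            using exec_value_at[of p ?w v x 2 m "[]"] p small Lw by auto
          have "val c = (nth0 x p = v)" by (auto simp: val_def value_at_def p(3))
          then show "\<exists>t m'. t \<le> 4 \<and> exec ?w x 2 c m [] t m' [] \<and> (m' 0 \<noteq> 0) = val c"
            using m' p(3) by blast
        qed (simp, unfold vals ft, rule small(2))
        then show ?thesis using ft cb(2) unfolding vals f_def by (simp add: len[unfolded t_def] t_def)
      qed
      then obtain u m' where u: "u \<le> ?T + 3 * (clog n + 1 - 0)"
        "exec ?w x 2 prog (\<lambda>_. 0) [] u m' y"
        using exec_ladder_small[of 2 B 0 "clog n" "Suc t0" ?T 100 x f "[]" y big "\<lambda>_. 0"] B0 2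
        unfolding prog_def by auto
      \<comment> \<open>Here \<open>2 ^ clog n \<le> n ^ 2\<close> doubles the exponent
        \<open>2 * r\<close>.\<close>
      have p1: "(2 ^ t) ^ (2 * r) \<le> n ^ (4 * r)"
        using power_mono[OF cb(1), of "2 * r"] by (simp add: t_def power_mult[symmetric] del: power_mult)
      have p2: "length y \<le> n ^ (4 * r)"
        using bnd(2) power_increasing[of r "4 * r" n] n by linarith
      have "clog n + 1 \<le> 2 ^ clog n" by (simp add: Suc_le_eq)
      moreover have "n ^ 2 \<le> n ^ (4 * r)" using r n by (intro power_increasing) auto
      ultimately have p3: "clog n + 1 \<le> n ^ (4 * r)" using cb(1) by linarith
      \<comment> \<open>6 for the tests, 2 for the output and 3 for the ladder.\<close>
      have "u \<le> 11 * Y" if "u \<le> (4 + 2) * X + 2 * l + 3 * (k + 1 - 0)" "X \<le> Y" "l \<le> Y" "k + 1 \<le> Y" for X Y l k :: nat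
        using that by simp
      from this[OF u(1) p1 p2 p3] have "u \<le> 11 * n ^ (4 * r)" .
      then have "real u \<le> real (11 * n ^ (4 * r))" by (rule of_nat_mono)
      also have "\<dots> = 11 * real (n ^ (4 * r))" by simp
      also have "\<dots> \<le> 11 * real n powr E"
        using nat_power_le_powr[OF n, of "4 * r" E] E(1) by (intro mult_left_mono) auto
      also have "\<dots> \<le> 100 * real n powr E" by (intro mult_right_mono) auto
      finally have T: "real u \<le> 100 * real n powr E" .
      have "real (?w * 2) = 2 * real B * real (clog n) + 200" by simp
      also have "\<dots> \<le> 2 * real B * (2 * log 2 (real n)) + 200 * log 2 (real n)"
        using cb(3,4) by (intro add_mono mult_left_mono) auto
      also have "\<dots> = (4 * real B + 200) * log 2 (real n)" by (simp add: algebra_simps)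
      also have "\<dots> \<le> E * log 2 (real n)" using E(3) cb(3) by (intro mult_right_mono) auto
      finally have "real (?w * 2) \<le> E * log 2 (real n) + 100" by simp
      then show ?thesis
        unfolding word_size_clog by (rule exec_runs_within[OF u(2) T])
    next
      case 3
      note cb = clog_bounds[OF 3(1)]
      let ?T = "clen big * 2 ^ (?w * N)"
      have "\<exists>t m'. t \<le> ?T \<and> exec ?w x N big m [] t m' y" if "\<forall>a. m a < 2 ^ ?w" for m
        using big[OF 3(2) xy, of m] exec_time that unfolding word_size_clog by blast
      then have "\<exists>t m'. t \<le> ?T + 3 * (Suc t0 - 0) \<and> exec ?w x N (ladder B 100 f big [0..<Suc t0]) (\<lambda>_. 0) [] t m' y"
        by (intro exec_ladder_big) (use N B0 3 in auto)
      then obtain t m' where t: "t \<le> ?T + 3 * (t0 + 1)" "exec ?w x N prog (\<lambda>_. 0) [] t m' y"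
        unfolding prog_def by auto
      \<comment> \<open>Large instances absorb the lengths of \<open>big\<close> and of the ladder
        into one factor \<open>n\<close>, which is the 1 in the exponent \<open>1 + F\<close>
        below.\<close>
      have t0n: "2 ^ t0 < n" using clog_le_iff[of n t0] 3 by auto
      have "t0 + 1 \<le> 2 ^ t0" by (simp add: Suc_le_eq)
      then have tn: "t0 + 1 \<le> n" "clen big \<le> n" using t0n big_len by auto
      \<comment> \<open>For \<open>n \<ge> 2\<close> a word has at most
        \<open>(2 * B + 100) * log 2 n\<close> bits, so \<open>N\<close> cells have at most
        \<open>n powr F\<close> contents.\<close>
      define F where "F = real N * (2 * real B + 100)"
      have "real (?w * N) = real N * (real B * real (clog n) + 100)" by simp
      also have "\<dots> \<le> real N * (real B * (2 * log 2 (real n)) + 100 * log 2 (real n))"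
        using cb(3,4) by (intro mult_left_mono add_mono) auto
      also have "\<dots> = F * log 2 (real n)" by (simp add: F_def algebra_simps)
      finally have wN: "real (?w * N) \<le> F * log 2 (real n)" .
      have "F * log 2 (real n) \<le> E * log 2 (real n) + 100"
        using E(2) cb(3) by (intro order_trans[OF mult_right_mono[of F E]]) (auto simp: F_def)
      then have sp: "real (?w * N) \<le> E * log 2 (real n) + 100" using wN by linarith
      have "real (2 ^ (?w * N)) = 2 powr real (?w * N)"
        by (simp only: powr_realpow[of 2] of_nat_power of_nat_numeral zero_less_numeral)
      also have "\<dots> \<le> 2 powr (F * log 2 (real n))" using wN by (intro powr_mono) auto
      also have "\<dots> = real n powr F" using n by (simp add: powr_def log_def)
      finally have pw: "real (2 ^ (?w * N)) \<le> real n powr F" .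
      have "real t \<le> real (clen big) * real (2 ^ (?w * N)) + 3 * real (t0 + 1)"
        using of_nat_mono[OF t(1), where 'a = real] by simp
      also have "\<dots> \<le> real n * real n powr F + 3 * (real n * 1)"
        using tn pw by (intro add_mono mult_mono) auto
      also have "\<dots> \<le> real n * real n powr F + 3 * (real n * real n powr F)"
        using n by (intro add_mono mult_left_mono ge_one_powr_ge_zero) (auto simp: F_def)
      also have "\<dots> = 4 * real n powr (1 + F)" using n by (simp add: powr_add)
      also have "\<dots> \<le> 100 * real n powr E"
        using n E(2) by (intro mult_mono powr_mono) (auto simp: F_def)
      finally show ?thesis
        unfolding word_size_clog by (rule exec_runs_within[OF t(2) _ sp])
    qed
  qed
  then show ?thesis by blast
qed

section \<open>Encodings\<close>

lemma sorted_list_of_set_Collect: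
  fixes A :: "'a :: linorder set"
  assumes "finite A"
  shows "sorted_list_of_set {x \<in> A. Q x} = filter Q (sorted_list_of_set A)"
  using assms by (intro sorted_distinct_set_unique) (auto intro: sorted_wrt_filter)

lemma code_set_decode: "finite X \<Longrightarrow> set (tl (code_set X)) = X"
  by (simp add: code_set_def)

lemma inj_on_code_set: "(\<And>X. X \<in> A \<Longrightarrow> finite X) \<Longrightarrow> inj_on code_set A"
  by (rule inj_on_inverseI[of _ "\<lambda>c. set (tl c)"]) (simp add: code_set_decode)

definition codes_of :: "nat set set \<Rightarrow> nat list list" where
  "codes_of F = sorted_list_of_set (code_set ` F)"

lemma finite_family: "F \<subseteq> Pow {..<n} \<Longrightarrow> finite F \<and> (\<forall>X\<in>F. finite X)" for n :: nat
  by (auto intro: finite_subset[of _ "Pow {..<n}"] finite_subset[of _ "{..<n}"])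

lemma codes_of:
  assumes "F \<subseteq> Pow {..<n}"
  shows "length (codes_of F) = card F" "set (codes_of F) = code_set ` F" "distinct (codes_of F)"
proof -
  have "finite F" "inj_on code_set F"
    using finite_family[of F n] assms inj_on_code_set[of F] by auto
  then show "length (codes_of F) = card F" "set (codes_of F) = code_set ` F" "distinct (codes_of F)"
    by (auto simp: codes_of_def card_image)
qed

lemma codes_of_shape:
  assumes "F \<subseteq> Pow {..<n}" "c \<in> set (codes_of F)"
  shows "\<exists>xs. c = length xs # xs \<and> set xs \<subseteq> {..<n}"
proof -
  obtain X where X: "X \<in> F" "c = code_set X" using assms codes_of[of F n] by auto
  then have "finite X" "X \<subseteq> {..<n}" using assms finite_subset by blast+
  then show ?thesis using X by (intro exI[of _ "sorted_list_of_set X"]) (simp add: code_set_def)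
qed

lemma sorted_list_of_subset:
  assumes "V \<subseteq> {..<n}"
  shows "sorted_list_of_set V = filter (\<lambda>x. x \<in> V) [0..<n]"
proof -
  have "V = {x \<in> set [0..<n]. x \<in> V}" using assms by auto
  then have "sorted_list_of_set V = filter (\<lambda>x. x \<in> V) (sorted_list_of_set (set [0..<n]))"
    by (metis List.finite_set sorted_list_of_set_Collect)
  also have "sorted_list_of_set (set [0..<n]) = [0..<n]"
    by (rule sorted_list_of_set.idem_if_sorted_distinct) auto
  finally show ?thesis .
qed

lemma encode_eq:
  assumes "F \<subseteq> Pow {..<n}"
  shows "encode n {..<n} F = n # n # [0..<n] @ length (codes_of F) # concat (codes_of F)"
proof -
  have "sorted_list_of_set {..<n} = [0..<n]"
    unfolding sorted_list_of_subset[OF order_refl] by (simp add: filter_id_conv)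
  then show ?thesis
    using codes_of[of F n] assms by (simp add: encode_def code_set_def codes_of_def)
qed

section \<open>Ground sets, families and virtual inputs\<close>

lemma ground_subset: "ground U S j \<subseteq> U"
  by (induction j) auto

text \<open>A subset of \<open>U\<close> that avoids each deleted set is the same as a subset of
  what is left of \<open>U\<close>.\<close>

lemma family_eq:
  assumes "F \<subseteq> Pow U"
  shows "family F S j = {X \<in> F. X \<subseteq> ground U S j}"
  by (induction j) (use assms in auto)

lemma codes_of_family:
  assumes "F \<subseteq> Pow {..<n}"
  shows "codes_of (family F S j) = filter (code_within (ground {..<n} S j)) (codes_of F)"
proof -
  have fin: "finite F" "\<And>X. X \<in> F \<Longrightarrow> finite X" using finite_family[of F n] assms by auto
  have "code_set ` family F S j = {c \<in> code_set ` F. code_within (ground {..<n} S j) c}"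
    using fin by (auto simp: family_eq[of F "{..<n}"] assms code_within_def code_set_decode)
  then show ?thesis
    using fin by (simp add: codes_of_def sorted_list_of_set_Collect)
qed

lemma virtual_input_eq:
  assumes "F \<subseteq> Pow {..<n}"
  shows "virtual_input n (codes_of F) (ground {..<n} S j) x =
    code_elem x @ encode n (ground {..<n} S j) (family F S j)"
proof -
  let ?V = "ground {..<n} S j"
  have V: "sorted_list_of_set ?V = filter (\<lambda>x. x \<in> ?V) [0..<n]"
    by (rule sorted_list_of_subset[OF ground_subset])
  then have cV: "card ?V = length (filter (\<lambda>x. x \<in> ?V) [0..<n])"
    by (metis length_sorted_list_of_set)
  have sub: "family F S j \<subseteq> Pow {..<n}"
    using assms by (auto simp: family_eq[of F "{..<n}"])
  have cF: "card (family F S j) = length (filter (code_within ?V) (codes_of F))"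
    using codes_of(1)[OF sub] codes_of_family[OF assms] by simp
  have F: "sorted_list_of_set (code_set ` family F S j) = filter (code_within ?V) (codes_of F)"
    using codes_of_family[OF assms] by (simp add: codes_of_def)
  show ?thesis
    by (simp only: virtual_input_def code_elem_def encode_def code_set_def V cV cF F append_Cons append_Nil)
qed

section \<open>Unique decodability of inputs\<close>

lemma nth0_append_eq:
  assumes "length xs = length ys" "nth0 (xs @ us) = nth0 (ys @ vs)"
  shows "xs = ys \<and> nth0 us = nth0 vs"
proof
  show "xs = ys"
  proof (rule nth_equalityI)
    fix p assume "p < length xs"
    then show "xs ! p = ys ! p" using assms(1) fun_cong[OF assms(2), of p] by (simp add: nth0_def nth_append)
  qed (rule assms)
  show "nth0 us = nth0 vs"
  proof
    fix p
    show "nth0 us p = nth0 vs p"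
      using assms(1) fun_cong[OF assms(2), of "length xs + p"] by (auto simp: nth0_def nth_append split: if_splits)
  qed
qed

lemma nth0_Cons_eq: "nth0 (x # us) = nth0 (y # vs) \<Longrightarrow> x = y \<and> nth0 us = nth0 vs"
  using nth0_append_eq[of "[x]" "[y]" us vs] by simp

lemma nth0_code_eq:
  assumes "nth0 ((length xs # xs) @ us) = nth0 ((length ys # ys) @ vs)"
  shows "xs = ys \<and> nth0 us = nth0 vs"
  using nth0_Cons_eq[of "length xs" "xs @ us" "length ys" "ys @ vs"] nth0_append_eq[of xs ys us vs] assms by simp

text \<open>\<open>nth0\<close> hides trailing zeros, so the lists are compared from the left: with
  a common number of codes, each announcing its own length, no ambiguity remains.\<close>

lemma nth0_concat_eq:
  assumes "length cs = length cs'"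
    "\<And>c. c \<in> set cs \<union> set cs' \<Longrightarrow> \<exists>xs. c = length xs # xs" "nth0 (concat cs) = nth0 (concat cs')"
  shows "cs = cs'"
  using assms
proof (induction cs cs' rule: list_induct2)
  case (Cons c cs c' cs')
  obtain xs ys where c: "c = length xs # xs" "c' = length ys # ys"
    using Cons.prems(1)[of c] Cons.prems(1)[of c'] by auto
  then have "xs = ys \<and> nth0 (concat cs) = nth0 (concat cs')"
    using Cons.prems(2) by (intro nth0_code_eq) simp
  then show ?case using Cons c by auto
qed simp

text \<open>The decision trees test only values of \<open>nth0\<close>, so their leaves are well
  defined only if these determine the instance. They do, since \<open>n\<close>, the number of sets
  and each cardinality precede what they count.\<close>

lemma nth0_encode_eq:
  assumes F: "F \<subseteq> Pow {..<n}" and F': "F' \<subseteq> Pow {..<n'}"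
    and eq: "nth0 (encode n {..<n} F) = nth0 (encode n' {..<n'} F')"
  shows "n = n' \<and> F = F'"
proof -
  have 1: "n = n' \<and> nth0 ((n # [0..<n]) @ length (codes_of F) # concat (codes_of F)) =
     nth0 ((n' # [0..<n']) @ length (codes_of F') # concat (codes_of F'))"
    using nth0_Cons_eq eq unfolding encode_eq[OF F] encode_eq[OF F'] by (metis append_Cons)
  then have "nth0 (length (codes_of F) # concat (codes_of F)) = nth0 (length (codes_of F') # concat (codes_of F'))"
    using nth0_append_eq[of "n # [0..<n]" "n' # [0..<n']"] by (metis length_Cons length_upt)
  then have 2: "length (codes_of F) = length (codes_of F')" "nth0 (concat (codes_of F)) = nth0 (concat (codes_of F'))"
    using nth0_Cons_eq by blast+
  have "codes_of F = codes_of F'"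
    by (rule nth0_concat_eq[OF 2(1) _ 2(2)]) (use codes_of_shape[OF F] codes_of_shape[OF F'] in blast)
  then have "code_set ` F = code_set ` F'" using codes_of(2)[OF F] codes_of(2)[OF F'] by metis
  moreover have "inj_on code_set (F \<union> F')"
    using finite_family[of F n] finite_family[of F' n'] F F' by (intro inj_on_code_set) auto
  ultimately have "F = F'" by (simp add: inj_on_Un_image_eq_iff)
  then show ?thesis using 1 by simp
qed

text \<open>A one-element ground set has four families. In the last encoding the code
  \<open>[0]\<close> of the empty set precedes the code \<open>[1, 0]\<close>.\<close>

lemma encode_1:
  assumes "F \<subseteq> Pow {..<1}"
  shows "encode 1 {..<1} F \<in> {[1, 1, 0, 0], [1, 1, 0, 1, 0], [1, 1, 0, 1, 1, 0], [1, 1, 0, 2, 0, 1, 0]}"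
proof -
  have "F \<subseteq> {{}, {0}}"
  proof
    fix X assume "X \<in> F"
    then have "X \<subseteq> {0}" using assms by (auto simp: lessThan_Suc)
    then show "X \<in> {{}, {0}}" by (auto simp: subset_singleton_iff)
  qed
  then have "F = {} \<or> F = {{}} \<or> F = {{0}} \<or> F = {{}, {0}}" by blast
  moreover have c: "code_set {} = [0]" "code_set {0} = [1, 0]" by (simp_all add: code_set_def)
  moreover have E: "encode 1 {..<1} F = 1 # 1 # 0 # card F # concat (sorted_list_of_set (code_set ` F))"
  proof -
    have "{..<1} = {0 :: nat}" by auto
    then show ?thesis by (simp add: encode_def c)
  qed
  moreover have "sorted_list_of_set {[0], [1, 0 :: nat]} = [[0], [1, 0]]"
    by (rule sorted_distinct_set_unique) auto
  ultimately show ?thesis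
    by (elim disjE) (simp_all only: E, simp_all)
qed

text \<open>Enumeration counts as a query with empty code, so that one statement covers all six
  programs. Each program serves one kind, within which its queries have to be told apart.\<close>

definition query_kind :: "(nat \<Rightarrow> nat list set) \<Rightarrow> bool" where
  "query_kind K \<longleftrightarrow> K = (\<lambda>n. {[]}) \<or> K = (\<lambda>n. {[q] | q. q < n}) \<or> K = (\<lambda>n. code_set ` Pow {..<n})"

text \<open>Codes of one kind either have a common length or announce it in their first entry, so
  the query can be split off although only \<open>nth0\<close> is known.\<close>

lemma query_kind_eq:
  assumes K: "query_kind K" "p \<in> K n" "p' \<in> K n'" and eq: "nth0 (p @ us) = nth0 (p' @ us')"
  shows "p = p' \<and> nth0 us = nth0 us'"
proof -
  consider "length p = length p'" | Q Q' where "Q \<subseteq> {..<n}" "Q' \<subseteq> {..<n'}" "p = code_set Q" "p' = code_set Q'"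
    using K unfolding query_kind_def by fastforce
  then show ?thesis
  proof cases
    case 1
    then show ?thesis by (rule nth0_append_eq[OF _ eq])
  next
    case 2
    then have "finite Q" "finite Q'" using finite_subset by blast+
    then have "p = length (sorted_list_of_set Q) # sorted_list_of_set Q"
      "p' = length (sorted_list_of_set Q') # sorted_list_of_set Q'"
      using 2 by (simp_all add: code_set_def)
    then show ?thesis using nth0_code_eq eq by metis
  qed
qed

lemma query_kind_bound:
  assumes "query_kind K" "p \<in> K n" "1 \<le> n"
  shows "length p \<le> n + 1 \<and> (\<forall>v\<in>set p. v \<le> n)"
proof -
  have "card Q \<le> n" if "Q \<subseteq> {..<n}" for Q
    using card_mono[OF _ that] by simp
  moreover have "finite Q" if "Q \<subseteq> {..<n}" for Q :: "nat set"
    using that finite_subset by blast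
  ultimately show ?thesis
    using assms unfolding query_kind_def code_set_def by fastforce
qed

lemma query_kind_1:
  assumes "query_kind K" "p \<in> K 1"
  shows "p \<in> {[], [0], [1, 0]}"
proof -
  consider "p = []" | "p = [0]" | Q where "Q \<subseteq> {..<1}" "p = code_set Q"
    using assms unfolding query_kind_def by auto
  then show ?thesis
  proof cases
    case 3
    have "Q \<subseteq> {0}" using 3(1) by auto
    then have "Q = {} \<or> Q = {0}" by (rule subset_singletonD)
    moreover have "code_set {} = [0]" "code_set {0} = [1, 0]" by (simp_all add: code_set_def)
    ultimately show ?thesis unfolding 3(2) by (elim disjE) simp_all
  qed auto
qed

text \<open>A finite check: of the few inputs with \<open>n = 1\<close>, no two of one kind have the
  same zeros. Eight positions suffice, since the longest input has nine entries and ends in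
  0.\<close>

lemma zero_pattern_1:
  assumes K: "query_kind K" "p \<in> K 1" "p' \<in> K 1"
    and F: "F \<subseteq> Pow {..<1}" and F': "F' \<subseteq> Pow {..<1}"
    and eq: "\<And>t. t < 8 \<Longrightarrow> nth0 (p @ encode 1 {..<1} F) t = 0 \<longleftrightarrow> nth0 (p' @ encode 1 {..<1} F') t = 0"
  shows "p @ encode 1 {..<1} F = p' @ encode 1 {..<1} F'"
proof -
  define x y where "x = encode 1 {..<1} F" and "y = encode 1 {..<1} F'"
  have len: "p = [] \<and> p' = [] \<or> p \<in> {[0], [1, 0]} \<and> p' \<in> {[0], [1, 0]}"
    using K unfolding query_kind_def
  proof (elim disjE)
    assume "K = (\<lambda>n. code_set ` Pow {..<n})"
    then have "p \<noteq> []" "p' \<noteq> []" using K(2,3) by (auto simp: code_set_def)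
    then show ?thesis using query_kind_1[OF K(1,2)] query_kind_1[OF K(1,3)] by blast
  qed auto
  have E: "\<forall>t\<in>{0, 1, 2, 3, 4, 5, 6, 7}. nth0 (p @ x) t = 0 \<longleftrightarrow> nth0 (p' @ y) t = 0"
    using eq by (simp add: x_def y_def)
  have "p @ x = p' @ y"
    using encode_1[OF F] encode_1[OF F'] len E unfolding x_def[symmetric] y_def[symmetric]
    by (elim insertE emptyE disjE conjE) (simp_all add: nth0_def)
  then show ?thesis by (simp add: x_def y_def)
qed

section \<open>Size of the input\<close>

lemma card_bounded_subsets:
  assumes "\<forall>X\<in>F. X \<subseteq> {..<n} \<and> card X \<le> d" "2 \<le> n"
  shows "card F \<le> n ^ (d + 1)"
proof -
  have "F \<subseteq> set ` {xs. set xs \<subseteq> {..<n} \<and> length xs \<le> d}"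
  proof
    fix X assume X: "X \<in> F"
    then have "finite X" using assms finite_subset by blast
    then show "X \<in> set ` {xs. set xs \<subseteq> {..<n} \<and> length xs \<le> d}"
      using X assms by (intro image_eqI[of _ _ "sorted_list_of_set X"]) auto
  qed
  then have "card F \<le> card {xs. set xs \<subseteq> {..<n} \<and> length xs \<le> d}"
    by (intro surj_card_le finite_lists_length_le) auto
  also have "\<dots> = (\<Sum>i\<le>d. n ^ i)" by (subst card_lists_length_le) auto
  also have "\<dots> \<le> n ^ (d + 1)"
  proof (induction d)
    case (Suc d)
    have "(\<Sum>i\<le>Suc d. n ^ i) \<le> n ^ (d + 1) + n ^ (d + 1)" using Suc by simp
    also have "\<dots> = 2 * n ^ (d + 1)" by simp
    also have "\<dots> \<le> n * n ^ (d + 1)" using assms(2) by (intro mult_right_mono) auto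
    finally show ?case by simp
  qed (use assms in simp)
  finally show ?thesis .
qed

text \<open>Origin of the exponent \<open>2 * d + 5\<close>: at most \<open>n ^ (d + 1)\<close> sets
  have codes of length at most \<open>d + 1 \<le> n ^ d\<close>, and all other entries number at
  most \<open>2 * n + 4 \<le> n ^ 4\<close>. Both parts are at most \<open>n ^ (2 * d + 4)\<close>,
  and their sum costs one more factor \<open>n \<ge> 2\<close>.\<close>

lemma input_bound:
  assumes F: "\<forall>X\<in>F. X \<subseteq> {..<n} \<and> card X \<le> d" and n: "2 \<le> n"
    and p: "length p \<le> n + 1" "\<forall>v\<in>set p. v \<le> n"
  shows "length (p @ encode n {..<n} F) \<le> n ^ (2 * d + 5)"
    and "\<forall>v\<in>set (p @ encode n {..<n} F). v < n ^ (2 * d + 5)"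
proof -
  have F': "F \<subseteq> Pow {..<n}" using F by blast
  have cF: "length (codes_of F) \<le> n ^ (d + 1)"
    using codes_of(1)[OF F'] card_bounded_subsets[OF F n] by simp
  have "length c \<le> d + 1" if c: "c \<in> set (codes_of F)" for c
  proof -
    obtain X where "X \<in> F" "c = code_set X" using c codes_of(2)[OF F'] by auto
    then show ?thesis using F by (auto simp: code_set_def)
  qed
  then have "length (concat (codes_of F)) \<le> (\<Sum>c\<leftarrow>codes_of F. d + 1)"
    unfolding length_concat by (rule sum_list_mono)
  also have "\<dots> \<le> n ^ (d + 1) * (d + 1)" unfolding sum_list_triv of_nat_id by (rule mult_le_mono1[OF cF])
  also have "\<dots> \<le> n ^ (d + 1) * n ^ d"
  proof (rule mult_left_mono)
    have "d + 1 \<le> 2 ^ d" by (simp add: Suc_le_eq)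
    also have "\<dots> \<le> n ^ d" using n by (intro power_mono) auto
    finally show "d + 1 \<le> n ^ d" .
  qed simp
  also have "\<dots> = n ^ (2 * d + 1)" by (simp add: power_add[symmetric] mult_2)
  also have "\<dots> \<le> n ^ (2 * d + 4)" using n by (intro power_increasing) auto
  finally have cc: "length (concat (codes_of F)) \<le> n ^ (2 * d + 4)" .
  have "2 * n + 4 \<le> n ^ 4"
  proof -
    have "2 * n + 4 \<le> 4 * n" using n by simp
    also have "\<dots> \<le> (n * n) * n" using mult_mono[OF n n] n by (intro mult_right_mono) auto
    also have "\<dots> \<le> n ^ 4" using n by (simp add: power4_eq_xxxx)
    finally show ?thesis .
  qed
  also have "n ^ 4 \<le> n ^ (2 * d + 4)" using n by (intro power_increasing) auto
  finally have n4: "2 * n + 4 \<le> n ^ (2 * d + 4)" .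
  have "2 * n ^ (2 * d + 4) \<le> n * n ^ (2 * d + 4)" using n by (intro mult_right_mono) auto
  then have top: "n ^ (2 * d + 4) + n ^ (2 * d + 4) \<le> n ^ (2 * d + 5)"
    by (simp add: numeral_eq_Suc)
  show "length (p @ encode n {..<n} F) \<le> n ^ (2 * d + 5)"
    using cc n4 top p by (simp add: encode_eq[OF F'])
  have "v \<le> n \<or> v \<le> n ^ (d + 1)" if v: "v \<in> set (p @ encode n {..<n} F)" for v
  proof -
    have "v \<le> n" if vc: "v \<in> set c" and c: "c \<in> set (codes_of F)" for c
    proof -
      obtain X where X: "X \<in> F" "c = code_set X" using c codes_of(2)[OF F'] by auto
      have "finite X" "card X \<le> n" "\<forall>v\<in>X. v \<le> n"
        using F' X(1) finite_subset[of X "{..<n}"] card_mono[of "{..<n}" X] by fastforce+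
      then show ?thesis using vc X less_imp_le by (auto simp: code_set_def)
    qed
    then show ?thesis using v p cF by (auto simp: encode_eq[OF F'])
  qed
  moreover have "n < n ^ (2 * d + 5)" using n power_strict_increasing[of 1 "2 * d + 5" n] by simp
  moreover have "n ^ (d + 1) < n ^ (2 * d + 5)" using n by (intro power_strict_increasing) auto
  ultimately show "\<forall>v\<in>set (p @ encode n {..<n} F). v < n ^ (2 * d + 5)"
    using le_less_trans by blast
qed

section \<open>Uniqueness of the sets \<open>S j\<close>\<close>

lemma runs_in_space_unique:
  assumes "runs_in_space w P inp [x] s" "runs_in_space w P inp [y] s'"
  shows "x = y"
proof -
  obtain t where t: "halted P (run w inp P t)" "out (run w inp P t) = [x]"
    using assms(1) by (auto simp: runs_in_space_def)
  obtain u where u: "halted P (run w inp P u)" "out (run w inp P u) = [y]"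
    using assms(2) by (auto simp: runs_in_space_def)
  have "run w inp P (max t u) = run w inp P t" "run w inp P (max t u) = run w inp P u"
    using run_halted t(1) u(1) by (metis max.cobounded1, metis max.cobounded2)
  then show ?thesis using t u by simp
qed

text \<open>These are the hypotheses of the theorem on a single instance, with \<open>s\<close> for
  \<open>a * c\<close>.\<close>

definition valid :: "nat \<Rightarrow> nat \<Rightarrow> nat \<Rightarrow> nat \<Rightarrow> (nat \<Rightarrow> program) \<Rightarrow> real \<Rightarrow> nat \<Rightarrow> nat set set \<Rightarrow> (nat \<Rightarrow> nat set) \<Rightarrow> bool" where
  "valid d k b e P s n F S \<longleftrightarrow> (\<forall>X\<in>F. X \<subseteq> {..<n} \<and> card X \<le> d) \<and>
     (\<forall>j\<in>{1..k}. S j \<subseteq> ground {..<n} S (j - 1)) \<and>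
     (\<forall>j\<in>{1..k}. \<forall>x\<in>ground {..<n} S (j - 1). runs_in_space (word_size b e n) (P j)
        (code_elem x @ encode n (ground {..<n} S (j - 1)) (family F S (j - 1)))
        [of_bool (x \<in> S j)] (s * log 2 n + e))"

text \<open>If the two sequences agree up to \<open>j\<close>, the next program sees the same
  instance in both, and a deterministic run has one output. Outside the current ground set there is
  no freedom either, since \<open>S (Suc j)\<close> lies inside it.\<close>

lemma valid_unique:
  assumes "valid d k b e P s n F S" "valid d k b e P s n F S'"
  shows "j \<le> k \<Longrightarrow> ground {..<n} S j = ground {..<n} S' j \<and> (1 \<le> j \<longrightarrow> S j = S' j)"
proof (induction j)
  case (Suc j)
  then have g: "ground {..<n} S j = ground {..<n} S' j" and j: "Suc j \<in> {1..k}" by auto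
  have F: "F \<subseteq> Pow {..<n}" using assms(1) by (auto simp: valid_def)
  have f: "family F S j = family F S' j" using F by (simp add: family_eq[of F "{..<n}"] g)
  have sub: "S (Suc j) \<subseteq> ground {..<n} S j" "S' (Suc j) \<subseteq> ground {..<n} S j"
    using assms j unfolding valid_def by (metis diff_Suc_1 g)+
  have "x \<in> S (Suc j) \<longleftrightarrow> x \<in> S' (Suc j)" if "x \<in> ground {..<n} S j" for x
  proof -
    have "runs_in_space (word_size b e n) (P (Suc j)) (code_elem x @ encode n (ground {..<n} S j) (family F S j))
        [of_bool (x \<in> S (Suc j))] (s * log 2 n + e)"
      "runs_in_space (word_size b e n) (P (Suc j)) (code_elem x @ encode n (ground {..<n} S j) (family F S j))
        [of_bool (x \<in> S' (Suc j))] (s * log 2 n + e)"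
      using assms j that g f unfolding valid_def by (metis diff_Suc_1)+
    from runs_in_space_unique[OF this] show ?thesis by (auto split: if_splits simp: of_bool_def)
  qed
  then have "S (Suc j) = S' (Suc j)" using sub by blast
  then show ?case using g by simp
qed simp

text \<open>As \<open>b \<ge> 1\<close>, a word has at least \<open>log 2 n + e\<close> bits, so the
  additive \<open>e\<close> of the space bound is worth at most one cell. The number of cells is
  thus bounded independently of \<open>n\<close> and \<open>e\<close>. The absolute value admits a
  negative \<open>a\<close>.\<close>

lemma cells_bound:
  fixes a c :: real
  assumes n: "2 \<le> n" and b: "1 \<le> b" and h: "real (word_size b e n * h) \<le> a * c * log 2 n + e" and c: "0 < c"
  shows "h \<le> nat \<lfloor>\<bar>a\<bar> * c\<rfloor> + 1"
proof (rule ccontr)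
  assume "\<not> h \<le> nat \<lfloor>\<bar>a\<bar> * c\<rfloor> + 1"
  then have "real h \<ge> real (nat \<lfloor>\<bar>a\<bar> * c\<rfloor> + 2)" by (intro of_nat_mono) linarith
  moreover have "real (nat \<lfloor>\<bar>a\<bar> * c\<rfloor>) > \<bar>a\<bar> * c - 1" using c by linarith
  ultimately have H: "real h \<ge> \<bar>a\<bar> * c + 1" by simp
  define l where "l = log 2 (real n)"
  have l: "1 \<le> l" "l \<le> real (clog n)" using clog_bounds[OF n] by (auto simp: l_def)
  have "1 * real (clog n) \<le> real b * real (clog n)" by (intro mult_right_mono) (use b in auto)
  then have "l \<le> real b * real (clog n)" using l by linarith
  then have w: "l + real e \<le> real (word_size b e n)" by (simp add: word_size_clog)
  have "(l + real e) * (\<bar>a\<bar> * c + 1) \<le> real (word_size b e n) * real h"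
    using w H l c by (intro mult_mono) auto
  then have "(l + real e) * (\<bar>a\<bar> * c + 1) \<le> a * c * l + e" using h by (simp add: l_def)
  moreover have "(l + real e) * (\<bar>a\<bar> * c + 1) = l * (\<bar>a\<bar> * c) + real e * (\<bar>a\<bar> * c) + l + real e"
    by (simp add: algebra_simps)
  moreover have "a * c * l \<le> l * (\<bar>a\<bar> * c)"
    using c l mult_right_mono[of a "\<bar>a\<bar>" "c * l"] by (simp add: mult_ac)
  moreover have "0 \<le> real e * (\<bar>a\<bar> * c)" using c by simp
  ultimately show False using l by linarith
qed

text \<open>Origin of \<open>B\<close>: \<open>2 * d + 5\<close> makes every input position a word,
  \<open>b\<close> covers the logarithmic part of the simulated word, and a further
  \<open>clog n\<close> exceeds \<open>e\<close>. Above the threshold the cell addresses and the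
  program lengths, which are constants of the code, fit into words as well.\<close>

lemma inst_intro:
  fixes a c :: real
  assumes valid: "valid d k b e P (a * c) n F S" and c: "0 < c" and i: "i \<le> k" and b: "1 \<le> b"
    and H: "H = nat \<lfloor>\<bar>a\<bar> * c\<rfloor> + 1" and B: "B = b + 1 + (2 * d + 5)"
    and t0: "e + blk H (i + 2) + (\<Sum>j<i. length (P (Suc j))) \<le> t0" "t0 < clog n" and n: "2 \<le> n"
    and p: "length p \<le> n + 1" "\<forall>v\<in>set p. v \<le> n"
  shows "inst (word_size B 100 n) (p @ encode n {..<n} F) (blk H (i + 2)) n p (codes_of F) (word_size b e n)
     b e (clog n) P H i (ground {..<n} S) S"
proof
  have F: "\<forall>X\<in>F. X \<subseteq> {..<n} \<and> card X \<le> d" using valid by (auto simp: valid_def)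
  then have F': "F \<subseteq> Pow {..<n}" by blast
  let ?w = "word_size B 100 n"
  note ib = input_bound[OF F n p]
  have lw: "t0 < ?w" "clog n < ?w" "word_size b e n < ?w"
    using t0 b by (auto simp: word_size_clog B algebra_simps)
  have t0w: "x < 2 ^ ?w" if "x \<le> t0" for x
    using that lw(1) by (meson le_less_trans less_exp less_trans)
  show "p @ encode n {..<n} F = p @ n # n # [0..<n] @ length (codes_of F) # concat (codes_of F)"
    by (simp add: encode_eq[OF F'])
  show "\<exists>xs. c = length xs # xs \<and> set xs \<subseteq> {..<n}" if "c \<in> set (codes_of F)" for c
    using codes_of_shape[OF F' that] by blast
  have "n ^ (2 * d + 5) \<le> (2 ^ clog n) ^ (2 * d + 5)"
    using clog_bounds(6)[OF n] by (intro power_mono) auto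
  also have "\<dots> = 2 ^ (clog n * (2 * d + 5))" by (simp add: power_mult)
  also have "\<dots> \<le> 2 ^ (B * clog n)"
    by (intro power_increasing) (auto simp: B algebra_simps)
  finally have n_pow: "n ^ (2 * d + 5) \<le> 2 ^ (B * clog n)" .
  have "length (p @ encode n {..<n} F) + 10 < 2 ^ (B * clog n) * 2 ^ 100"
  proof -
    have *: "l + 10 < x * 2 ^ 100" if "1 \<le> x" "l \<le> y" "y \<le> x" for l x y :: nat using that by simp
    show ?thesis by (rule *[OF _ ib(1) n_pow]) simp
  qed
  then show room: "length (p @ encode n {..<n} F) + 10 < 2 ^ ?w"
    by (simp add: word_size_clog power_add)
  show "v < 2 ^ ?w" if "v \<in> set p" for v
  proof -
    have "v \<le> n" using p(2) that by blast
    moreover have "n < 2 ^ ?w" using room by (simp add: encode_eq[OF F'])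
    ultimately show ?thesis by simp
  qed
  show "blk H (i + 2) < 2 ^ ?w" using t0 by (intro t0w) simp
  show "length (P (Suc j)) < 2 ^ ?w" if "j < i" for j
  proof (rule t0w)
    have "length (P (Suc j)) \<le> (\<Sum>j<i. length (P (Suc j)))"
      by (rule member_le_sum) (use that in auto)
    then show "length (P (Suc j)) \<le> t0" using t0 by simp
  qed
  show "(n \<le> 2 ^ t) = (clog n \<le> t)" for t using clog_le_iff n by simp
  show "S (Suc j) \<subseteq> ground {..<n} S j" if "j < i" for j
    using valid i that unfolding valid_def by (metis atLeastAtMost_iff diff_Suc_1 Suc_le_eq le_add1 less_le_trans plus_1_eq_Suc)
  let ?run = "\<lambda>j x. run (word_size b e n) (virtual_input n (codes_of F) (ground {..<n} S j) x) (P (Suc j))"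
  show "\<exists>t. halted (P (Suc j)) (?run j x t) \<and> out (?run j x t) = [of_bool (x \<in> S (Suc j))] \<and> hi (?run j x t) \<le> H"
    if j: "j < i" and x: "x \<in> ground {..<n} S j" for j x
  proof -
    have "Suc j \<in> {1..k}" using i j by simp
    then have "runs_in_space (word_size b e n) (P (Suc j)) (code_elem x @ encode n (ground {..<n} S j) (family F S j))
        [of_bool (x \<in> S (Suc j))] (a * c * log 2 n + e)"
      using valid x unfolding valid_def by (metis diff_Suc_1)
    then show ?thesis
      unfolding runs_in_space_def virtual_input_eq[OF F'] H using cells_bound[OF n b _ c] by blast
  qed
  show "word_size b e n < ?w" by (rule lw(3))
qed (use b in \<open>auto simp: word_size_clog\<close>)

text \<open>The common core of the six programs: \<open>ans\<close> is the required output on the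
  query \<open>p\<close>, and \<open>big\<close> computes it on large instances. By
  \<open>det\<close> the output is a function of the input alone, and by \<open>bnd\<close> it is no
  larger than the instance; the hard-coded leaves rest on both.\<close>

lemma task_program:
  fixes a c c0 :: real
  assumes c0: "0 < c0" "c0 \<le> c" and b: "1 \<le> b" and i: "1 \<le> i" "i \<le> k"
    and H: "H = nat \<lfloor>\<bar>a\<bar> * c\<rfloor> + 1" and B: "B = b + 1 + (2 * d + 5)"
    and A: "A = (70 / c0 + 3 * \<bar>a\<bar>) * (2 * real B + 100) + (4 * real (2 * d + 5) + 4 * real B + 202) / c0"
    and K: "query_kind K"
    and det: "\<And>n F S S' p. valid d k b e P (a * c) n F S \<Longrightarrow> valid d k b e P (a * c) n F S' \<Longrightarrow> ans n F S p = ans n F S' p"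
    and bnd: "\<And>n F S p. valid d k b e P (a * c) n F S \<Longrightarrow> p \<in> K n \<Longrightarrow>
       length (ans n F S p) \<le> length (encode n {..<n} F) \<and> set (ans n F S p) \<subseteq> set (encode n {..<n} F) \<union> {0, 1}"
    and big: "\<And>n F S p w N m. valid d k b e P (a * c) n F S \<Longrightarrow> p \<in> K n \<Longrightarrow>
       inst w (p @ encode n {..<n} F) N n p (codes_of F) (word_size b e n) b e (clog n) P H i (ground {..<n} S) S \<Longrightarrow>
       ram.wp w (p @ encode n {..<n} F) N big (\<lambda>m' os'. os' = ans n F S p) m []"
  shows "\<exists>prog. \<forall>n F S p. 1 \<le> n \<longrightarrow> valid d k b e P (a * c) n F S \<longrightarrow> p \<in> K n \<longrightarrow>
     runs_within (word_size B 100 n) prog (p @ encode n {..<n} F) (ans n F S p)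
       (100 * n powr (A * i * c)) (A * i * c * log 2 n + 100)"
proof -
  define E where "E = A * real i * c"
  define N where "N = blk H (i + 2)"
  \<comment> \<open>The last summand gives \<open>clen big \<le> 2 ^ t0\<close>, which is less than
    \<open>n\<close> on large instances.\<close>
  define t0 where "t0 = e + N + (\<Sum>j<i. length (P (Suc j))) + clen big"
  define D where "D n = {(p @ encode n {..<n} F, ans n F S p) | p F S. valid d k b e P (a * c) n F S \<and> p \<in> K n}" for n
  have validF: "\<forall>X\<in>F. X \<subseteq> {..<n} \<and> card X \<le> d" "F \<subseteq> Pow {..<n}" if "valid d k b e P (a * c) n F S" for n F S
    using that by (auto simp: valid_def)
  have c: "0 < c" using c0 by simp
  have E_eq: "E = (70 / c0 + 3 * \<bar>a\<bar>) * (2 * real B + 100) * (i * c) + (4 * real (2 * d + 5) + 4 * real B + 202) * (i * c / c0)"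
    by (simp add: E_def A algebra_simps add_divide_distrib)
  \<comment> \<open>Through \<open>i \<ge> 1\<close> and \<open>c \<ge> c0\<close> an additive
    constant is at most its multiple by \<open>i * c / c0\<close>; hence the divisor
    \<open>c0\<close> in \<open>A\<close>.\<close>
  have ic: "1 \<le> i * c / c0"
  proof -
    have "1 * c0 \<le> real i * c" using i c0 by (intro mult_mono) auto
    then show ?thesis using c0 by (simp add: le_divide_eq)
  qed
  \<comment> \<open>This is the sum of the additive demands on \<open>E\<close>: four times the
    exponent \<open>2 * d + 5\<close>, the two cells of the decision trees, and 2 for the time of
    \<open>big\<close>.\<close>
  have const: "4 * real (2 * d + 5) + 4 * real B + 202 \<le> (4 * real (2 * d + 5) + 4 * real B + 202) * (i * c / c0)"
    using mult_left_mono[OF ic, of "4 * real (2 * d + 5) + 4 * real B + 202"] by simp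
  \<comment> \<open>Origin of 70 and 3:
    \<open>N \<le> 4 + (i + 2) * (22 + \<bar>a\<bar> * c)\<close> with
    \<open>i + 2 \<le> 3 * i\<close>, and \<open>4 + 3 * 22 = 70\<close>.\<close>
  have "real N \<le> (70 / c0 + 3 * \<bar>a\<bar>) * (i * c)"
  proof -
    have "real H \<le> \<bar>a\<bar> * c + 1" using c by (simp add: H)
    then have "real N \<le> 4 + (real i + 2) * (22 + \<bar>a\<bar> * c)"
      using mult_left_mono[of "21 + real H" "22 + \<bar>a\<bar> * c" "real i + 2"]
      by (simp add: N_def blk_def algebra_simps)
    also have "\<dots> \<le> 4 * real i + (3 * real i) * (22 + \<bar>a\<bar> * c)"
      using i c by (intro add_mono mult_right_mono) auto
    also have "\<dots> = 70 * i + 3 * \<bar>a\<bar> * (i * c)" by (simp add: algebra_simps)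
    also have "\<dots> \<le> 70 * (i * (c / c0)) + 3 * \<bar>a\<bar> * (i * c)"
    proof -
      have "1 \<le> c / c0" using c0 by simp
      then have "real i * 1 \<le> i * (c / c0)" by (intro mult_left_mono) auto
      then show ?thesis by simp
    qed
    also have "\<dots> = (70 / c0 + 3 * \<bar>a\<bar>) * (i * c)" by (simp add: algebra_simps)
    finally show ?thesis .
  qed
  then have "real N * (2 * real B + 100) \<le> (70 / c0 + 3 * \<bar>a\<bar>) * (i * c) * (2 * real B + 100)"
    by (intro mult_right_mono) auto
  also have "\<dots> = (70 / c0 + 3 * \<bar>a\<bar>) * (2 * real B + 100) * (i * c)" by (simp only: mult_ac)
  finally have NE: "real N * (2 * real B + 100) \<le> (70 / c0 + 3 * \<bar>a\<bar>) * (2 * real B + 100) * (i * c)" .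
  have pos: "0 \<le> (70 / c0 + 3 * \<bar>a\<bar>) * (2 * real B + 100) * (i * c)" using c0 c by simp
  have E: "4 * real (2 * d + 5) \<le> E" "real N * (2 * real B + 100) + 2 \<le> E" "4 * real B + 200 \<le> E"
    using E_eq const NE pos by linarith+
  have "\<exists>prog. \<forall>n x y. 1 \<le> n \<longrightarrow> (x, y) \<in> D n \<longrightarrow>
     runs_within (word_size B 100 n) prog x y (100 * real n powr E) (E * log 2 (real n) + 100)"
  proof (rule assemble[where r = "2 * d + 5" and N = N and ?t0.0 = t0 and big = big])
    fix n x y and m :: "nat \<Rightarrow> nat"
    assume t: "t0 < clog n" and "(x, y) \<in> D n"
    then obtain p F S where D: "x = p @ encode n {..<n} F" "y = ans n F S p" "valid d k b e P (a * c) n F S" "p \<in> K n"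
      by (auto simp: D_def)
    have n: "2 \<le> n"
    proof (rule ccontr)
      assume "\<not> 2 \<le> n"
      then have "n = 0 \<or> n = 1" by linarith
      then have "clog n = 0" by (auto simp: clog_def log_def)
      then show False using t by simp
    qed
    have "inst (word_size B 100 n) x N n p (codes_of F) (word_size b e n) b e (clog n) P H i (ground {..<n} S) S"
      unfolding D(1) N_def
      by (rule inst_intro[OF D(3) c i(2) b H B _ t n])
        (use query_kind_bound[OF K D(4)] n in \<open>auto simp: t0_def N_def\<close>)
    then show "\<exists>t m'. exec (word_size B 100 n) x N big m [] t m' y"
      using big[OF D(3,4), of "word_size B 100 n" N m] unfolding D(1,2) by (auto simp: ram.wp_def)
  next
    show "clen big \<le> 2 ^ t0"
      using less_exp[of t0] by (simp add: t0_def del: less_exp)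
  next
    fix n n' x x' y y'
    assume "(x, y) \<in> D n" "(x', y') \<in> D n'" and eq: "nth0 x = nth0 x'"
    then obtain p F S p' F' S' where D: "x = p @ encode n {..<n} F" "y = ans n F S p" "valid d k b e P (a * c) n F S" "p \<in> K n"
      "x' = p' @ encode n' {..<n'} F'" "y' = ans n' F' S' p'" "valid d k b e P (a * c) n' F' S'" "p' \<in> K n'"
      by (auto simp: D_def)
    have 1: "p = p'" "nth0 (encode n {..<n} F) = nth0 (encode n' {..<n'} F')"
      using query_kind_eq[OF K D(4,8) eq[unfolded D(1,5)]] by blast+
    have "n = n' \<and> F = F'"
      by (rule nth0_encode_eq[OF _ _ 1(2)]) (rule validF(2)[OF D(3)], rule validF(2)[OF D(7)])
    then show "y = y'" using det[OF D(3)] D(7) unfolding D(2,6) 1(1) by metis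
  next
    fix x x' y y'
    assume "(x, y) \<in> D 1" "(x', y') \<in> D 1" and eq: "\<And>t. t < 8 \<Longrightarrow> (nth0 x t = 0) = (nth0 x' t = 0)"
    then obtain p F S p' F' S' where D: "x = p @ encode 1 {..<1} F" "y = ans 1 F S p" "valid d k b e P (a * c) 1 F S" "p \<in> K 1"
      "x' = p' @ encode 1 {..<1} F'" "y' = ans 1 F' S' p'" "valid d k b e P (a * c) 1 F' S'" "p' \<in> K 1"
      unfolding D_def by auto
    have "x = x'"
      unfolding D(1,5)
      by (rule zero_pattern_1[OF K D(4,8)])
        (rule validF(2)[OF D(3)], rule validF(2)[OF D(7)], rule eq[unfolded D(1,5)])
    then have "nth0 (p @ encode 1 {..<1} F) = nth0 (p' @ encode 1 {..<1} F')"
      by (simp only: D(1,5))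
    then have 1: "p = p'" "nth0 (encode 1 {..<1} F) = nth0 (encode 1 {..<1} F')"
      using query_kind_eq[OF K D(4,8)] by blast+
    have "(1::nat) = 1 \<and> F = F'"
      by (rule nth0_encode_eq[OF _ _ 1(2)]) (rule validF(2)[OF D(3)], rule validF(2)[OF D(7)])
    then show "y = y'" using det[OF D(3)] D(7) unfolding D(2,6) 1(1) by metis
  next
    fix n x y
    assume n: "2 \<le> n" and "(x, y) \<in> D n"
    then obtain p F S where D: "x = p @ encode n {..<n} F" "y = ans n F S p" "valid d k b e P (a * c) n F S" "p \<in> K n"
      by (auto simp: D_def)
    have p: "length p \<le> n + 1" "\<forall>v\<in>set p. v \<le> n" using query_kind_bound[OF K D(4)] n by auto
    note ib = input_bound[OF validF(1)[OF D(3)] n p]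
    have "1 < n ^ (2 * d + 5)" using n by (intro one_less_power) auto
    then have "\<forall>v\<in>set (encode n {..<n} F) \<union> {0, 1}. v < n ^ (2 * d + 5)" using ib(2) n by auto
    then have "\<forall>v\<in>set y. v < n ^ (2 * d + 5)" using bnd[OF D(3,4)] unfolding D(2) by blast
    moreover have "length y \<le> length x" using bnd[OF D(3,4)] unfolding D(1,2) by simp
    ultimately show "length x \<le> n ^ (2 * d + 5) \<and> length y \<le> n ^ (2 * d + 5) \<and> (\<forall>v\<in>set x \<union> set y. v < n ^ (2 * d + 5))"
      using ib unfolding D(1) by (meson Un_iff le_trans)
  next
    fix x y
    assume "(x, y) \<in> D 1"
    then obtain p F S where D: "x = p @ encode 1 {..<1} F" "y = ans 1 F S p" "valid d k b e P (a * c) 1 F S" "p \<in> K 1"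
      unfolding D_def by auto
    have F: "F \<subseteq> Pow {..<1}" by (rule validF(2)[OF D(3)])
    define en where "en = encode 1 {..<1} F"
    have "length en \<le> 8 \<and> (\<forall>v\<in>set en. v \<le> 2)" using encode_1[OF F] unfolding en_def[symmetric] by auto
    moreover have "\<forall>v\<in>set p. v \<le> 2" using query_kind_1[OF K D(4)] by auto
    ultimately have "length y \<le> 8 \<and> (\<forall>v\<in>set x \<union> set y. v \<le> 2)"
      using bnd[OF D(3,4)] unfolding D(1,2) en_def[symmetric] by fastforce
    then show "length y \<le> 8 \<and> (\<forall>v\<in>set x \<union> set y. v < 2 ^ 100)"
    proof -
      have "v < 2 ^ 100" if "v \<le> 2" for v :: nat using that by simp
      then show ?thesis using \<open>length y \<le> 8 \<and> (\<forall>v\<in>set x \<union> set y. v \<le> 2)\<close> by blast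
    qed
  qed (use E in \<open>auto simp: B N_def blk_def\<close>)
  then obtain prog where prog: "\<And>n x y. 1 \<le> n \<Longrightarrow> (x, y) \<in> D n \<Longrightarrow>
     runs_within (word_size B 100 n) prog x y (100 * real n powr E) (E * log 2 (real n) + 100)" by blast
  show ?thesis
    by (intro exI[of _ prog] allI impI, unfold E_def[symmetric], rule prog) (auto simp: D_def)
qed

theorem theorem2:
  fixes d b :: nat and a c0 :: real
  assumes "1 \<le> b" and "0 < c0"
  shows "\<exists>(A::real) (B::nat). \<forall>(k::nat) (c::real) (e::nat) (P :: nat \<Rightarrow> program).
    1 \<le> k \<longrightarrow> c0 \<le> c \<longrightarrow>
    (\<forall>i\<in>{1..k}. \<exists>(C::nat) ES MS EU MU EF MF.
      \<forall>(n::nat) (U::nat set) (F::nat set set) (S :: nat \<Rightarrow> nat set).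
        1 \<le> n \<longrightarrow> U = {..<n} \<longrightarrow> (\<forall>X\<in>F. X \<subseteq> U \<and> card X \<le> d) \<longrightarrow>
        (\<forall>j\<in>{1..k}. S j \<subseteq> ground U S (j - 1)) \<longrightarrow>
        (\<forall>j\<in>{1..k}. \<forall>x\<in>ground U S (j - 1).
           runs_in_space (word_size b e n) (P j)
             (code_elem x @ encode n (ground U S (j - 1)) (family F S (j - 1)))
             [of_bool (x \<in> S j)] (a * c * log 2 n + e)) \<longrightarrow>
        (let w = word_size B C n;
             inp = encode n U F;
             T = C * n powr (A * i * c);
             sp = A * i * c * log 2 n + C
         in enumerates_and_answers w ES MS inp code_elem U (S i) T sp \<and>
            enumerates_and_answers w EU MU inp code_elem U (ground U S i) T sp \<and>
            enumerates_and_answers w EF MF inp code_set (Pow U) (family F S i) T sp))"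
proof -
  define B where "B = b + 1 + (2 * d + 5)"
  define A where "A = (70 / c0 + 3 * \<bar>a\<bar>) * (2 * real B + 100) + (4 * real (2 * d + 5) + 4 * real B + 202) / c0"
  show ?thesis
  proof (rule exI[of _ A], rule exI[of _ B], intro allI impI ballI)
    fix k e i :: nat and c :: real and P :: "nat \<Rightarrow> program"
    assume c: "c0 \<le> c" and "i \<in> {1..k}"
    then have i: "1 \<le> i" "i \<le> k" by auto
    define H where "H = nat \<lfloor>\<bar>a\<bar> * c\<rfloor> + 1"
    note task = task_program[where P = P and e = e, OF assms(2) c assms(1) i H_def B_def A_def]
    let ?V = "valid d k b e P (a * c)"
    let ?none = "\<lambda>n :: nat. {[] :: nat list}"
    let ?elem = "\<lambda>n :: nat. {[q] | q. q < n}"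
    let ?set = "\<lambda>n. code_set ` Pow {..<n}"
    let ?solves = "\<lambda>K ans prog. \<forall>n F S p. 1 \<le> n \<longrightarrow> ?V n F S \<longrightarrow> p \<in> K n \<longrightarrow>
      runs_within (word_size B 100 n) prog (p @ encode n {..<n} F) (ans n F S p)
       (100 * n powr (A * i * c)) (A * i * c * log 2 n + 100)"
    have kinds: "query_kind ?none" "query_kind ?elem" "query_kind ?set"
      by (simp_all add: query_kind_def)
    have F: "F \<subseteq> Pow {..<n}" if "?V n F S" for n F S
      using that by (auto simp: valid_def)
    have S_eq: "S i = S' i" "ground {..<n} S i = ground {..<n} S' i" if "?V n F S" "?V n F S'" for n F S S'
      using valid_unique[OF that i(2)] i by auto
    let ?inst = "\<lambda>w N n F S p. inst w (p @ encode n {..<n} F) N n p (codes_of F) (word_size b e n)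
      b e (clog n) P H i (ground {..<n} S) S"
    let ?answers = "\<lambda>c ans w N n F S p m. ram.wp w (p @ encode n {..<n} F) N c (\<lambda>m' os'. os' = ans n F S p) m []"
    let ?bounded = "\<lambda>ans n F S p. length (ans n F S p) \<le> length (encode n {..<n} F) \<and>
      set (ans n F S p) \<subseteq> set (encode n {..<n} F) \<union> {0, 1}"
    have pro: "ram.wp w (p @ encode n {..<n} F) N (prologue b e (off_const l) ;; body) Q m []"
      if "?inst w N n F S p" "length p = l"
        "\<And>m. level.glob n p (word_size b e n) m \<Longrightarrow> ram.wp w (p @ encode n {..<n} F) N body Q m []"
      for w p n F N S Q m l body
      using inst.wp_prologue_const[OF that(1), of body Q "[]" m] that(2,3) by blast
    have elem: "p = [hd p]" "hd p < n" "length p = 1" if "p \<in> ?elem n" for p n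
      using that by auto

    \<comment> \<open>The outputs are lists in the order in which the scans produce them; in the
      element queries, \<open>hd p\<close> is the queried element.\<close>
    define ansS where "ansS n F S p = filter (\<lambda>x. x \<in> S i) [0..<n]"
      for n :: nat and F :: "nat set set" and S :: "nat \<Rightarrow> nat set" and p :: "nat list"
    define ansU where "ansU n F S p = filter (\<lambda>x. x \<in> ground {..<n} S i) [0..<n]"
      for n :: nat and F :: "nat set set" and S and p :: "nat list"
    define ansF where "ansF n F S p = concat (filter (\<lambda>c. set (tl c) \<subseteq> ground {..<n} S i) (codes_of F))"
      for n :: nat and F S and p :: "nat list"
    define inS where "inS n F S p = [of_bool (hd p \<in> S i) :: nat]"
      for n :: nat and F :: "nat set set" and S :: "nat \<Rightarrow> nat set" and p :: "nat list"
    define inU where "inU n F S p = [of_bool (hd p \<in> ground {..<n} S i) :: nat]"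
      for n :: nat and F :: "nat set set" and S and p :: "nat list"
    define inF where "inF n F S p = [of_bool (p \<in> {c \<in> set (codes_of F). set (tl c) \<subseteq> ground {..<n} S i}) :: nat]"
      for n :: nat and F S and p :: "nat list"
    note defs = ansS_def ansU_def ansF_def inS_def inU_def inF_def

    have det: "ansS n F S p = ansS n F S' p" "ansU n F S p = ansU n F S' p" "ansF n F S p = ansF n F S' p"
      "inS n F S p = inS n F S' p" "inU n F S p = inU n F S' p" "inF n F S p = inF n F S' p"
      if "?V n F S" "?V n F S'" for n F S S' p
      using S_eq[OF that] by (simp_all add: defs)
    have bnd: "?bounded ansS n F S p" "?bounded ansU n F S p" "?bounded ansF n F S p"
      "?bounded inS n F S p" "?bounded inU n F S p" "?bounded inF n F S p"
      if "?V n F S" "p \<in> K n" for n F S p and K :: "nat \<Rightarrow> nat list set"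
    proof -
      have "length (filter Q [0..<n]) \<le> Suc (Suc (Suc (n + l)))" for Q l
        using length_filter_le[of Q "[0..<n]"] by simp
      then show "?bounded ansS n F S p" "?bounded ansU n F S p"
        by (auto simp: encode_eq[OF F[OF that(1)]] defs)
      have "length (concat (filter Q xs)) \<le> length (concat xs)" "set (concat (filter Q xs)) \<subseteq> set (concat xs)"
        for Q and xs :: "nat list list"
        by (induction xs) auto
      from this[of "\<lambda>c. set (tl c) \<subseteq> ground {..<n} S i" "codes_of F"] show "?bounded ansF n F S p"
        by (auto simp: encode_eq[OF F[OF that(1)]] defs)
    qed (auto simp: encode_eq[OF F[OF that(1)]] defs)

    have enum: "?answers (prologue b e (off_const 0) ;; enum_S P H i) ansS w N n F S p m"
      "?answers (prologue b e (off_const 0) ;; enum_U P H i) ansU w N n F S p m"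
      "?answers (prologue b e (off_const 0) ;; enum_F P H i) ansF w N n F S p m"
      if "?V n F S" "p \<in> ?none n" and I: "?inst w N n F S p" for w N n F S p m
    proof -
      have l: "length p = 0" using that(2) by simp
      show "?answers (prologue b e (off_const 0) ;; enum_S P H i) ansS w N n F S p m"
        unfolding defs by (rule pro[OF I l inst.wp_enum_S[OF I _ i(1)]])
      show "?answers (prologue b e (off_const 0) ;; enum_U P H i) ansU w N n F S p m"
        unfolding defs by (rule pro[OF I l inst.wp_enum_U[OF I]])
      show "?answers (prologue b e (off_const 0) ;; enum_F P H i) ansF w N n F S p m"
        unfolding defs by (rule pro[OF I l inst.wp_enum_F[OF I]])
    qed
    have query: "?answers (prologue b e (off_const 1) ;; query_S P H i) inS w N n F S p m"
      "?answers (prologue b e (off_const 1) ;; query_U P H i) inU w N n F S p m"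
      if "?V n F S" "p \<in> ?elem n" and I: "?inst w N n F S p" for w N n F S p m
    proof -
      note q = elem[OF that(2)]
      show "?answers (prologue b e (off_const 1) ;; query_S P H i) inS w N n F S p m"
        unfolding defs by (rule pro[OF I q(3) inst.wp_query_S[OF I _ q(1,2) i(1)]])
      show "?answers (prologue b e (off_const 1) ;; query_U P H i) inU w N n F S p m"
        unfolding defs by (rule pro[OF I q(3) inst.wp_query_U[OF I _ q(1,2)]])
    qed
    have query_set: "?answers (prologue b e off_set ;; query_F P H i) inF w N n F S p m"
      if "?V n F S" "p \<in> ?set n" and I: "?inst w N n F S p" for w N n F S p m
    proof -
      obtain Q where "p = code_set Q" using \<open>p \<in> ?set n\<close> by auto
      then have p: "p = length (sorted_list_of_set Q) # sorted_list_of_set Q"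
        by (simp add: code_set_def)
      show ?thesis
        unfolding defs by (rule inst.wp_prologue_set[OF I p inst.wp_query_F[OF I _ p]])
    qed

    have "\<exists>prog. ?solves ?none ansS prog"
      by (rule task[OF kinds(1)], erule (1) det, erule (1) bnd, erule (2) enum)
    then obtain ES where ES: "?solves ?none ansS ES" ..
    have "\<exists>prog. ?solves ?none ansU prog"
      by (rule task[OF kinds(1)], erule (1) det, erule (1) bnd, erule (2) enum)
    then obtain EU where EU: "?solves ?none ansU EU" ..
    have "\<exists>prog. ?solves ?none ansF prog"
      by (rule task[OF kinds(1)], erule (1) det, erule (1) bnd, erule (2) enum)
    then obtain EF where EF: "?solves ?none ansF EF" ..
    have "\<exists>prog. ?solves ?elem inS prog"
      by (rule task[OF kinds(2)], erule (1) det, erule (1) bnd, erule (2) query)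
    then obtain MS where MS: "?solves ?elem inS MS" ..
    have "\<exists>prog. ?solves ?elem inU prog"
      by (rule task[OF kinds(2)], erule (1) det, erule (1) bnd, erule (2) query)
    then obtain MU where MU: "?solves ?elem inU MU" ..
    have "\<exists>prog. ?solves ?set inF prog"
      by (rule task[OF kinds(3)], erule (1) det, erule (1) bnd, erule (2) query_set)
    then obtain MF where MF: "?solves ?set inF MF" ..

    show "\<exists>C ES MS EU MU EF MF. \<forall>n U F S. 1 \<le> n \<longrightarrow> U = {..<n} \<longrightarrow> (\<forall>X\<in>F. X \<subseteq> U \<and> card X \<le> d) \<longrightarrow>
        (\<forall>j\<in>{1..k}. S j \<subseteq> ground U S (j - 1)) \<longrightarrow>
        (\<forall>j\<in>{1..k}. \<forall>x\<in>ground U S (j - 1).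
           runs_in_space (word_size b e n) (P j)
             (code_elem x @ encode n (ground U S (j - 1)) (family F S (j - 1)))
             [of_bool (x \<in> S j)] (a * c * log 2 n + e)) \<longrightarrow>
        (let w = word_size B C n; inp = encode n U F; T = C * n powr (A * i * c); sp = A * i * c * log 2 n + C
         in enumerates_and_answers w ES MS inp code_elem U (S i) T sp \<and>
            enumerates_and_answers w EU MU inp code_elem U (ground U S i) T sp \<and>
            enumerates_and_answers w EF MF inp code_set (Pow U) (family F S i) T sp)"
    proof (rule exI[of _ 100], rule exI[of _ ES], rule exI[of _ MS], rule exI[of _ EU], rule exI[of _ MU],
        rule exI[of _ EF], rule exI[of _ MF], intro allI impI)
      fix n :: nat and U F and S :: "nat \<Rightarrow> nat set"
      assume n: "1 \<le> n" and U: "U = {..<n}"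
        and h: "\<forall>X\<in>F. X \<subseteq> U \<and> card X \<le> d" "\<forall>j\<in>{1..k}. S j \<subseteq> ground U S (j - 1)"
          "\<forall>j\<in>{1..k}. \<forall>x\<in>ground U S (j - 1). runs_in_space (word_size b e n) (P j)
             (code_elem x @ encode n (ground U S (j - 1)) (family F S (j - 1)))
             [of_bool (x \<in> S j)] (a * c * log 2 n + e)"
      have V: "?V n F S" using h unfolding valid_def U by blast
      have Fn: "F \<subseteq> Pow {..<n}" using h U by blast
      have Si: "S i \<subseteq> {..<n}" using V i ground_subset[of "{..<n}" S "i - 1"] unfolding valid_def by fastforce
      have id: "concat (map code_elem xs) = xs" for xs by (induction xs) (auto simp: code_elem_def)
      have fam: "family F S i = {X \<in> F. X \<subseteq> ground {..<n} S i}" by (rule family_eq[OF Fn])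
      have fin: "finite X" if "X \<in> F" for X using finite_family[OF Fn] that by blast
      \<comment> \<open>The enumeration order is that of the selected codes. Decoding is injective
        on codes, so no set is listed twice.\<close>
      define xs where "xs = map (\<lambda>c. set (tl c)) (filter (\<lambda>c. set (tl c) \<subseteq> ground {..<n} S i) (codes_of F))"
      have dec: "c = code_set (set (tl c)) \<and> set (tl c) \<in> F" if "c \<in> set (codes_of F)" for c
        using that codes_of(2)[OF Fn] fin code_set_decode by auto
      have xs: "distinct xs" "set xs = family F S i" "concat (map code_set xs) = ansF n F S []"
      proof -
        have "inj_on (\<lambda>c. set (tl c)) (set (codes_of F))"
          by (rule inj_on_inverseI[of _ code_set]) (use dec in metis)
        then show "distinct xs"
          using codes_of(3)[OF Fn] by (auto simp: xs_def distinct_map intro: inj_on_subset)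
        show "set xs = family F S i"
        proof
          show "set xs \<subseteq> family F S i" using dec by (auto simp: xs_def fam)
          show "family F S i \<subseteq> set xs"
          proof
            fix X assume "X \<in> family F S i"
            then have X: "X \<in> F" "X \<subseteq> ground {..<n} S i" by (auto simp: fam)
            then have "code_set X \<in> set (codes_of F)" "set (tl (code_set X)) = X"
              using codes_of(2)[OF Fn] fin code_set_decode by auto
            then show "X \<in> set xs" using X by (auto simp: xs_def intro!: image_eqI[of _ _ "code_set X"])
          qed
        qed
        have "map code_set xs = filter (\<lambda>c. set (tl c) \<subseteq> ground {..<n} S i) (codes_of F)"
          unfolding xs_def map_map by (rule map_idI) (use dec in auto)
        then show "concat (map code_set xs) = ansF n F S []" by (simp add: ansF_def)
      qed
      \<comment> \<open>The program searches for a code, which amounts to searching for the set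
        because codes can be decoded.\<close>
      have inF_eq: "inF n F S (code_set X) = [of_bool (X \<in> family F S i)]" if "X \<subseteq> {..<n}" for X
      proof -
        have "finite X" using that finite_subset by blast
        then have X: "set (tl (code_set X)) = X" by (rule code_set_decode)
        then have "code_set X \<in> set (codes_of F) \<longleftrightarrow> X \<in> F"
          using codes_of(2)[OF Fn] dec by (metis imageI)
        then show ?thesis by (simp add: inF_def fam X)
      qed
      let ?time = "100 * n powr (A * i * c)" and ?space = "A * i * c * log 2 n + 100"
      have 1: "enumerates_and_answers (word_size B 100 n) ES MS (encode n {..<n} F) code_elem {..<n} (S i)
          ?time ?space"
        unfolding enumerates_and_answers_def
      proof (intro conjI exI[of _ "ansS n F S []"] ballI)
        show "set (ansS n F S []) = S i" using Si by (auto simp: ansS_def)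
        show "runs_within (word_size B 100 n) MS (code_elem q @ encode n {..<n} F) [of_bool (q \<in> S i)] ?time ?space" if "q \<in> {..<n}" for q
          using MS[rule_format, OF n V, of "[q]"] that by (simp add: inS_def code_elem_def)
      qed (use ES[rule_format, OF n V, of "[]"] in \<open>simp_all add: id\<close>, simp add: ansS_def)
      have 2: "enumerates_and_answers (word_size B 100 n) EU MU (encode n {..<n} F) code_elem {..<n} (ground {..<n} S i)
          ?time ?space"
        unfolding enumerates_and_answers_def
      proof (intro conjI exI[of _ "ansU n F S []"] ballI)
        show "set (ansU n F S []) = ground {..<n} S i" using ground_subset[of "{..<n}" S i] by (auto simp: ansU_def)
        show "runs_within (word_size B 100 n) MU (code_elem q @ encode n {..<n} F) [of_bool (q \<in> ground {..<n} S i)]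
          ?time ?space" if "q \<in> {..<n}" for q
          using MU[rule_format, OF n V, of "[q]"] that by (simp add: inU_def code_elem_def)
      qed (use EU[rule_format, OF n V, of "[]"] in \<open>simp_all add: id\<close>, simp add: ansU_def)
      have 3: "enumerates_and_answers (word_size B 100 n) EF MF (encode n {..<n} F) code_set (Pow {..<n}) (family F S i)
          ?time ?space"
        unfolding enumerates_and_answers_def
      proof (intro conjI exI[of _ xs] ballI)
        show "runs_within (word_size B 100 n) MF (code_set q @ encode n {..<n} F) [of_bool (q \<in> family F S i)]
          ?time ?space" if "q \<in> Pow {..<n}" for q
          using MF[rule_format, OF n V, of "code_set q"] that inF_eq[of q] by simp
      qed (use EF[rule_format, OF n V, of "[]"] xs in simp_all)
      show "let w = word_size B 100 n; inp = encode n U F; T = (100 :: nat) * n powr (A * i * c);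
             sp = A * i * c * log 2 n + (100 :: nat)
         in enumerates_and_answers w ES MS inp code_elem U (S i) T sp \<and>
            enumerates_and_answers w EU MU inp code_elem U (ground U S i) T sp \<and>
            enumerates_and_answers w EF MF inp code_set (Pow U) (family F S i) T sp"
        using 1 2 3 by (simp add: Let_def U)
    qed
  qed
qed

end
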